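(* Let $T$ be a continuous theory. If $T$ has a $(\kappa,\lambda)$-model where $\kappa>\lambda\geq\aleph_0$, then $T$ has an $(\aleph_1,\aleph_0)$-model.
   Context: Setting: continuous first-order logic for metric structures. Structures are complete metric spaces with metric $d$ bounded by $1$; formulas take values in $[0,1]$. $\mathcal{L}$ denotes the language of $T$. For an $\mathcal{L}$-structure $\mathcal{M}$ and $A\subset\mathcal{M}$, a definable predicate in $\mathcal{M}$ over $A$ is a function $P:\mathcal{M}^n\to[0,1]$ which is a uniform limit on $\mathcal{M}^n$ of a sequence of (interpretations of) $\mathcal{L}(A)$-formulas. Its zero set is $Z(P^{\mathcal{M}})=\{x\in\mathcal{M}^n : P(x)=0\}$. A set $D\subset\mathcal{M}^n$ is definable if $\mathrm{dist}(x,D)=\inf_{y\in D}\max_{1\le i\le n}d(x_i,y_i)$ is a definable predicate. A definable predicate $P$ is a definable distance predicate if $Z(P)$ is a definable set. The density character of a metric space is the least cardinality of a dense subset. For cardinals $\kappa>\lambda\geq\aleph_0$, a theory $T$ has a $(\kappa,\lambda)$-model if there are $\mathcal{M}\vDash T$ and a definable distance predicate $P$ in $\mathcal{M}$ (parameters from $\mathcal{M}$ allowed) such that $\mathcal{M}$ has density character $\kappa$ and $Z(P^{\mathcal{M}})$ has density character $\lambda$.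
   Formalization: The language of T is assumed countable; without this the claim fails: with ℵ₂ constants at pairwise distance 1 and a predicate with countably infinite zero set, T has an (ℵ₂,ℵ₀)-model but every model has density character at least ℵ₂. *)

theory Defs
  imports "HOL-Analysis.Analysis"
begin

unbundle cardinal_syntax

section \<open>Density character\<close>

text \<open>The topological space X has a dense subset of cardinality k, and none of smaller
  cardinality. For a cardinal k this says that k is the density character of X.\<close>

definition density_character_is :: "'a topology \<Rightarrow> 'k rel \<Rightarrow> bool" where
  "density_character_is X k \<longleftrightarrow>
     (\<exists>D \<subseteq> topspace X. X closure_of D = topspace X \<and> |D| =o k) \<and>
     (\<forall>D \<subseteq> topspace X. X closure_of D = topspace X \<longrightarrow> k \<le>o |D| )"

section \<open>Tuples\<close>

text \<open>The power \<open>M\<^sup>n\<close> is the set of lists of length n over M, with the maximum metric.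
  Inserting 0 only matters for the empty tuple.\<close>

definition tuples :: "nat \<Rightarrow> 'a set \<Rightarrow> 'a list set" where
  "tuples n M = {xs. length xs = n \<and> set xs \<subseteq> M}"

definition tuple_dist :: "('a \<Rightarrow> 'a \<Rightarrow> real) \<Rightarrow> 'a list \<Rightarrow> 'a list \<Rightarrow> real" where
  "tuple_dist d xs ys = Max (insert 0 (set (map2 d xs ys)))"

lemma tuple_dist_le_iff:
  assumes "\<And>x y. 0 \<le> d x y" "length xs = n" "length ys = n"
  shows "tuple_dist d xs ys \<le> r \<longleftrightarrow> 0 \<le> r \<and> (\<forall>i<n. d (xs ! i) (ys ! i) \<le> r)"
proof -
  have "set (map2 d xs ys) = (\<lambda>i. d (xs ! i) (ys ! i)) ` {..<n}"
    using assms(2,3) by (auto simp: set_zip image_iff)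
  then show ?thesis
    unfolding tuple_dist_def by (auto simp: Ball_def)
qed

lemma Metric_space_tuples:
  assumes "Metric_space M d"
  shows "Metric_space (tuples n M) (tuple_dist d)"
proof -
  interpret Metric_space M d by fact
  show ?thesis
  proof
    show "0 \<le> tuple_dist d xs ys" for xs ys
      unfolding tuple_dist_def by simp
    show "tuple_dist d xs ys = tuple_dist d ys xs" for xs ys
    proof -
      have "map2 d xs ys = map2 d ys xs"
        by (rule nth_equalityI) (auto simp: commute)
      then show ?thesis by (simp add: tuple_dist_def)
    qed
    show "tuple_dist d xs ys = 0 \<longleftrightarrow> xs = ys"
      if "xs \<in> tuples n M" "ys \<in> tuples n M" for xs ys
    proof -
      have len: "length xs = n" "length ys = n"
        and mem: "\<And>i. i < n \<Longrightarrow> xs ! i \<in> M" "\<And>i. i < n \<Longrightarrow> ys ! i \<in> M"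
        using that by (auto simp: tuples_def)
      have "0 \<le> tuple_dist d xs ys"
        unfolding tuple_dist_def by simp
      then have "tuple_dist d xs ys = 0 \<longleftrightarrow> tuple_dist d xs ys \<le> 0"
        by linarith
      also have "\<dots> \<longleftrightarrow> (\<forall>i<n. d (xs ! i) (ys ! i) \<le> 0)"
        by (simp add: tuple_dist_le_iff[where d = d, OF nonneg len])
      also have "\<dots> \<longleftrightarrow> (\<forall>i<n. xs ! i = ys ! i)"
      proof -
        have "d (xs ! i) (ys ! i) \<le> 0 \<longleftrightarrow> xs ! i = ys ! i" if "i < n" for i
          using zero[OF mem(1)[OF that] mem(2)[OF that]] nonneg[of "xs ! i" "ys ! i"] by linarith
        then show ?thesis by blast
      qed
      also have "\<dots> \<longleftrightarrow> xs = ys"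
        using len by (simp add: list_eq_iff_nth_eq)
      finally show ?thesis .
    qed
    show "tuple_dist d xs zs \<le> tuple_dist d xs ys + tuple_dist d ys zs"
      if "xs \<in> tuples n M" "ys \<in> tuples n M" "zs \<in> tuples n M" for xs ys zs
    proof -
      have len: "length xs = n" "length ys = n" "length zs = n"
        and mem: "\<And>i. i < n \<Longrightarrow> xs ! i \<in> M" "\<And>i. i < n \<Longrightarrow> ys ! i \<in> M"
          "\<And>i. i < n \<Longrightarrow> zs ! i \<in> M"
        using that by (auto simp: tuples_def)
      have 1: "0 \<le> tuple_dist d xs ys \<and> (\<forall>i<n. d (xs ! i) (ys ! i) \<le> tuple_dist d xs ys)"
        using tuple_dist_le_iff[where d = d and r = "tuple_dist d xs ys", OF nonneg len(1,2)] by simp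
      have 2: "0 \<le> tuple_dist d ys zs \<and> (\<forall>i<n. d (ys ! i) (zs ! i) \<le> tuple_dist d ys zs)"
        using tuple_dist_le_iff[where d = d and r = "tuple_dist d ys zs", OF nonneg len(2,3)] by simp
      have "d (xs ! i) (zs ! i) \<le> tuple_dist d xs ys + tuple_dist d ys zs" if "i < n" for i
        using conjunct2[OF 1, rule_format, OF that] conjunct2[OF 2, rule_format, OF that]
          triangle[OF mem(1)[OF that] mem(2)[OF that] mem(3)[OF that]]
        by linarith
      with 1 2 show ?thesis
        by (simp add: tuple_dist_le_iff[where d = d, OF nonneg len(1,3)])
    qed
  qed
qed

section \<open>Languages and formulas\<close>

text \<open>A language has function and predicate symbols, each with an arity and a modulus of uniform
  continuity. Constant symbols are the function symbols of arity 0.\<close>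

record ('f, 'p) language =
  funs :: "'f set"
  fun_arity :: "'f \<Rightarrow> nat"
  fun_modulus :: "'f \<Rightarrow> real \<Rightarrow> real"
  preds :: "'p set"
  pred_arity :: "'p \<Rightarrow> nat"
  pred_modulus :: "'p \<Rightarrow> real \<Rightarrow> real"

definition is_modulus :: "(real \<Rightarrow> real) \<Rightarrow> bool" where
  "is_modulus \<Delta> \<longleftrightarrow> (\<forall>\<epsilon>\<in>{0<..1}. \<Delta> \<epsilon> \<in> {0<..1})"

definition is_language :: "('f, 'p) language \<Rightarrow> bool" where
  "is_language L \<longleftrightarrow> (\<forall>f\<in>funs L. is_modulus (fun_modulus L f)) \<and>
                    (\<forall>p\<in>preds L. is_modulus (pred_modulus L p))"

text \<open>Descending from arbitrary cardinals to the first two infinite ones requires a countable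
  language: with uncountably many constants a theory can force all its infinite definable sets to
  be uncountable.\<close>

definition countable_language :: "('f, 'p) language \<Rightarrow> bool" where
  "countable_language L \<longleftrightarrow> countable (funs L) \<and> countable (preds L)"

datatype 'f tm = Var nat | Fn 'f "'f tm list"

fun tm_vars :: "'f tm \<Rightarrow> nat set" where
  "tm_vars (Var i) = {i}"
| "tm_vars (Fn f ts) = (\<Union>t\<in>set ts. tm_vars t)"

fun is_tm :: "('f, 'p) language \<Rightarrow> 'f tm \<Rightarrow> bool" where
  "is_tm L (Var i) \<longleftrightarrow> True"
| "is_tm L (Fn f ts) \<longleftrightarrow> f \<in> funs L \<and> length ts = fun_arity L f \<and> (\<forall>t\<in>set ts. is_tm L t)"

text \<open>Every continuous function from \<open>[0,1]\<^sup>n\<close> to \<open>[0,1]\<close> is an n-ary connective. Here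
  \<open>[0,1]\<^sup>n\<close> is the product of n copies of the unit interval indexed by \<open>{..<n}\<close>, so a
  connective is only ever applied to extensional functions on that index set.\<close>

definition is_connective :: "nat \<Rightarrow> ((nat \<Rightarrow> real) \<Rightarrow> real) \<Rightarrow> bool" where
  "is_connective n u \<longleftrightarrow>
     continuous_map (product_topology (\<lambda>_. top_of_set {0..1}) {..<n}) (top_of_set {0..1}) u"

datatype ('f, 'p) fm =
    DistF "'f tm" "'f tm"
  | PredF 'p "'f tm list"
  | ConnF "(nat \<Rightarrow> real) \<Rightarrow> real" "('f, 'p) fm list"
  | SupF nat "('f, 'p) fm"
  | InfF nat "('f, 'p) fm"

fun fm_vars :: "('f, 'p) fm \<Rightarrow> nat set" where
  "fm_vars (DistF s t) = tm_vars s \<union> tm_vars t"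
| "fm_vars (PredF p ts) = (\<Union>t\<in>set ts. tm_vars t)"
| "fm_vars (ConnF u \<phi>s) = (\<Union>\<phi>\<in>set \<phi>s. fm_vars \<phi>)"
| "fm_vars (SupF x \<phi>) = fm_vars \<phi> - {x}"
| "fm_vars (InfF x \<phi>) = fm_vars \<phi> - {x}"

fun is_fm :: "('f, 'p) language \<Rightarrow> ('f, 'p) fm \<Rightarrow> bool" where
  "is_fm L (DistF s t) \<longleftrightarrow> is_tm L s \<and> is_tm L t"
| "is_fm L (PredF p ts) \<longleftrightarrow> p \<in> preds L \<and> length ts = pred_arity L p \<and> (\<forall>t\<in>set ts. is_tm L t)"
| "is_fm L (ConnF u \<phi>s) \<longleftrightarrow> is_connective (length \<phi>s) u \<and> (\<forall>\<phi>\<in>set \<phi>s. is_fm L \<phi>)"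
| "is_fm L (SupF x \<phi>) \<longleftrightarrow> is_fm L \<phi>"
| "is_fm L (InfF x \<phi>) \<longleftrightarrow> is_fm L \<phi>"

text \<open>A theory is a set of closed conditions \<open>\<phi> = 0\<close>; the condition is represented by the
  sentence \<open>\<phi>\<close>.\<close>

definition is_theory :: "('f, 'p) language \<Rightarrow> ('f, 'p) fm set \<Rightarrow> bool" where
  "is_theory L T \<longleftrightarrow> (\<forall>\<phi>\<in>T. is_fm L \<phi> \<and> fm_vars \<phi> = {})"

section \<open>Metric structures\<close>

record ('f, 'p, 'a) metric_structure =
  univ :: "'a set"
  sdist :: "'a \<Rightarrow> 'a \<Rightarrow> real"
  fun_int :: "'f \<Rightarrow> 'a list \<Rightarrow> 'a"
  pred_int :: "'p \<Rightarrow> 'a list \<Rightarrow> real"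

definition is_structure :: "('f, 'p) language \<Rightarrow> ('f, 'p, 'a) metric_structure \<Rightarrow> bool" where
  "is_structure L M \<longleftrightarrow>
     univ M \<noteq> {} \<and>
     Metric_space (univ M) (sdist M) \<and>
     Metric_space.mcomplete (univ M) (sdist M) \<and>
     (\<forall>x\<in>univ M. \<forall>y\<in>univ M. sdist M x y \<le> 1) \<and>
     (\<forall>f\<in>funs L.
        (\<forall>xs\<in>tuples (fun_arity L f) (univ M). fun_int M f xs \<in> univ M) \<and>
        (\<forall>\<epsilon>\<in>{0<..1}. \<forall>xs\<in>tuples (fun_arity L f) (univ M). \<forall>ys\<in>tuples (fun_arity L f) (univ M).
           tuple_dist (sdist M) xs ys < fun_modulus L f \<epsilon> \<longrightarrow>
           sdist M (fun_int M f xs) (fun_int M f ys) \<le> \<epsilon>)) \<and>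
     (\<forall>p\<in>preds L.
        (\<forall>xs\<in>tuples (pred_arity L p) (univ M). pred_int M p xs \<in> {0..1}) \<and>
        (\<forall>\<epsilon>\<in>{0<..1}. \<forall>xs\<in>tuples (pred_arity L p) (univ M). \<forall>ys\<in>tuples (pred_arity L p) (univ M).
           tuple_dist (sdist M) xs ys < pred_modulus L p \<epsilon> \<longrightarrow>
           \<bar>pred_int M p xs - pred_int M p ys\<bar> \<le> \<epsilon>))"

fun tm_val :: "('f, 'p, 'a) metric_structure \<Rightarrow> 'f tm \<Rightarrow> (nat \<Rightarrow> 'a) \<Rightarrow> 'a" where
  "tm_val M (Var i) v = v i"
| "tm_val M (Fn f ts) v = fun_int M f (map (\<lambda>t. tm_val M t v) ts)"

fun fm_val :: "('f, 'p, 'a) metric_structure \<Rightarrow> ('f, 'p) fm \<Rightarrow> (nat \<Rightarrow> 'a) \<Rightarrow> real" where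
  "fm_val M (DistF s t) v = sdist M (tm_val M s v) (tm_val M t v)"
| "fm_val M (PredF p ts) v = pred_int M p (map (\<lambda>t. tm_val M t v) ts)"
| "fm_val M (ConnF u \<phi>s) v = u (\<lambda>i\<in>{..<length \<phi>s}. map (\<lambda>\<phi>. fm_val M \<phi> v) \<phi>s ! i)"
| "fm_val M (SupF x \<phi>) v = (SUP a\<in>univ M. fm_val M \<phi> (v(x := a)))"
| "fm_val M (InfF x \<phi>) v = (INF a\<in>univ M. fm_val M \<phi> (v(x := a)))"

definition is_model :: "('f, 'p) language \<Rightarrow> ('f, 'p) fm set \<Rightarrow> ('f, 'p, 'a) metric_structure \<Rightarrow> bool"
  where "is_model L T M \<longleftrightarrow>
     is_structure L M \<and> (\<forall>\<phi>\<in>T. \<forall>v. range v \<subseteq> univ M \<longrightarrow> fm_val M \<phi> v = 0)"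

section \<open>Definable predicates and definable sets\<close>

text \<open>The language \<open>L(A)\<close> and the expansion of M interpreting each new constant by itself. Any
  modulus would do for a constant.\<close>

definition lang_params :: "('f, 'p) language \<Rightarrow> 'a set \<Rightarrow> ('f + 'a, 'p) language" where
  "lang_params L A =
     \<lparr> funs = Inl ` funs L \<union> Inr ` A,
       fun_arity = case_sum (fun_arity L) (\<lambda>_. 0),
       fun_modulus = case_sum (fun_modulus L) (\<lambda>_ _. 1),
       preds = preds L,
       pred_arity = pred_arity L,
       pred_modulus = pred_modulus L \<rparr>"

definition struct_params :: "('f, 'p, 'a) metric_structure \<Rightarrow> ('f + 'a, 'p, 'a) metric_structure" where
  "struct_params M =
     \<lparr> univ = univ M,
       sdist = sdist M,
       fun_int = case_sum (fun_int M) (\<lambda>a _. a),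
       pred_int = pred_int M \<rparr>"

text \<open>The formulas below have their free variables among the first n, so the assignment
  \<open>nth xs\<close> is only used at indices below the length of \<open>xs\<close>.\<close>

definition definable_predicate ::
  "('f, 'p) language \<Rightarrow> ('f, 'p, 'a) metric_structure \<Rightarrow> 'a set \<Rightarrow> nat \<Rightarrow> ('a list \<Rightarrow> real) \<Rightarrow> bool"
  where "definable_predicate L M A n P \<longleftrightarrow>
     (\<forall>xs\<in>tuples n (univ M). P xs \<in> {0..1}) \<and>
     (\<exists>\<phi>. (\<forall>k. is_fm (lang_params L A) (\<phi> k) \<and> fm_vars (\<phi> k) \<subseteq> {..<n}) \<and>
          uniform_limit (tuples n (univ M))
            (\<lambda>k xs. fm_val (struct_params M) (\<phi> k) (nth xs)) P sequentially)"

definition zero_set :: "('f, 'p, 'a) metric_structure \<Rightarrow> nat \<Rightarrow> ('a list \<Rightarrow> real) \<Rightarrow> 'a list set" where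
  "zero_set M n P = {xs\<in>tuples n (univ M). P xs = 0}"

text \<open>The infimum is taken in the unit interval, so the distance to the empty set is 1; for
  nonempty D inserting 1 changes nothing, as the metric is bounded by 1.\<close>

definition dist_to :: "('f, 'p, 'a) metric_structure \<Rightarrow> 'a list set \<Rightarrow> 'a list \<Rightarrow> real" where
  "dist_to M D xs = Inf (insert 1 ((\<lambda>ys. tuple_dist (sdist M) xs ys) ` D))"

definition definable_set ::
  "('f, 'p) language \<Rightarrow> ('f, 'p, 'a) metric_structure \<Rightarrow> 'a set \<Rightarrow> nat \<Rightarrow> 'a list set \<Rightarrow> bool"
  where "definable_set L M A n D \<longleftrightarrow>
     D \<subseteq> tuples n (univ M) \<and> definable_predicate L M A n (dist_to M D)"

definition definable_distance_predicate ::
  "('f, 'p) language \<Rightarrow> ('f, 'p, 'a) metric_structure \<Rightarrow> 'a set \<Rightarrow> nat \<Rightarrow> ('a list \<Rightarrow> real) \<Rightarrow> bool"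
  where "definable_distance_predicate L M A n P \<longleftrightarrow>
     definable_predicate L M A n P \<and> definable_set L M A n (zero_set M n P)"

section \<open>Two-cardinal models\<close>

text \<open>The type of elements has to be fixed in order to assert the existence of a model. A complete
  metric space whose density character is the first uncountable cardinal has at most continuum many
  points, so the type of reals is large enough to carry an isomorphic copy of every model of that
  density character.\<close>

definition two_cardinal_model ::
  "('f, 'p) language \<Rightarrow> ('f, 'p) fm set \<Rightarrow> 'k rel \<Rightarrow> 'l rel \<Rightarrow> ('f, 'p, 'a) metric_structure \<Rightarrow> bool"
  where "two_cardinal_model L T \<kappa> \<mu> M \<longleftrightarrow>
     is_model L T M \<and>
     density_character_is (Metric_space.mtopology (univ M) (sdist M)) \<kappa> \<and>
     (\<exists>n P. definable_distance_predicate L M (univ M) n P \<and>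
            density_character_is
              (Metric_space.mtopology (zero_set M n P) (tuple_dist (sdist M))) \<mu>)"

end

theory Submission
  imports Defs "HOL-Library.Countable_Set_Type"
begin

text \<open>The homogeneous models of Vaught's argument are avoided: the new model is a limit of the given
  model M along an ultrafilter F on the set of all maps \<open>i :: 'o \<Rightarrow> S\<close>.

  Let \<open>D\<close> be dense in the zero set \<open>Z(P)\<close> with \<open>|D| = \<mu>\<close>, and U the set of coordinates of D. As
  \<open>\<mu> < \<kappa>\<close>, there is a set S in M of more than \<open>\<mu>\<close> points with pairwise distances at least \<open>e > 0\<close>. Close
  the coordinate maps \<open>i \<mapsto> i j\<close> under the functions of the language, approximate Skolem functions,
  an approximate nearest point map onto D, and a further operation: for functions \<open>f\<^sub>0, \<dots>, f\<^sub>n\<close> of a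
  parameter s, decide greedily for each \<open>f\<^sub>k\<close> either a value in U or that the value is outside U, so
  that more than \<open>\<mu>\<close> values of s respect all decisions. With this operation a type over countably many
  coordinates extends to one more coordinate without new values in U. By Zorn's lemma one obtains a
  type with uncountably many coordinates in which all values in U come from a countable set, and F is
  an ultrafilter containing it.

  The limits along F of functions from \<open>\<aleph>\<^sub>1\<close> coordinates form an elementarily equivalent model by
  the theorem of Los. The coordinates keep it from being separable, while the nearest point map shows
  that countably many tuples over U are dense in the zero set.\<close>

section \<open>Types without new values in a small set\<close>

text \<open>The obstacle is that new coordinates must not enrich the zero set. Call a set small if
  it has at most \<mu> elements. As U is small, a union of small sets indexed by U is small, so a
  function that is not outside U on a large set is constant on a large set. A large set survives
  finitely many decisions, but perhaps not infinitely many. Therefore the decisions are taken in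
  order type \<omega>, and only finite satisfiability is asked for; this is why one step starts from
  countably many coordinates. The decisions depend on the old coordinates. Once they have names
  among the terms, the old type already fixes them, so no step adds a value in U beyond those of
  terms without coordinates. These terms are countably many only because the operations are. Hence
  formulas with arbitrary continuous connectives are first approximated by countably many functions,
  and only countably many parameters of the distance predicate are named. The points of S are e
  apart because mere distinctness of coordinates would not survive the passage to limits.\<close>

text \<open>Names for functions of a family of parameters indexed by 'o. The term
  \<open>Quant m ts\<close> binds the variable m and stands for the value decided last by the greedy
  algorithm \<open>greedy_last\<close> below, applied to \<open>ts\<close> as functions of m. Binders range over
  natural numbers rather than over 'o, so that countably many parameters give countably many terms.\<close>

datatype 'o sk = Coord 'o | Bound nat | Op nat "'o sk list" | Quant nat "'o sk list"

instance sk :: (countable) countable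
  by countable_datatype

text \<open>Binders are counted besides occurrences, so an index outside this set can serve as a
  fresh variable without capture.\<close>

primrec bound_vars :: "'o sk \<Rightarrow> nat set" where
  "bound_vars (Coord j) = {}"
| "bound_vars (Bound n) = {n}"
| "bound_vars (Op k ts) = \<Union> (set (map bound_vars ts))"
| "bound_vars (Quant n ts) = insert n (\<Union> (set (map bound_vars ts)))"

text \<open>Turns a parameter into a variable: a term over the enlarged parameter set becomes a
  function of the new parameter that no longer mentions it, ready to be bound by
  \<open>Quant\<close>.\<close>

primrec abstract :: "'o \<Rightarrow> nat \<Rightarrow> 'o sk \<Rightarrow> 'o sk" where
  "abstract a m (Coord j) = (if j = a then Bound m else Coord j)"
| "abstract a m (Bound n) = Bound n"
| "abstract a m (Op k ts) = Op k (map (abstract a m) ts)"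
| "abstract a m (Quant n ts) = Quant n (map (abstract a m) ts)"

lemma finite_bound_vars [simp]: "finite (bound_vars t)"
  by (induction t) auto

lemma finite_set_sk [simp]: "finite (set_sk t)"
  by (induction t) auto

lemma set_sk_abstract: "set_sk (abstract a m t) \<subseteq> set_sk t - {a}"
  by (induction t) auto

text \<open>An enumeration of J makes every term over J the image of a term over the natural
  numbers, and the type of the latter is countable.\<close>

lemma countable_set_sk:
  fixes J :: "'o set"
  assumes "countable J"
  shows "countable {t. set_sk t \<subseteq> J}"
proof (cases "J = {}")
  case True
  have "\<exists>t' :: nat sk. t = map_sk (\<lambda>_. undefined) t'" if "set_sk t \<subseteq> {}" for t :: "'o sk"
  proof
    have "t = map_sk id t" by (simp add: sk.map_id)
    also have "\<dots> = map_sk ((\<lambda>_. undefined) \<circ> (\<lambda>_. 0 :: nat)) t"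
      by (rule sk.map_cong) (use that in auto)
    finally show "t = map_sk (\<lambda>_. undefined) (map_sk (\<lambda>_. 0 :: nat) t)"
      by (simp add: sk.map_comp)
  qed
  then have "{t :: 'o sk. set_sk t \<subseteq> J} \<subseteq> range (map_sk (\<lambda>_ :: nat. undefined))"
    using True by (auto simp: image_iff)
  then show ?thesis
    by (rule countable_subset) simp
next
  case False
  have "t = map_sk (from_nat_into J) (map_sk (to_nat_on J) t)" if "set_sk t \<subseteq> J" for t
  proof -
    have "t = map_sk id t" by (simp add: sk.map_id)
    also have "\<dots> = map_sk (from_nat_into J \<circ> to_nat_on J) t"
      by (rule sk.map_cong) (use that assms in auto)
    finally show ?thesis by (simp add: sk.map_comp)
  qed
  then have "{t. set_sk t \<subseteq> J} \<subseteq> range (map_sk (from_nat_into J))"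
    by blast
  then show ?thesis
    by (rule countable_subset) simp
qed

section \<open>Ultrafilters from the finite intersection property\<close>

lemma ultrafilter_exists:
  assumes fip: "\<And>X. finite X \<Longrightarrow> X \<subseteq> \<B> \<Longrightarrow> \<Inter> X \<noteq> {}"
  obtains F :: "'i filter" where "F \<noteq> bot"
    "\<And>P. eventually P F \<or> eventually (\<lambda>i. \<not> P i) F"
    "\<And>A. A \<in> \<B> \<Longrightarrow> eventually (\<lambda>i. i \<in> A) F"
proof -
  define \<A> where "\<A> = {\<C>. \<B> \<subseteq> \<C> \<and> (\<forall>X. finite X \<longrightarrow> X \<subseteq> \<C> \<longrightarrow> \<Inter> X \<noteq> {})}"
  have "\<exists>\<M>\<in>\<A>. \<forall>\<C>\<in>\<A>. \<M> \<subseteq> \<C> \<longrightarrow> \<C> = \<M>"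
  proof (rule subset_Zorn_nonempty)
    show "\<A> \<noteq> {}" using fip unfolding \<A>_def by blast
    fix C assume C: "C \<noteq> {}" "subset.chain \<A> C"
    have "\<Inter> X \<noteq> {}" if "finite X" "X \<subseteq> \<Union> C" for X
    proof -
      obtain Y where "Y \<in> C" "X \<subseteq> Y"
        using finite_subset_Union_chain[OF \<open>finite X\<close> \<open>X \<subseteq> \<Union> C\<close> C] by blast
      then show ?thesis
        using C that(1) unfolding \<A>_def subset_chain_def by blast
    qed
    then show "\<Union> C \<in> \<A>"
      using C unfolding \<A>_def subset_chain_def by blast
  qed
  then obtain \<M> where \<M>: "\<M> \<in> \<A>" "\<And>\<C>. \<C> \<in> \<A> \<Longrightarrow> \<M> \<subseteq> \<C> \<Longrightarrow> \<C> = \<M>"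
    by blast
  have ne: "\<Inter> X \<noteq> {}" if "finite X" "X \<subseteq> \<M>" for X
    using \<M>(1) that unfolding \<A>_def by blast
  have mem: "A \<in> \<M>" if A: "\<And>X. finite X \<Longrightarrow> X \<subseteq> \<M> \<Longrightarrow> A \<inter> \<Inter> X \<noteq> {}" for A
  proof -
    have "\<Inter> X \<noteq> {}" if X: "finite X" "X \<subseteq> insert A \<M>" for X
    proof -
      have "A \<inter> \<Inter> (X - {A}) \<subseteq> \<Inter> X" by blast
      moreover have "A \<inter> \<Inter> (X - {A}) \<noteq> {}"
        using X by (intro A) auto
      ultimately show ?thesis by blast
    qed
    then have "insert A \<M> \<in> \<A>"
      using \<M>(1) unfolding \<A>_def by blast
    from \<M>(2)[OF this] show ?thesis by blast
  qed
  \<comment> \<open>If neither A nor its complement belonged to the maximal family, one finite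
    subfamily would avoid A and another its complement, and together they would have empty
    intersection.\<close>
  have dich: "A \<in> \<M> \<or> - A \<in> \<M>" for A
  proof (rule ccontr)
    assume "\<not> ?thesis"
    then obtain X Y where "finite X" "X \<subseteq> \<M>" "A \<inter> \<Inter> X = {}" "finite Y" "Y \<subseteq> \<M>" "- A \<inter> \<Inter> Y = {}"
      using mem[of A] mem[of "- A"] by metis
    then have "\<Inter> X \<inter> \<Inter> Y = {}" by blast
    then have "\<Inter> (X \<union> Y) = {}" by (simp only: Inter_Un_distrib)
    moreover have "finite (X \<union> Y)" "X \<union> Y \<subseteq> \<M>"
      using \<open>finite X\<close> \<open>finite Y\<close> \<open>X \<subseteq> \<M>\<close> \<open>Y \<subseteq> \<M>\<close> by auto
    ultimately show False using ne by blast
  qed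
  define F where "F = (INF A\<in>\<M>. principal A)"
  have ev: "eventually (\<lambda>i. i \<in> A) F" if "A \<in> \<M>" for A
    unfolding F_def using that
    by (intro eventually_INF1) (auto simp: eventually_principal)
  have "F \<noteq> bot"
    unfolding F_def
  proof (rule INF_filter_not_bot)
    fix X assume "X \<subseteq> \<M>" "finite X"
    then show "(INF A\<in>X. principal A) \<noteq> bot"
      using ne[of X] by (simp add: INF_principal_finite principal_eq_bot_iff)
  qed
  moreover have "eventually P F \<or> eventually (\<lambda>i. \<not> P i) F" for P
    using dich[of "Collect P"] ev[of "Collect P"] ev[of "- Collect P"] by auto
  moreover have "eventually (\<lambda>i. i \<in> A) F" if "A \<in> \<B>" for A
    using ev \<M>(1) that unfolding \<A>_def by blast
  ultimately show thesis using that by blast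
qed

text \<open>In the application \<open>small\<close> means cardinality at most \<mu>; S is large, and
  \<open>small_UN\<close> holds because U has at most \<mu> elements. The point z outside U stands
  for the decision None, so that every decision has a name among the elements. The point s0 replaces
  coordinates outside S.\<close>

locale greedy =
  fixes S U :: "'a set" and small :: "'a set \<Rightarrow> bool" and G :: "nat \<Rightarrow> 'a list \<Rightarrow> 'a" and z s0 :: 'a
  assumes small_mono: "A \<subseteq> B \<Longrightarrow> small B \<Longrightarrow> small A"
    and small_Un: "small A \<Longrightarrow> small B \<Longrightarrow> small (A \<union> B)"
    and small_UN: "(\<And>u. u \<in> U \<Longrightarrow> small (H u)) \<Longrightarrow> small (\<Union>u\<in>U. H u)"
    and small_finite: "finite A \<Longrightarrow> small A"
    and S_big: "\<not> small S"
    and z: "z \<notin> U"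
    and s0: "s0 \<in> S"
begin

definition tr :: "'a \<Rightarrow> 'a option" where
  "tr x = (if x \<in> U then Some x else None)"

primrec untr :: "'a option \<Rightarrow> 'a" where
  "untr None = z"
| "untr (Some u) = u"

text \<open>Listing functions one by one, the value of each is decided so that the set of arguments that
  respect all decisions stays large: None stands for all values outside U, and since U is small
  some value in U is taken on a large set if None is not possible.\<close>

definition greedy_val :: "('a \<Rightarrow> 'a) \<Rightarrow> 'a set \<Rightarrow> 'a option" where
  "greedy_val f X = (if \<not> small {s \<in> X. f s \<notin> U} then None
     else Some (SOME u. u \<in> U \<and> \<not> small {s \<in> X. f s = u}))"

text \<open>Lists are read from the right: the head is decided last, on the set where all decisions
  for the tail are respected. Hence the reversed enumeration in \<open>good_extend\<close>.\<close>

primrec greedy_set :: "('a \<Rightarrow> 'a) list \<Rightarrow> 'a set" where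
  "greedy_set [] = S"
| "greedy_set (f # fs) = {s \<in> greedy_set fs. tr (f s) = greedy_val f (greedy_set fs)}"

primrec greedy_last :: "('a \<Rightarrow> 'a) list \<Rightarrow> 'a option" where
  "greedy_last [] = None"
| "greedy_last (f # fs) = greedy_val f (greedy_set fs)"

lemma greedy_val_cases:
  assumes "\<not> small X"
  shows "greedy_val f X = None \<and> \<not> small {s \<in> X. f s \<notin> U} \<or>
    (\<exists>u\<in>U. greedy_val f X = Some u \<and> \<not> small {s \<in> X. f s = u})"
proof (cases "small {s \<in> X. f s \<notin> U}")
  case True
  have "\<exists>u. u \<in> U \<and> \<not> small {s \<in> X. f s = u}"
  proof (rule ccontr)
    assume "\<not> ?thesis"
    then have "small (\<Union>u\<in>U. {s \<in> X. f s = u})"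
      by (intro small_UN) blast
    from small_Un[OF True this] have "small X"
      by (rule small_mono[rotated]) blast
    with assms show False ..
  qed
  from someI_ex[OF this] True show ?thesis
    unfolding greedy_val_def by auto
qed (auto simp: greedy_val_def)

lemma greedy_val_big:
  assumes "\<not> small X"
  shows "\<not> small {s \<in> X. tr (f s) = greedy_val f X}"
  using greedy_val_cases[OF assms, of f]
proof (elim disjE bexE conjE)
  assume "greedy_val f X = None" "\<not> small {s \<in> X. f s \<notin> U}"
  moreover have "{s \<in> X. tr (f s) = None} = {s \<in> X. f s \<notin> U}"
    by (auto simp: tr_def)
  ultimately show ?thesis by simp
next
  fix u assume u: "u \<in> U" "greedy_val f X = Some u" "\<not> small {s \<in> X. f s = u}"
  moreover have "{s \<in> X. tr (f s) = Some u} = {s \<in> X. f s = u}"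
    using u(1) by (auto simp: tr_def)
  ultimately show ?thesis by simp
qed

lemma greedy_set_big: "\<not> small (greedy_set fs)"
  by (induction fs) (use S_big greedy_val_big in auto)

lemma greedy_set_subset: "greedy_set fs \<subseteq> S"
  by (induction fs) auto

text \<open>Naming a decision by an element loses nothing, because decided values lie in U and z
  does not. So the trace of a \<open>Quant\<close> term is the decision itself.\<close>

lemma tr_untr_greedy_last: "tr (untr (greedy_last fs)) = greedy_last fs"
proof (cases fs)
  case (Cons f gs)
  then show ?thesis
    using greedy_val_cases[OF greedy_set_big, of f gs] z by (auto simp: tr_def)
qed (use z in \<open>auto simp: tr_def\<close>)

lemma untr_greedy_last: "untr (greedy_last fs) \<in> insert z U"
  using tr_untr_greedy_last[of fs] by (cases "greedy_last fs") (auto simp: tr_def split: if_splits)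

section \<open>Evaluation of terms\<close>

definition guard :: "'a \<Rightarrow> 'a" where
  "guard x = (if x \<in> S then x else s0)"

text \<open>Through \<open>guard\<close>, every assignment and not only one into S gives coordinates
  in S. So a function named by a term takes admissible values at all indices, rather than at almost
  all.\<close>

fun eval :: "'o sk \<Rightarrow> ('o \<Rightarrow> 'a) \<Rightarrow> (nat \<Rightarrow> 'a) \<Rightarrow> 'a" where
  "eval (Coord j) i b = guard (i j)"
| "eval (Bound n) i b = guard (b n)"
| "eval (Op k ts) i b = G k (map (\<lambda>t. eval t i b) ts)"
| "eval (Quant m ts) i b = untr (greedy_last (map (\<lambda>t s. eval t i (b(m := s))) ts))"

lemma eval_cong:
  "(\<And>j. j \<in> set_sk t \<Longrightarrow> i j = i' j) \<Longrightarrow> eval t i b = eval t i' b"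
proof (induction t arbitrary: b)
  case (Op k ts)
  have "map (\<lambda>t. eval t i b) ts = map (\<lambda>t. eval t i' b) ts"
    by (intro map_cong refl Op.IH) (use Op.prems in auto)
  then show ?case by (simp only: eval.simps)
next
  case (Quant m ts)
  have "map (\<lambda>t s. eval t i (b(m := s))) ts = map (\<lambda>t s. eval t i' (b(m := s))) ts"
    by (intro map_cong refl ext Quant.IH) (use Quant.prems in auto)
  then show ?case by (simp only: eval.simps)
qed auto

lemma eval_unused:
  "m \<notin> bound_vars t \<Longrightarrow> eval t i (b(m := s)) = eval t i b"
proof (induction t arbitrary: b)
  case (Op k ts)
  have "map (\<lambda>t. eval t i (b(m := s))) ts = map (\<lambda>t. eval t i b) ts"
    by (intro map_cong refl Op.IH) (use Op.prems in auto)
  then show ?case by (simp only: eval.simps)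
next
  case (Quant n ts)
  have "m \<noteq> n" using Quant.prems by auto
  have "map (\<lambda>t s'. eval t i (b(n := s', m := s))) ts = map (\<lambda>t s'. eval t i (b(n := s'))) ts"
    by (intro map_cong refl ext Quant.IH) (use Quant.prems in auto)
  then show ?case
    by (simp only: eval.simps fun_upd_twist[OF \<open>m \<noteq> n\<close>])
qed auto

lemma eval_abstract:
  "m \<notin> bound_vars t \<Longrightarrow> eval (abstract a m t) i b = eval t (i(a := b m)) b"
proof (induction t arbitrary: b)
  case (Op k ts)
  have "map ((\<lambda>t. eval t i b) \<circ> abstract a m) ts = map (\<lambda>t. eval t (i(a := b m)) b) ts"
    unfolding comp_def by (intro map_cong refl Op.IH) (use Op.prems in auto)
  then show ?case by (simp only: abstract.simps eval.simps map_map)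
next
  case (Quant n ts)
  have "m \<noteq> n" using Quant.prems by auto
  have "eval (abstract a m t) i (b(n := s)) = eval t (i(a := b m)) (b(n := s))" if "t \<in> set ts" for t s
  proof -
    have "(b(n := s)) m = b m" using \<open>m \<noteq> n\<close> by simp
    moreover have "m \<notin> bound_vars t" using Quant.prems that by auto
    ultimately show ?thesis using Quant.IH[OF that, of "b(n := s)"] by metis
  qed
  then have "map ((\<lambda>t s. eval t i (b(n := s))) \<circ> abstract a m) ts
      = map (\<lambda>t s. eval t (i(a := b m)) (b(n := s))) ts"
    unfolding comp_def by (intro map_cong refl ext) blast
  then show ?case by (simp only: abstract.simps eval.simps map_map)
qed auto

section \<open>Types and their realizations\<close>

definition ev :: "'o sk \<Rightarrow> ('o \<Rightarrow> 'a) \<Rightarrow> 'a" where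
  "ev t i = eval t i (\<lambda>_. s0)"

lemma eval_abstract_upd:
  assumes "m \<notin> bound_vars t"
  shows "eval (abstract a m t) i ((\<lambda>_. s0)(m := s)) = ev t (i(a := s))"
  using eval_abstract[OF assms, of a i "(\<lambda>_. s0)(m := s)"] eval_unused[OF assms]
  by (simp add: ev_def)

text \<open>Injectivity is a demand of its own, since traces do not tell values outside U apart.
  Together with the separation of S it keeps the parameters in K at a fixed distance from each
  other.\<close>

definition sat :: "('o sk \<times> 'a option) set \<Rightarrow> 'o set \<Rightarrow> ('o \<Rightarrow> 'a) \<Rightarrow> bool" where
  "sat p K i \<longleftrightarrow> range i \<subseteq> S \<and> inj_on i K \<and> (\<forall>x\<in>p. tr (ev (fst x) i) = snd x)"

text \<open>The argument only fixes the index type, which does not occur in the type of the result.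
  By \<open>eval_cong\<close> any other assignment would give the same values.\<close>

definition closed_vals :: "'o itself \<Rightarrow> 'a set" where
  "closed_vals _ = (\<lambda>t :: 'o sk. ev t (\<lambda>_. s0)) ` {t. set_sk t = {}}"

text \<open>A finitely satisfiable type over the parameters J, in which every value in U is the value of
  a term without parameters.\<close>

definition good :: "'o set \<Rightarrow> ('o sk \<times> 'a option) set \<Rightarrow> bool" where
  "good J p \<longleftrightarrow> fst ` p = {t. set_sk t \<subseteq> J} \<and>
     (\<forall>q\<subseteq>p. finite q \<longrightarrow> (\<forall>K\<subseteq>J. finite K \<longrightarrow> (\<exists>i. sat q K i))) \<and>
     snd ` p \<subseteq> insert None (Some ` closed_vals TYPE('o))"

lemma good_satD:
  assumes "good J p" "q \<subseteq> p" "finite q" "K \<subseteq> J" "finite K"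
  shows "\<exists>i. sat q K i"
  using assms unfolding good_def by simp

lemma good_fst: "good J p \<Longrightarrow> fst ` p = {t. set_sk t \<subseteq> J}"
  by (simp only: good_def)

lemma good_snd: "good J p \<Longrightarrow> (snd ` p :: 'a option set) \<subseteq> insert None (Some ` closed_vals TYPE('o))"
  for J :: "'o set"
  by (simp only: good_def)

text \<open>Enumerate the terms over the enlarged set of parameters. The values that the greedy algorithm
  decides for them, as functions of the new parameter, are named by terms over J, so p already
  determines them.\<close>

lemma good_extend:
  fixes J :: "'o set"
  assumes p: "good J p" and J: "countable J" and a: "a \<notin> J"
  obtains p' where "good (insert a J) p'" "p \<subseteq> p'"
proof -
  define T where "T = {t. set_sk t \<subseteq> insert a J}"
  have "countable T"
    unfolding T_def using J by (intro countable_set_sk) auto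
  have "T \<noteq> {}"
    unfolding T_def using sk.set(1)[of a] by blast
  define f where "f = from_nat_into T"
  have range_f: "range f = T"
    unfolding f_def using \<open>T \<noteq> {}\<close> \<open>countable T\<close> by (rule range_from_nat_into)
  define fs where "fs n = map f (rev [0..<n])" for n
  have "\<exists>m. m \<notin> (\<Union>t\<in>set (fs n). bound_vars t)" for n
    by (intro ex_new_if_finite) auto
  then obtain m where m: "\<And>n t. t \<in> set (fs n) \<Longrightarrow> m n \<notin> bound_vars t"
    by (metis UN_I)
  \<comment> \<open>The head of \<open>fs (Suc n)\<close> is \<open>f n\<close>, so
    \<open>Qt n\<close> names the decision about \<open>f n\<close> made after those about all
    earlier terms. Abstracting a makes it a term over J.\<close>
  define Qt where "Qt n = Quant (m (Suc n)) (map (abstract a (m (Suc n))) (fs (Suc n)))" for n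
  define L where "L i n = map (\<lambda>t s. ev t (i(a := s))) (fs n)" for i n
  have L_Suc: "L i (Suc n) = (\<lambda>s. ev (f n) (i(a := s))) # L i n" for i n
    by (simp add: L_def fs_def)
  have tr_Qt: "tr (ev (Qt n) i) = greedy_last (L i (Suc n))" for n i
  proof -
    have "map (\<lambda>t s. eval t i ((\<lambda>_. s0)(m (Suc n) := s))) (map (abstract a (m (Suc n))) (fs (Suc n)))
        = L i (Suc n)"
      unfolding L_def map_map by (intro map_cong ext) (auto simp: eval_abstract_upd m)
    then show ?thesis
      unfolding Qt_def ev_def eval.simps tr_untr_greedy_last by simp
  qed
  have "set_sk (Qt n) \<subseteq> J" for n
  proof -
    have "set_sk t \<subseteq> insert a J" if "t \<in> set (fs (Suc n))" for t
      using that range_f unfolding fs_def T_def by auto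
    then show ?thesis
      unfolding Qt_def using set_sk_abstract[of a "m (Suc n)"] by fastforce
  qed
  then have "\<exists>v. (Qt n, v) \<in> p" for n
    using good_fst[OF p] by (metis (mono_tags, lifting) fst_conv imageE mem_Collect_eq surj_pair)
  \<comment> \<open>Although the greedy run depends on i, p fixes the trace of \<open>Qt n\<close>,
    so the decision about \<open>f n\<close> is the same for all i that realize this
    condition.\<close>
  then obtain w where w: "\<And>n. (Qt n, w n) \<in> p" by metis
  have key: "\<exists>i s. sat q K i \<and> s \<in> S \<and> s \<notin> i ` K \<and> (\<forall>n<N. tr (ev (f n) (i(a := s))) = w n)"
    if q: "q \<subseteq> p" "finite q" and K: "K \<subseteq> J" "finite K" for q K N
  proof -
    have fin: "finite (q \<union> (\<lambda>n. (Qt n, w n)) ` {..<N})" "q \<union> (\<lambda>n. (Qt n, w n)) ` {..<N} \<subseteq> p"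
      using q w by auto
    obtain i where i: "sat (q \<union> (\<lambda>n. (Qt n, w n)) ` {..<N}) K i"
      using good_satD[OF p fin(2,1) K] by blast
    have "\<not> greedy_set (L i N) \<subseteq> i ` K"
      using greedy_set_big small_mono small_finite[OF finite_imageI[OF K(2), of i]] by metis
    then obtain s where s: "s \<in> greedy_set (L i N)" "s \<notin> i ` K" by blast
    have "\<forall>n<N. tr (ev (f n) (i(a := s))) = greedy_last (L i (Suc n))"
      using s(1) by (induction N) (auto simp: L_Suc less_Suc_eq)
    moreover have "\<forall>n<N. greedy_last (L i (Suc n)) = w n"
    proof (intro allI impI)
      fix n assume "n < N"
      then have "(Qt n, w n) \<in> q \<union> (\<lambda>n. (Qt n, w n)) ` {..<N}" by blast
      then have "tr (ev (fst (Qt n, w n)) i) = snd (Qt n, w n)"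
        using i unfolding sat_def by blast
      then show "greedy_last (L i (Suc n)) = w n"
        by (simp only: tr_Qt fst_conv snd_conv)
    qed
    moreover have "sat q K i"
      using i unfolding sat_def by auto
    ultimately show ?thesis
      using s greedy_set_subset by (metis subsetD)
  qed
  define p' where "p' = range (\<lambda>n. (f n, w n))"
  have "good (insert a J) p'"
    unfolding good_def
  proof (intro conjI allI impI)
    show "fst ` p' = {t. set_sk t \<subseteq> insert a J}"
      unfolding p'_def image_image using range_f T_def by simp
    show "snd ` p' \<subseteq> insert None (Some ` closed_vals TYPE('o))"
    proof -
      have "w n \<in> snd ` p" for n using w[of n] by force
      then have "snd ` p' \<subseteq> snd ` p" unfolding p'_def by auto
      then show ?thesis using good_snd[OF p] by (rule order_trans)
    qed
    fix q K assume q: "q \<subseteq> p'" "finite q" and K: "K \<subseteq> insert a J" "finite K"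
    obtain A where A: "finite A" "q = (\<lambda>n. (f n, w n)) ` A"
      using finite_subset_image[of q "\<lambda>n. (f n, w n)" UNIV] q unfolding p'_def by auto
    obtain N where N: "\<And>n. n \<in> A \<Longrightarrow> n < N"
      using finite_nat_set_iff_bounded[of A] A(1) by auto
    obtain i s where i: "sat {} (K - {a}) i" "s \<in> S" "s \<notin> i ` (K - {a})"
        "\<And>n. n < N \<Longrightarrow> tr (ev (f n) (i(a := s))) = w n"
      using key[of "{}" "K - {a}" N] K by auto
    have "sat q K (i(a := s))"
      unfolding sat_def
    proof (intro conjI)
      show "range (i(a := s)) \<subseteq> S"
        using i unfolding sat_def by auto
      show "inj_on (i(a := s)) K"
        using i unfolding sat_def inj_on_def by (auto simp: image_iff)
      show "\<forall>x\<in>q. tr (ev (fst x) (i(a := s))) = snd x"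
        using i(4) N unfolding A(2) by auto
    qed
    then show "\<exists>i. sat q K i" by (rule exI[of _ "i(a := s)"])
  qed
  moreover have "p \<subseteq> p'"
  proof
    fix x assume x: "x \<in> p"
    obtain t v where tv: "x = (t, v)" by fastforce
    have "set_sk t \<subseteq> J"
      using good_fst[OF p] x tv by force
    then obtain n where n: "t = f n"
      using range_f unfolding T_def by blast
    obtain i s where i: "sat {x} {} i" "\<And>k. k < Suc n \<Longrightarrow> tr (ev (f k) (i(a := s))) = w k"
      using key[of "{x}" "{}" "Suc n"] x by auto
    \<comment> \<open>A term over J does not see the new coordinate, so v and \<open>w n\<close> are
      traces of one value.\<close>
    have "ev t (i(a := s)) = ev t i"
      unfolding ev_def using \<open>set_sk t \<subseteq> J\<close> a by (intro eval_cong) auto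
    then have "v = w n"
      using i(1) i(2)[of n] n tv unfolding sat_def by auto
    then show "x \<in> p'"
      unfolding p'_def tv n by blast
  qed
  ultimately show thesis using that by blast
qed

text \<open>By \<open>good_extend\<close> a maximal good type cannot have a countable parameter set.
  The parameter set can be read off from the coordinate terms in the type, so Zorn's lemma is
  applied to the types alone.\<close>

lemma good_exists:
  assumes "uncountable (UNIV :: 'o set)"
  obtains J :: "'o set" and p where "good J p" "uncountable J"
proof -
  define \<A> where "\<A> = {p :: ('o sk \<times> 'a option) set. \<exists>J. good J p}"
  define D where "D p = {j. Coord j \<in> fst ` p}" for p :: "('o sk \<times> 'a option) set"
  have D: "J = D p" if "good J p" for J p
    using good_fst[OF that] unfolding D_def by auto
  have D_mono: "p \<subseteq> q \<Longrightarrow> D p \<subseteq> D q" for p q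
    unfolding D_def by blast
  have "\<exists>p\<in>\<A>. \<forall>q\<in>\<A>. p \<subseteq> q \<longrightarrow> q = p"
  proof (rule subset_Zorn_nonempty)
    \<comment> \<open>Without parameters the type is forced, since each closed term has a single
      value. These are the values in U that all extensions may repeat.\<close>
    define p0 where "p0 = (\<lambda>t :: 'o sk. (t, tr (ev t (\<lambda>_. s0)))) ` {t. set_sk t \<subseteq> {}}"
    have "sat q {} (\<lambda>_. s0)" if "q \<subseteq> p0" for q
      unfolding sat_def using that s0 unfolding p0_def by auto
    then have "\<exists>i. sat q K i" if "q \<subseteq> p0" "K \<subseteq> {}" for q K
      using that by auto
    moreover have "fst ` p0 = {t. set_sk t \<subseteq> {}}"
      by (simp add: p0_def image_image)
    moreover have "snd ` p0 \<subseteq> insert None (Some ` closed_vals TYPE('o))"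
      by (auto simp: p0_def tr_def closed_vals_def)
    ultimately have "good {} p0"
      unfolding good_def by blast
    then have "p0 \<in> \<A>" unfolding \<A>_def by (intro CollectI exI)
    then show "\<A> \<noteq> {}" by blast
    fix C assume C: "C \<noteq> {}" "subset.chain \<A> C"
    have gC: "good (D p) p" if "p \<in> C" for p
    proof -
      have "p \<in> \<A>" using C(2) that unfolding subset_chain_def by blast
      then obtain J where "good J p" unfolding \<A>_def by auto
      then show ?thesis using D[OF \<open>good J p\<close>] by (simp only:)
    qed
    have fin: "\<exists>p\<in>C. K \<subseteq> D p" if K: "finite K" "K \<subseteq> \<Union> (D ` C)" for K
    proof -
      have "X \<subseteq> Y \<or> Y \<subseteq> X" if "X \<in> C" "Y \<in> C" for X Y
        using C(2) that unfolding subset_chain_def by blast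
      then have "subset.chain UNIV (D ` C)"
        unfolding subset_chain_def using D_mono by (metis (no_types, lifting) imageE subset_UNIV)
      moreover have "D ` C \<noteq> {}" using C(1) by simp
      ultimately obtain B where B: "B \<in> D ` C" "K \<subseteq> B"
        using finite_subset_Union_chain[OF K] by metis
      then show ?thesis by blast
    qed
    have "good (\<Union> (D ` C)) (\<Union> C)"
      unfolding good_def
    proof (intro conjI allI impI)
      show "fst ` \<Union> C = {t. set_sk t \<subseteq> \<Union> (D ` C)}"
      proof (intro set_eqI iffI)
        fix t assume "t \<in> fst ` \<Union> C"
        then obtain p where p: "p \<in> C" "t \<in> fst ` p" by auto
        then have "set_sk t \<subseteq> D p" using good_fst[OF gC[OF p(1)]] by simp
        then show "t \<in> {t. set_sk t \<subseteq> \<Union> (D ` C)}" using p by auto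
      next
        fix t assume "t \<in> {t. set_sk t \<subseteq> \<Union> (D ` C)}"
        then obtain p where p: "p \<in> C" "set_sk t \<subseteq> D p"
          using fin[OF finite_set_sk, of t] by auto
        then have "t \<in> fst ` p" using good_fst[OF gC[OF p(1)]] by simp
        then show "t \<in> fst ` \<Union> C" using p(1) by blast
      qed
      show "snd ` \<Union> C \<subseteq> insert None (Some ` closed_vals TYPE('o))"
      proof
        fix v assume "v \<in> snd ` \<Union> C"
        then obtain p where p: "p \<in> C" "v \<in> snd ` p" by auto
        then show "v \<in> insert None (Some ` closed_vals TYPE('o))"
          using subsetD[OF good_snd[OF gC[OF p(1)]] p(2)] by simp
      qed
      fix q K assume q: "q \<subseteq> \<Union> C" "finite q" and K: "K \<subseteq> \<Union> (D ` C)" "finite K"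
      obtain p1 where p1: "p1 \<in> C" "q \<subseteq> p1"
        using finite_subset_Union_chain[OF q(2) q(1) C] by blast
      obtain p2 where p2: "p2 \<in> C" "K \<subseteq> D p2" using fin K by blast
      have "p1 \<subseteq> p2 \<or> p2 \<subseteq> p1" using C p1 p2 unfolding subset_chain_def by auto
      then obtain p where p: "p \<in> C" "q \<subseteq> p" "K \<subseteq> D p"
        using p1 p2 D_mono by (metis order_trans)
      then show "\<exists>i. sat q K i" using good_satD[OF gC[OF p(1)] p(2) q(2) p(3) K(2)] by simp
    qed
    then show "\<Union> C \<in> \<A>" unfolding \<A>_def by (intro CollectI exI)
  qed
  then obtain p where p: "p \<in> \<A>" "\<And>q. q \<in> \<A> \<Longrightarrow> p \<subseteq> q \<Longrightarrow> q = p" by blast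
  then obtain J where J: "good J p" unfolding \<A>_def by auto
  have "uncountable J"
  proof
    assume "countable J"
    then obtain a where a: "a \<notin> J" using assms by (metis UNIV_eq_I)
    obtain p' where p': "good (insert a J) p'" "p \<subseteq> p'"
      using good_extend[OF J \<open>countable J\<close> a] by blast
    then have "p' = p" using p unfolding \<A>_def by blast
    then show False using D[OF p'(1)] D[OF J] a by auto
  qed
  with J show thesis using that by blast
qed

end

section \<open>Uniform continuity and separability of formulas\<close>

lemma ultrafilter_tendsto_compact:
  assumes ultra: "\<And>P. eventually P F \<or> eventually (\<lambda>i. \<not> P i) F" and "F \<noteq> bot"
    and "compact K" and "eventually (\<lambda>i. h i \<in> K) F"
  shows "\<exists>l\<in>K. (h \<longlongrightarrow> l) F"
proof -
  have "eventually (\<lambda>x. x \<in> K) (filtermap h F)" "filtermap h F \<noteq> bot"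
    using assms by (auto simp: eventually_filtermap filtermap_bot_iff)
  then obtain l where l: "l \<in> K" "inf (nhds l) (filtermap h F) \<noteq> bot"
    using \<open>compact K\<close> unfolding compact_filter by blast
  \<comment> \<open>Compactness gives only a cluster point. For an ultrafilter it is a limit, as the
    complement of a neighbourhood cannot belong to the filter.\<close>
  have "eventually (\<lambda>i. P (h i)) F" if "eventually P (nhds l)" for P
  proof (rule ccontr)
    assume "\<not> ?thesis"
    then have "eventually (\<lambda>i. \<not> P (h i)) F" using ultra by blast
    then have "eventually (\<lambda>x. \<not> P x) (filtermap h F)" by (simp add: eventually_filtermap)
    with that have "eventually (\<lambda>_. False) (inf (nhds l) (filtermap h F))"
      unfolding eventually_inf by blast
    with l(2) show False by (simp add: trivial_limit_def)
  qed
  then have "(h \<longlongrightarrow> l) F"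
    unfolding filterlim_def le_filter_def by (simp add: eventually_filtermap)
  with l(1) show ?thesis by blast
qed

lemma connective_range:
  assumes "is_connective n u" "\<And>i. i < n \<Longrightarrow> x i \<in> {0..1}"
  shows "u (restrict x {..<n}) \<in> {0..1}"
proof -
  have "restrict x {..<n} \<in> topspace (product_topology (\<lambda>_. top_of_set {0..1::real}) {..<n})"
    using assms(2) by (auto simp: PiE_iff)
  then show ?thesis
    using assms(1) unfolding is_connective_def continuous_map_def by (auto simp: Pi_iff)
qed

lemma connective_tendsto:
  assumes u: "is_connective n u" and x: "\<And>j i. i < n \<Longrightarrow> x j i \<in> {0..1}"
    and lim: "\<And>i. i < n \<Longrightarrow> ((\<lambda>j. x j i) \<longlongrightarrow> l i) F" and l: "\<And>i. i < n \<Longrightarrow> l i \<in> {0..1}"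
  shows "((\<lambda>j. u (restrict (x j) {..<n})) \<longlongrightarrow> u (restrict l {..<n})) F"
proof -
  have "limitin (product_topology (\<lambda>_. top_of_set {0..1::real}) {..<n})
      (\<lambda>j. restrict (x j) {..<n}) (restrict l {..<n}) F"
    unfolding limitin_componentwise
    using x l lim by (auto simp: limitin_subtopology PiE_iff)
  from continuous_map_limit[OF u[unfolded is_connective_def] this]
  have "limitin (top_of_set {0..1}) (\<lambda>j. u (restrict (x j) {..<n})) (u (restrict l {..<n})) F"
    by (simp add: comp_def)
  then show ?thesis
    by (simp add: limitin_subtopology)
qed

text \<open>Continuity is given for the product topology, without a metric on the cube. So pairs of
  counterexamples at distance below 1/(k+1) are taken along an ultrafilter finer than
  \<open>sequentially\<close>, where both members converge coordinatewise to the same point;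
  continuity there contradicts the gap e.\<close>

lemma connective_uniform:
  assumes u: "is_connective n u" and "0 < e"
  shows "\<exists>\<delta>>0. \<forall>x y. (\<forall>i<n. x i \<in> {0..1} \<and> y i \<in> {0..1} \<and> \<bar>x i - y i\<bar> < \<delta>) \<longrightarrow>
    \<bar>u (restrict x {..<n}) - u (restrict y {..<n})\<bar> \<le> e"
proof (rule ccontr)
  assume contra: "\<not> ?thesis"
  have "\<exists>x y. (\<forall>i<n. x i \<in> {0..1} \<and> y i \<in> {0..1} \<and> \<bar>x i - y i\<bar> < inverse (real (Suc k))) \<and>
      e < \<bar>u (restrict x {..<n}) - u (restrict y {..<n})\<bar>" for k
  proof -
    have "0 < inverse (real (Suc k))" by simp
    with contra show ?thesis by (meson not_le)
  qed
  then obtain x y where xy: "\<And>k i. i < n \<Longrightarrow> x k i \<in> {0..1}" "\<And>k i. i < n \<Longrightarrow> y k i \<in> {0..1}"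
      "\<And>k i. i < n \<Longrightarrow> \<bar>x k i - y k i\<bar> < inverse (real (Suc k))"
      "\<And>k. e < \<bar>u (restrict (x k) {..<n}) - u (restrict (y k) {..<n})\<bar>"
    by metis
  have fip: "\<Inter> X \<noteq> {}" if X: "finite X" "X \<subseteq> range atLeast" for X :: "nat set set"
  proof -
    obtain A where A: "finite A" "X = atLeast ` A"
      using X finite_subset_image by metis
    obtain b where "\<forall>a\<in>A. a \<le> b"
      using A(1) finite_nat_set_iff_bounded_le by blast
    then have "b \<in> \<Inter> X" using A(2) by auto
    then show "\<Inter> X \<noteq> {}" by blast
  qed
  obtain F :: "nat filter" where F: "F \<noteq> bot"
      "\<And>P. eventually P F \<or> eventually (\<lambda>i. \<not> P i) F"
      "\<And>A. A \<in> range atLeast \<Longrightarrow> eventually (\<lambda>i. i \<in> A) F"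
    using ultrafilter_exists[OF fip] by metis
  have "F \<le> sequentially"
    unfolding le_filter_def eventually_sequentially
  proof (intro allI impI, elim exE)
    fix P :: "nat \<Rightarrow> bool" and N assume "\<forall>n\<ge>N. P n"
    then show "eventually P F"
      by (intro eventually_mono[OF F(3)[of "{N..}"]]) auto
  qed
  then have to0: "((\<lambda>k. inverse (real (Suc k))) \<longlongrightarrow> 0) F"
    using LIMSEQ_inverse_real_of_nat filterlim_mono[OF _ order_refl] by blast
  have "\<exists>l. i < n \<longrightarrow> l \<in> {0..1} \<and> ((\<lambda>k. x k i) \<longlongrightarrow> l) F" for i
  proof (cases "i < n")
    case True
    then have "eventually (\<lambda>k. x k i \<in> {0..1}) F"
      using xy(1) by (intro always_eventually allI)
    from ultrafilter_tendsto_compact[OF F(2,1) compact_Icc this] show ?thesis by blast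
  qed simp
  then have "\<forall>i. \<exists>l. i < n \<longrightarrow> l \<in> {0..1} \<and> ((\<lambda>k. x k i) \<longlongrightarrow> l) F" ..
  from choice[OF this] obtain l where
      l: "\<And>i. i < n \<Longrightarrow> l i \<in> {0..1}" "\<And>i. i < n \<Longrightarrow> ((\<lambda>k. x k i) \<longlongrightarrow> l i) F"
    by auto
  have "((\<lambda>k. y k i) \<longlongrightarrow> l i) F" if "i < n" for i
  proof -
    have "norm (y k i - x k i) \<le> inverse (real (Suc k))" for k
      using xy(3)[OF that, of k] unfolding real_norm_def by linarith
    then have "((\<lambda>k. y k i - x k i) \<longlongrightarrow> 0) F"
      by (intro Lim_null_comparison[OF _ to0] always_eventually allI)
    from tendsto_add[OF this l(2)[OF that]] show ?thesis by simp
  qed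
  then have "((\<lambda>k. u (restrict (x k) {..<n}) - u (restrict (y k) {..<n})) \<longlongrightarrow>
      u (restrict l {..<n}) - u (restrict l {..<n})) F"
    using l xy(1,2) by (intro tendsto_diff connective_tendsto[OF u])
  then have "((\<lambda>k. \<bar>u (restrict (x k) {..<n}) - u (restrict (y k) {..<n})\<bar>) \<longlongrightarrow> 0) F"
    by (simp add: tendsto_rabs_zero)
  moreover have "eventually (\<lambda>k. e \<le> \<bar>u (restrict (x k) {..<n}) - u (restrict (y k) {..<n})\<bar>) F"
    using xy(4) by (intro always_eventually allI less_imp_le)
  ultimately have "e \<le> 0"
    using F(1) by (rule tendsto_lowerbound)
  with \<open>0 < e\<close> show False by simp
qed

lemma SUP_diff_le:
  fixes f g :: "'a \<Rightarrow> real"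
  assumes "X \<noteq> {}" "bdd_above (f ` X)" "\<And>a. a \<in> X \<Longrightarrow> \<bar>f a - g a\<bar> \<le> e"
  shows "\<bar>(SUP a\<in>X. f a) - (SUP a\<in>X. g a)\<bar> \<le> e"
proof -
  obtain B where B: "\<And>a. a \<in> X \<Longrightarrow> f a \<le> B"
    using assms(2) unfolding bdd_above_def by auto
  have "g a \<le> B + e" if "a \<in> X" for a
    using B[OF that] assms(3)[OF that] by linarith
  then have bg: "bdd_above (g ` X)"
    by (intro bdd_aboveI2)
  have "(SUP a\<in>X. f a) \<le> (SUP a\<in>X. g a) + e"
  proof (rule cSUP_least[OF assms(1)])
    fix a assume "a \<in> X"
    then show "f a \<le> (SUP a\<in>X. g a) + e"
      using cSUP_upper[OF _ bg, of a] assms(3)[of a] by linarith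
  qed
  moreover have "(SUP a\<in>X. g a) \<le> (SUP a\<in>X. f a) + e"
  proof (rule cSUP_least[OF assms(1)])
    fix a assume "a \<in> X"
    then show "g a \<le> (SUP a\<in>X. f a) + e"
      using cSUP_upper[OF _ assms(2), of a] assms(3)[of a] by linarith
  qed
  ultimately show ?thesis by linarith
qed

lemma INF_eq_uminus_SUP:
  fixes f :: "'a \<Rightarrow> real"
  shows "(INF a\<in>X. f a) = - (SUP a\<in>X. - f a)"
  by (simp add: Inf_real_def image_image)

lemma INF_diff_le:
  fixes f g :: "'a \<Rightarrow> real"
  assumes "X \<noteq> {}" "bdd_below (f ` X)" "\<And>a. a \<in> X \<Longrightarrow> \<bar>f a - g a\<bar> \<le> e"
  shows "\<bar>(INF a\<in>X. f a) - (INF a\<in>X. g a)\<bar> \<le> e"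
proof -
  have "\<bar>(SUP a\<in>X. - f a) - (SUP a\<in>X. - g a)\<bar> \<le> e"
  proof (rule SUP_diff_le[OF assms(1)])
    show "bdd_above ((\<lambda>a. - f a) ` X)"
      using assms(2) unfolding bdd_above_def bdd_below_def by (metis (no_types, lifting) image_iff neg_le_iff_le)
    show "\<bar>- f a - - g a\<bar> \<le> e" if "a \<in> X" for a
      using assms(3)[OF that] by linarith
  qed
  then show ?thesis unfolding INF_eq_uminus_SUP by linarith
qed

section \<open>Tuples and dependence on free variables\<close>

lemma tuple_dist_Nil [simp]: "tuple_dist d [] [] = 0"
  by (simp add: tuple_dist_def)

lemma tuple_dist_Cons [simp]:
  "tuple_dist d (x # xs) (y # ys) = max (d x y) (tuple_dist d xs ys)"
  by (simp add: tuple_dist_def insert_commute[of 0] max.commute max.left_commute)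

lemma tuple_dist_less:
  assumes "0 < r" "length xs = length ys" "\<And>i. i < length xs \<Longrightarrow> d (xs ! i) (ys ! i) < r"
  shows "tuple_dist d xs ys < r"
  using assms(2,3)
proof (induction xs ys rule: list_induct2)
  case (Cons x xs y ys)
  have "d x y < r" using Cons.prems[of 0] by simp
  moreover have "tuple_dist d xs ys < r" using Cons.prems[of "Suc _"] by (intro Cons.IH) simp
  ultimately show ?case by simp
qed (use assms(1) in simp)

lemma tuple_dist_map_less:
  assumes "0 < r" "\<And>t. t \<in> set ts \<Longrightarrow> d (f t) (g t) < r"
  shows "tuple_dist d (map f ts) (map g ts) < r"
  using assms by (intro tuple_dist_less) auto

lemma tm_val_cong: "(\<And>n. n \<in> tm_vars t \<Longrightarrow> v n = w n) \<Longrightarrow> tm_val M t v = tm_val M t w"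
proof (induction t)
  case (Fn f ts)
  then have "map (\<lambda>t. tm_val M t v) ts = map (\<lambda>t. tm_val M t w) ts"
    by (intro map_cong) auto
  then show ?case by (simp only: tm_val.simps)
qed auto

lemma fm_val_cong: "(\<And>n. n \<in> fm_vars \<phi> \<Longrightarrow> v n = w n) \<Longrightarrow> fm_val M \<phi> v = fm_val M \<phi> w"
proof (induction \<phi> arbitrary: v w)
  case (DistF s t)
  then show ?case using tm_val_cong[of s v w M] tm_val_cong[of t v w M] by simp
next
  case (PredF p ts)
  then have "map (\<lambda>t. tm_val M t v) ts = map (\<lambda>t. tm_val M t w) ts"
    by (intro map_cong tm_val_cong) auto
  then show ?case by (simp only: fm_val.simps)
next
  case (ConnF u \<phi>s)
  have "map (\<lambda>\<phi>. fm_val M \<phi> v) \<phi>s = map (\<lambda>\<phi>. fm_val M \<phi> w) \<phi>s"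
    by (intro map_cong refl ConnF.IH) (use ConnF.prems in auto)
  then show ?case by (simp only: fm_val.simps)
next
  case (SupF x \<phi>)
  have "fm_val M \<phi> (v(x := a)) = fm_val M \<phi> (w(x := a))" for a
    by (rule SupF.IH) (use SupF.prems in simp)
  then show ?case by (simp only: fm_val.simps)
next
  case (InfF x \<phi>)
  have "fm_val M \<phi> (v(x := a)) = fm_val M \<phi> (w(x := a))" for a
    by (rule InfF.IH) (use InfF.prems in simp)
  then show ?case by (simp only: fm_val.simps)
qed

lemma finite_tm_vars [simp]: "finite (tm_vars t)"
  by (induction t) auto

lemma finite_fm_vars [simp]: "finite (fm_vars \<phi>)"
  by (induction \<phi>) auto

section \<open>Countably many approximants of formulas\<close>

definition step_val :: "nat \<Rightarrow> (int list \<times> rat) list \<Rightarrow> real list \<Rightarrow> real" where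
  "step_val m tab ys =
     (case map_of tab (map (\<lambda>y. \<lfloor>real m * max 0 (min 1 y)\<rfloor>) ys) of None \<Rightarrow> 0 | Some r \<Rightarrow> of_rat r)"

text \<open>Approximants of formulas: connectives are replaced by rational step functions on a grid
  of mesh \<open>1/m\<close>, given by a finite table. There are only countably many of them.\<close>

datatype approx =
    AtomA nat
  | StepA nat "(int list \<times> rat) list" "approx list"
  | SupA nat approx
  | InfA nat approx

instance approx :: countable
  by countable_datatype

instance tm :: (countable) countable
  by countable_datatype

primrec approx_val :: "'a set \<Rightarrow> (nat \<Rightarrow> (nat \<Rightarrow> 'a) \<Rightarrow> real) \<Rightarrow> approx \<Rightarrow> (nat \<Rightarrow> 'a) \<Rightarrow> real" where
  "approx_val X atm (AtomA k) = atm k"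
| "approx_val X atm (StepA m tab as) = (\<lambda>v. step_val m tab (map (\<lambda>g. g v) (map (approx_val X atm) as)))"
| "approx_val X atm (SupA x a) = (\<lambda>v. SUP c\<in>X. approx_val X atm a (v(x := c)))"
| "approx_val X atm (InfA x a) = (\<lambda>v. INF c\<in>X. approx_val X atm a (v(x := c)))"

lemma set_tm_subset_funs: "is_tm L t \<Longrightarrow> set_tm t \<subseteq> funs L"
  by (induction t) auto

lemma countable_is_tm:
  assumes "countable (funs L)"
  shows "countable {t. is_tm L t}"
proof (cases "funs L = {}")
  case True
  have "\<exists>n. t = Var n" if "is_tm L t" for t
    using that True by (cases t) auto
  then have "{t. is_tm L t} \<subseteq> range Var" by blast
  then show ?thesis by (rule countable_subset) simp
next
  case False
  have "t = map_tm (from_nat_into (funs L)) (map_tm (to_nat_on (funs L)) t)" if "is_tm L t" for t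
  proof -
    have "t = map_tm id t" by (simp add: tm.map_id)
    also have "\<dots> = map_tm (from_nat_into (funs L) \<circ> to_nat_on (funs L)) t"
      by (rule tm.map_cong) (use set_tm_subset_funs[OF that] assms in auto)
    finally show ?thesis by (simp add: tm.map_comp)
  qed
  then have "{t. is_tm L t} \<subseteq> range (map_tm (from_nat_into (funs L)))" by blast
  then show ?thesis by (rule countable_subset) simp
qed


section \<open>Uniform continuity of terms and formulas\<close>

locale structure_over =
  fixes L :: "('f, 'p) language" and M :: "('f, 'p, 'a) metric_structure"
  assumes language: "is_language L" and struct: "is_structure L M"
begin

abbreviation "X \<equiv> univ M"
abbreviation "d \<equiv> sdist M"

sublocale MS: Metric_space X d
  using struct by (simp add: is_structure_def)

lemma X_ne: "X \<noteq> {}" and d_le_1: "\<lbrakk>x \<in> X; y \<in> X\<rbrakk> \<Longrightarrow> d x y \<le> 1"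
  and complete: "MS.mcomplete"
  using struct by (auto simp: is_structure_def)

lemma fun_closed:
  "\<lbrakk>f \<in> funs L; length xs = fun_arity L f; set xs \<subseteq> X\<rbrakk> \<Longrightarrow> fun_int M f xs \<in> X"
  using struct unfolding is_structure_def tuples_def by blast

lemma pred_range:
  "\<lbrakk>p \<in> preds L; length xs = pred_arity L p; set xs \<subseteq> X\<rbrakk> \<Longrightarrow> pred_int M p xs \<in> {0..1}"
  using struct unfolding is_structure_def tuples_def by blast

lemma fun_uniform:
  assumes "f \<in> funs L" "0 < e" "e \<le> 1"
  shows "0 < fun_modulus L f e"
    and "\<lbrakk>length xs = fun_arity L f; set xs \<subseteq> X; length ys = fun_arity L f; set ys \<subseteq> X;
      tuple_dist d xs ys < fun_modulus L f e\<rbrakk> \<Longrightarrow> d (fun_int M f xs) (fun_int M f ys) \<le> e"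
proof -
  show "0 < fun_modulus L f e"
    using language assms by (auto simp: is_language_def is_modulus_def)
  assume "length xs = fun_arity L f" "set xs \<subseteq> X" "length ys = fun_arity L f" "set ys \<subseteq> X"
  then have "xs \<in> tuples (fun_arity L f) X" "ys \<in> tuples (fun_arity L f) X"
    by (auto simp: tuples_def)
  moreover assume "tuple_dist d xs ys < fun_modulus L f e"
  moreover have "e \<in> {0<..1}" using assms by simp
  ultimately show "d (fun_int M f xs) (fun_int M f ys) \<le> e"
    using struct assms(1) by (simp add: is_structure_def)
qed

lemma pred_uniform:
  assumes "p \<in> preds L" "0 < e" "e \<le> 1"
  shows "0 < pred_modulus L p e"
    and "\<lbrakk>length xs = pred_arity L p; set xs \<subseteq> X; length ys = pred_arity L p; set ys \<subseteq> X;
      tuple_dist d xs ys < pred_modulus L p e\<rbrakk> \<Longrightarrow> \<bar>pred_int M p xs - pred_int M p ys\<bar> \<le> e"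
proof -
  show "0 < pred_modulus L p e"
    using language assms by (auto simp: is_language_def is_modulus_def)
  assume "length xs = pred_arity L p" "set xs \<subseteq> X" "length ys = pred_arity L p" "set ys \<subseteq> X"
  then have "xs \<in> tuples (pred_arity L p) X" "ys \<in> tuples (pred_arity L p) X"
    by (auto simp: tuples_def)
  moreover assume "tuple_dist d xs ys < pred_modulus L p e"
  moreover have "e \<in> {0<..1}" using assms by simp
  ultimately show "\<bar>pred_int M p xs - pred_int M p ys\<bar> \<le> e"
    using struct assms(1) by (simp add: is_structure_def)
qed

lemma tm_val_closed:
  assumes "range v \<subseteq> X"
  shows "is_tm L t \<Longrightarrow> tm_val M t v \<in> X"
proof (induction t)
  case (Fn f ts)
  then have "set (map (\<lambda>t. tm_val M t v) ts) \<subseteq> X" by auto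
  with Fn show ?case by (auto intro!: fun_closed)
qed (use assms in auto)

lemma SUP_range:
  assumes "\<And>a. a \<in> X \<Longrightarrow> f a \<in> {0..1 :: real}"
  shows "(SUP a\<in>X. f a) \<in> {0..1}"
proof -
  obtain a where a: "a \<in> X" using X_ne by blast
  have "bdd_above (f ` X)" using assms by (intro bdd_aboveI2[of _ _ 1]) auto
  then have "f a \<le> (SUP a\<in>X. f a)" using a by (intro cSUP_upper)
  moreover have "(SUP a\<in>X. f a) \<le> 1" using assms X_ne by (intro cSUP_least) auto
  ultimately show ?thesis using assms[OF a] by auto
qed

lemma INF_range:
  assumes "\<And>a. a \<in> X \<Longrightarrow> f a \<in> {0..1 :: real}"
  shows "(INF a\<in>X. f a) \<in> {0..1}"
proof -
  obtain a where a: "a \<in> X" using X_ne by blast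
  have "bdd_below (f ` X)" using assms by (intro bdd_belowI2[of _ 0]) auto
  then have "(INF a\<in>X. f a) \<le> f a" using a by (intro cINF_lower)
  moreover have "0 \<le> (INF a\<in>X. f a)" using assms X_ne by (intro cINF_greatest) auto
  ultimately show ?thesis using assms[OF a] by auto
qed

lemma fm_val_range: "\<lbrakk>is_fm L \<phi>; range v \<subseteq> X\<rbrakk> \<Longrightarrow> fm_val M \<phi> v \<in> {0..1}"
proof (induction \<phi> arbitrary: v)
  case (DistF s t)
  then show ?case
    using tm_val_closed[of v s] tm_val_closed[of v t] d_le_1 by auto
next
  case (PredF p ts)
  have "set (map (\<lambda>t. tm_val M t v) ts) \<subseteq> X"
    using PredF tm_val_closed by auto
  with PredF show ?case unfolding fm_val.simps by (intro pred_range) auto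
next
  case (ConnF u \<phi>s)
  show ?case unfolding fm_val.simps
    by (rule connective_range) (use ConnF in auto)
next
  case (SupF x \<phi>)
  show ?case unfolding fm_val.simps
    by (rule SUP_range, rule SupF.IH) (use SupF.prems in auto)
next
  case (InfF x \<phi>)
  show ?case unfolding fm_val.simps
    by (rule INF_range, rule InfF.IH) (use InfF.prems in auto)
qed

lemma fm_val_bounds:
  assumes "is_fm L \<phi>" "range v \<subseteq> X"
  shows "bdd_above ((\<lambda>a. fm_val M \<phi> (v(x := a))) ` X)" "bdd_below ((\<lambda>a. fm_val M \<phi> (v(x := a))) ` X)"
proof -
  have *: "fm_val M \<phi> (v(x := a)) \<in> {0..1}" if "a \<in> X" for a
    by (rule fm_val_range) (use assms that in auto)
  show "bdd_above ((\<lambda>a. fm_val M \<phi> (v(x := a))) ` X)"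
    using * by (intro bdd_aboveI2[of _ _ 1]) simp
  show "bdd_below ((\<lambda>a. fm_val M \<phi> (v(x := a))) ` X)"
    using * by (intro bdd_belowI2[of _ 0]) simp
qed

definition close :: "nat set \<Rightarrow> real \<Rightarrow> (nat \<Rightarrow> 'a) \<Rightarrow> (nat \<Rightarrow> 'a) \<Rightarrow> bool" where
  "close V \<delta> v w \<longleftrightarrow> range v \<subseteq> X \<and> range w \<subseteq> X \<and> (\<forall>n\<in>V. d (v n) (w n) < \<delta>)"

lemma close_range: "close V \<delta> v w \<Longrightarrow> range v \<subseteq> X" "close V \<delta> v w \<Longrightarrow> range w \<subseteq> X"
  by (simp_all add: close_def)

lemma close_mono: "\<lbrakk>close V \<delta> v w; V' \<subseteq> V; \<delta> \<le> \<delta>'\<rbrakk> \<Longrightarrow> close V' \<delta>' v w"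
  unfolding close_def by (meson less_le_trans subsetD)

lemma close_upd: "\<lbrakk>close (V - {x}) \<delta> v w; 0 < \<delta>; a \<in> X\<rbrakk> \<Longrightarrow> close V \<delta> (v(x := a)) (w(x := a))"
  by (auto simp: close_def)

text \<open>Takes the minimum of finitely many radii; used for the arguments of symbols and of
  connectives alike.\<close>

lemma uniform_list:
  assumes "\<forall>t\<in>set ts. \<exists>\<delta>>0. \<forall>v w. close (V t) \<delta> v w \<longrightarrow> R t v w"
  obtains \<delta> where "\<delta> > 0" "\<And>v w t. \<lbrakk>close (\<Union>t\<in>set ts. V t) \<delta> v w; t \<in> set ts\<rbrakk> \<Longrightarrow> R t v w"
proof -
  have "\<exists>\<delta>>0. \<forall>v w. close (\<Union>t\<in>set ts. V t) \<delta> v w \<longrightarrow> (\<forall>t\<in>set ts. R t v w)"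
    using assms
  proof (induction ts)
    case Nil
    show ?case by (intro exI[of _ 1]) simp
  next
    case (Cons t ts)
    obtain \<delta>1 where \<delta>1: "\<delta>1 > 0" "\<forall>v w. close (V t) \<delta>1 v w \<longrightarrow> R t v w"
      using Cons.prems by auto
    obtain \<delta>2 where \<delta>2: "\<delta>2 > 0" "\<forall>v w. close (\<Union>t\<in>set ts. V t) \<delta>2 v w \<longrightarrow> (\<forall>t\<in>set ts. R t v w)"
      using Cons.IH Cons.prems by auto
    have "R t' v w" if c: "close (\<Union>t\<in>set (t # ts). V t) (min \<delta>1 \<delta>2) v w" and "t' \<in> set (t # ts)" for t' v w
    proof -
      have "close (V t) \<delta>1 v w" "close (\<Union>t\<in>set ts. V t) \<delta>2 v w"
        by (rule close_mono[OF c]; auto)+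
      then show ?thesis using \<delta>1(2) \<delta>2(2) that(2) by auto
    qed
    moreover have "min \<delta>1 \<delta>2 > 0" using \<delta>1 \<delta>2 by simp
    ultimately show ?case by blast
  qed
  then show thesis using that by blast
qed

lemma tm_uniform:
  assumes "is_tm L t" "0 < e"
  shows "\<exists>\<delta>>0. \<forall>v w. close (tm_vars t) \<delta> v w \<longrightarrow> d (tm_val M t v) (tm_val M t w) < e"
  using assms
proof (induction t arbitrary: e)
  case (Var i)
  then show ?case by (auto simp: close_def)
next
  case (Fn f ts)
  \<comment> \<open>Moduli are given only up to 1 and yield a bound with \<le>; halving e makes the
    inequality strict.\<close>
  define e' where "e' = min 1 (e / 2)"
  have e': "0 < e'" "e' \<le> 1" "e' < e" using Fn.prems by (auto simp: e'_def)
  have f: "f \<in> funs L" using Fn.prems by simp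
  let ?r = "fun_modulus L f e'"
  have r: "0 < ?r" using fun_uniform(1)[OF f e'(1,2)] .
  have "\<forall>t\<in>set ts. \<exists>\<delta>>0. \<forall>v w. close (tm_vars t) \<delta> v w \<longrightarrow> d (tm_val M t v) (tm_val M t w) < ?r"
    using Fn.IH[OF _ _ r] Fn.prems by simp
  from uniform_list[OF this] obtain \<delta> where \<delta>: "\<delta> > 0" "\<And>v w t.
      \<lbrakk>close (\<Union>t\<in>set ts. tm_vars t) \<delta> v w; t \<in> set ts\<rbrakk> \<Longrightarrow> d (tm_val M t v) (tm_val M t w) < ?r"
    by blast
  have "d (tm_val M (Fn f ts) v) (tm_val M (Fn f ts) w) < e" if v: "close (tm_vars (Fn f ts)) \<delta> v w" for v w
  proof -
    have "tuple_dist d (map (\<lambda>t. tm_val M t v) ts) (map (\<lambda>t. tm_val M t w) ts) < ?r"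
      by (rule tuple_dist_map_less[OF r], rule \<delta>(2)) (use v in auto)
    then have "d (tm_val M (Fn f ts) v) (tm_val M (Fn f ts) w) \<le> e'"
      unfolding tm_val.simps
      by (intro fun_uniform(2)[OF f e'(1,2)]) (use Fn.prems close_range[OF v] tm_val_closed in auto)
    with e'(3) show ?thesis by simp
  qed
  with \<delta>(1) show ?case by blast
qed

text \<open>Quantifiers cost nothing: the bound variable receives the same value on both sides, so
  closeness on the remaining variables suffices.\<close>

lemma fm_uniform:
  assumes "is_fm L \<phi>" "0 < e"
  shows "\<exists>\<delta>>0. \<forall>v w. close (fm_vars \<phi>) \<delta> v w \<longrightarrow> \<bar>fm_val M \<phi> v - fm_val M \<phi> w\<bar> \<le> e"
  using assms
proof (induction \<phi> arbitrary: e)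
  case (DistF s t)
  have "\<forall>t'\<in>set [s, t]. \<exists>\<delta>>0. \<forall>v w. close (tm_vars t') \<delta> v w \<longrightarrow> d (tm_val M t' v) (tm_val M t' w) < e / 2"
    using DistF.prems by (intro ballI tm_uniform) auto
  from uniform_list[OF this] obtain \<delta> where \<delta>: "\<delta> > 0" "\<And>v w t'.
      \<lbrakk>close (\<Union>t\<in>set [s, t]. tm_vars t) \<delta> v w; t' \<in> set [s, t]\<rbrakk> \<Longrightarrow> d (tm_val M t' v) (tm_val M t' w) < e / 2"
    by blast
  have "\<bar>fm_val M (DistF s t) v - fm_val M (DistF s t) w\<bar> \<le> e" if v: "close (fm_vars (DistF s t)) \<delta> v w" for v w
  proof -
    let ?a = "tm_val M s v" and ?b = "tm_val M t v" and ?a' = "tm_val M s w" and ?b' = "tm_val M t w"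
    have "d ?a ?a' < e / 2" "d ?b ?b' < e / 2"
      using \<delta>(2)[of v w s] \<delta>(2)[of v w t] v by simp_all
    moreover have "?a \<in> X" "?b \<in> X" "?a' \<in> X" "?b' \<in> X"
      using close_range[OF v] DistF.prems by (auto intro!: tm_val_closed)
    ultimately show ?thesis
      using MS.triangle[of ?a ?a' ?b] MS.triangle[of ?a' ?b' ?b] MS.triangle[of ?a' ?a ?b']
        MS.triangle[of ?a ?b ?b'] MS.commute[of ?a' ?a] MS.commute[of ?b' ?b]
      by simp
  qed
  with \<delta>(1) show ?case by blast
next
  case (PredF p ts)
  define e' where "e' = min 1 e"
  have e': "0 < e'" "e' \<le> 1" "e' \<le> e" using PredF.prems by (auto simp: e'_def)
  have p: "p \<in> preds L" using PredF.prems by simp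
  let ?r = "pred_modulus L p e'"
  have r: "0 < ?r" using pred_uniform(1)[OF p e'(1,2)] .
  have "\<forall>t\<in>set ts. \<exists>\<delta>>0. \<forall>v w. close (tm_vars t) \<delta> v w \<longrightarrow> d (tm_val M t v) (tm_val M t w) < ?r"
    using tm_uniform[OF _ r] PredF.prems by simp
  from uniform_list[OF this] obtain \<delta> where \<delta>: "\<delta> > 0" "\<And>v w t.
      \<lbrakk>close (\<Union>t\<in>set ts. tm_vars t) \<delta> v w; t \<in> set ts\<rbrakk> \<Longrightarrow> d (tm_val M t v) (tm_val M t w) < ?r"
    by blast
  have "\<bar>fm_val M (PredF p ts) v - fm_val M (PredF p ts) w\<bar> \<le> e" if v: "close (fm_vars (PredF p ts)) \<delta> v w" for v w
  proof -
    have "tuple_dist d (map (\<lambda>t. tm_val M t v) ts) (map (\<lambda>t. tm_val M t w) ts) < ?r"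
      by (rule tuple_dist_map_less[OF r], rule \<delta>(2)) (use v in auto)
    then have "\<bar>fm_val M (PredF p ts) v - fm_val M (PredF p ts) w\<bar> \<le> e'"
      unfolding fm_val.simps
      by (intro pred_uniform(2)[OF p e'(1,2)]) (use PredF.prems close_range[OF v] tm_val_closed in auto)
    with e'(3) show ?thesis by simp
  qed
  with \<delta>(1) show ?case by blast
next
  case (ConnF u \<phi>s)
  let ?n = "length \<phi>s"
  have u: "is_connective ?n u" using ConnF.prems by simp
  obtain r where r: "r > 0" "\<And>x y. (\<forall>i<?n. x i \<in> {0..1} \<and> y i \<in> {0..1} \<and> \<bar>x i - y i\<bar> < r) \<Longrightarrow>
      \<bar>u (restrict x {..<?n}) - u (restrict y {..<?n})\<bar> \<le> e"
    using connective_uniform[OF u ConnF.prems(2)] by blast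
  have "0 < r / 2" using r by simp
  have "\<forall>\<phi>\<in>set \<phi>s. \<exists>\<delta>>0. \<forall>v w. close (fm_vars \<phi>) \<delta> v w \<longrightarrow> \<bar>fm_val M \<phi> v - fm_val M \<phi> w\<bar> \<le> r / 2"
    using ConnF.IH[OF _ _ \<open>0 < r / 2\<close>] ConnF.prems(1) by simp
  from uniform_list[OF this] obtain \<delta> where \<delta>: "\<delta> > 0" "\<And>v w \<phi>.
      \<lbrakk>close (\<Union>\<phi>\<in>set \<phi>s. fm_vars \<phi>) \<delta> v w; \<phi> \<in> set \<phi>s\<rbrakk> \<Longrightarrow> \<bar>fm_val M \<phi> v - fm_val M \<phi> w\<bar> \<le> r / 2"
    by blast
  have "\<bar>fm_val M (ConnF u \<phi>s) v - fm_val M (ConnF u \<phi>s) w\<bar> \<le> e" if v: "close (fm_vars (ConnF u \<phi>s)) \<delta> v w" for v w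
    unfolding fm_val.simps
  proof (rule r(2), intro allI impI)
    fix i assume i: "i < ?n"
    have "\<bar>fm_val M (\<phi>s ! i) v - fm_val M (\<phi>s ! i) w\<bar> \<le> r / 2"
      by (rule \<delta>(2)) (use v i in auto)
    moreover have "is_fm L (\<phi>s ! i)" using ConnF.prems i by auto
    ultimately show "map (\<lambda>\<phi>. fm_val M \<phi> v) \<phi>s ! i \<in> {0..1} \<and> map (\<lambda>\<phi>. fm_val M \<phi> w) \<phi>s ! i \<in> {0..1} \<and>
        \<bar>map (\<lambda>\<phi>. fm_val M \<phi> v) \<phi>s ! i - map (\<lambda>\<phi>. fm_val M \<phi> w) \<phi>s ! i\<bar> < r"
      using fm_val_range[of "\<phi>s ! i" v] fm_val_range[of "\<phi>s ! i" w] close_range[OF v] i r(1) by simp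
  qed
  with \<delta>(1) show ?case by blast
next
  case (SupF x \<phi>)
  have fm: "is_fm L \<phi>" using SupF.prems by simp
  obtain \<delta> where \<delta>: "\<delta> > 0" "\<And>v w. close (fm_vars \<phi>) \<delta> v w \<Longrightarrow> \<bar>fm_val M \<phi> v - fm_val M \<phi> w\<bar> \<le> e"
    using SupF.IH[OF fm SupF.prems(2)] by blast
  have "\<bar>fm_val M (SupF x \<phi>) v - fm_val M (SupF x \<phi>) w\<bar> \<le> e" if v: "close (fm_vars (SupF x \<phi>)) \<delta> v w" for v w
    unfolding fm_val.simps
    by (rule SUP_diff_le[OF X_ne fm_val_bounds(1)[OF fm close_range(1)[OF v]]], rule \<delta>(2))
      (use v \<delta>(1) close_upd in simp)
  with \<delta>(1) show ?case by blast
next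
  case (InfF x \<phi>)
  have fm: "is_fm L \<phi>" using InfF.prems by simp
  obtain \<delta> where \<delta>: "\<delta> > 0" "\<And>v w. close (fm_vars \<phi>) \<delta> v w \<Longrightarrow> \<bar>fm_val M \<phi> v - fm_val M \<phi> w\<bar> \<le> e"
    using InfF.IH[OF fm InfF.prems(2)] by blast
  have "\<bar>fm_val M (InfF x \<phi>) v - fm_val M (InfF x \<phi>) w\<bar> \<le> e" if v: "close (fm_vars (InfF x \<phi>)) \<delta> v w" for v w
    unfolding fm_val.simps
    by (rule INF_diff_le[OF X_ne fm_val_bounds(2)[OF fm close_range(1)[OF v]]], rule \<delta>(2))
      (use v \<delta>(1) close_upd in simp)
  with \<delta>(1) show ?case by blast
qed

end

text \<open>A uniformly continuous u is tabulated with rational values at the grid points of mesh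
  1/m. The statement allows y to differ from x, since in the induction over formulas the arguments
  are themselves only approximated.\<close>

lemma connective_step_approx:
  assumes u: "is_connective n u" and "0 < e"
  shows "\<exists>m tab \<delta>. 0 < \<delta> \<and> (\<forall>x y. (\<forall>i<n. x i \<in> {0..1} \<and> \<bar>x i - y i\<bar> \<le> \<delta>) \<longrightarrow>
    \<bar>u (restrict x {..<n}) - step_val m tab (map y [0..<n])\<bar> \<le> e)"
proof -
  have "0 < e / 2" using assms by simp
  obtain r where r: "r > 0" "\<And>x y. (\<forall>i<n. x i \<in> {0..1} \<and> y i \<in> {0..1} \<and> \<bar>x i - y i\<bar> < r) \<Longrightarrow>
      \<bar>u (restrict x {..<n}) - u (restrict y {..<n})\<bar> \<le> e / 2"
    using connective_uniform[OF u \<open>0 < e / 2\<close>] by blast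
  \<comment> \<open>One half of r is reserved for the mesh and the other for the error of y.
    Likewise one half of e pays for uniform continuity and the other for rational rounding.\<close>
  obtain m0 where m0: "inverse (real (Suc m0)) < r / 2"
    using reals_Archimedean[of "r / 2"] r(1) by auto
  define m where "m = Suc m0"
  have m: "0 < real m" "1 / real m < r / 2"
    using m0 by (auto simp: m_def inverse_eq_divide)
  define keys where "keys = {ks :: int list. set ks \<subseteq> {0..int m} \<and> length ks = n}"
  have "finite keys" unfolding keys_def by (rule finite_lists_length_eq) simp
  then obtain kl where kl: "set kl = keys" using finite_list by blast
  define pt where "pt ks i = real_of_int (ks ! i) / real m" for ks :: "int list" and i
  have "\<exists>q. \<bar>u (restrict (pt ks) {..<n}) - of_rat q\<bar> \<le> e / 2" for ks
  proof -
    have "u (restrict (pt ks) {..<n}) < u (restrict (pt ks) {..<n}) + e / 2"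
      using assms(2) by simp
    from of_rat_dense[OF this] obtain q where
      "u (restrict (pt ks) {..<n}) < of_rat q" "of_rat q < u (restrict (pt ks) {..<n}) + e / 2"
      by blast
    then show ?thesis by (intro exI[of _ q]) linarith
  qed
  then obtain q where q: "\<And>ks. \<bar>u (restrict (pt ks) {..<n}) - of_rat (q ks)\<bar> \<le> e / 2"
    by metis
  define tab where "tab = map (\<lambda>ks. (ks, q ks)) kl"
  have "\<bar>u (restrict x {..<n}) - step_val m tab (map y [0..<n])\<bar> \<le> e"
    if xy: "\<forall>i<n. x i \<in> {0..1} \<and> \<bar>x i - y i\<bar> \<le> r / 2" for x y
  proof -
    \<comment> \<open>Approximants of formulas may leave the unit interval, hence the clamping. It
      does not move y away from x, which lies in the interval.\<close>
    define c where "c i = max 0 (min 1 (y i))" for i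
    define ks where "ks = map (\<lambda>i. \<lfloor>real m * c i\<rfloor>) [0..<n]"
    have c: "0 \<le> c i" "c i \<le> 1" for i by (auto simp: c_def)
    have fl: "0 \<le> \<lfloor>real m * c i\<rfloor>" "\<lfloor>real m * c i\<rfloor> \<le> int m" for i
    proof -
      show "0 \<le> \<lfloor>real m * c i\<rfloor>" using c m by simp
      have "real m * c i \<le> real m" using c[of i] m by (simp add: mult_left_le)
      then have "\<lfloor>real m * c i\<rfloor> \<le> \<lfloor>real m\<rfloor>" by (rule floor_mono)
      then show "\<lfloor>real m * c i\<rfloor> \<le> int m" by simp
    qed
    have "ks \<in> keys"
      unfolding keys_def ks_def using fl by auto
    then have tab: "map_of tab ks = Some (q ks)"
      unfolding tab_def by (simp add: map_of_map_restrict kl)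
    have "x i \<in> {0..1} \<and> pt ks i \<in> {0..1} \<and> \<bar>x i - pt ks i\<bar> < r" if i: "i < n" for i
    proof -
      have pt: "pt ks i = real_of_int \<lfloor>real m * c i\<rfloor> / real m"
        using i by (simp add: pt_def ks_def)
      have "real_of_int \<lfloor>real m * c i\<rfloor> \<le> real m * c i" "real m * c i - 1 \<le> real_of_int \<lfloor>real m * c i\<rfloor>"
        by linarith+
      moreover have "real m * pt ks i = real_of_int \<lfloor>real m * c i\<rfloor>"
        unfolding pt using m(1) by simp
      moreover have "real m * (c i - 1 / real m) = real m * c i - 1"
        using m(1) by (simp add: right_diff_distrib)
      ultimately have "real m * pt ks i \<le> real m * c i" "real m * (c i - 1 / real m) \<le> real m * pt ks i"
        by simp_all
      then have "pt ks i \<le> c i" "c i - 1 / real m \<le> pt ks i"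
        using m(1) mult_le_cancel_left_pos by blast+
      moreover have "0 \<le> pt ks i" unfolding pt using fl m by simp
      moreover have "\<bar>x i - c i\<bar> \<le> r / 2"
        using xy i unfolding c_def by (smt (verit) atLeastAtMost_iff)
      ultimately have "0 \<le> pt ks i" "pt ks i \<le> 1" "\<bar>x i - pt ks i\<bar> < r"
        using m(2) c[of i] by linarith+
      then show ?thesis using xy i by simp
    qed
    then have "\<bar>u (restrict x {..<n}) - u (restrict (pt ks) {..<n})\<bar> \<le> e / 2"
      by (intro r(2)) blast
    with q[of ks] have "\<bar>u (restrict x {..<n}) - of_rat (q ks)\<bar> \<le> e" by linarith
    then show ?thesis using tab unfolding ks_def c_def step_val_def by (simp add: comp_def)
  qed
  moreover have "0 < r / 2" using r by simp
  ultimately show ?thesis by blast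
qed

context structure_over
begin

text \<open>Arbitrary connectives give uncountably many formulas, but only countably many Skolem
  functions can be afforded. The approximants over the countably many atomic formulas are countably
  many and uniformly dense.\<close>

lemma formulas_separable:
  assumes "countable_language L"
  shows "\<exists>C :: ((nat \<Rightarrow> 'a) \<Rightarrow> real) set. countable C \<and>
    (\<forall>\<phi> e. is_fm L \<phi> \<longrightarrow> 0 < e \<longrightarrow> (\<exists>\<psi>\<in>C. \<forall>v. range v \<subseteq> X \<longrightarrow> \<bar>fm_val M \<phi> v - \<psi> v\<bar> \<le> e))"
proof -
  have ctm: "countable {t. is_tm L t}"
    using assms by (intro countable_is_tm) (simp add: countable_language_def)
  define At where "At = (\<lambda>(s, t). fm_val M (DistF s t)) ` ({t. is_tm L t} \<times> {t. is_tm L t}) \<union>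
    (\<lambda>(p, ts). fm_val M (PredF p ts)) ` (preds L \<times> lists {t. is_tm L t})"
  have "countable At"
    unfolding At_def using ctm assms by (auto simp: countable_language_def)
  have "fm_val M (DistF (Var 0) (Var 0)) \<in> At"
    unfolding At_def by (intro UnI1 image_eqI[of _ _ "(Var 0, Var 0)"]) auto
  then have "At \<noteq> {}" by blast
  define atm where "atm = from_nat_into At"
  have atm: "range atm = At"
    unfolding atm_def using \<open>At \<noteq> {}\<close> \<open>countable At\<close> by (rule range_from_nat_into)
  have main: "\<exists>a. \<forall>v. range v \<subseteq> X \<longrightarrow> \<bar>fm_val M \<phi> v - approx_val X atm a v\<bar> \<le> e"
    if "is_fm L \<phi>" "0 < e" for \<phi> e
    using that
  proof (induction \<phi> arbitrary: e)
    case (DistF s t)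
    have "fm_val M (DistF s t) \<in> At"
      unfolding At_def using DistF by (intro UnI1 image_eqI[of _ _ "(s, t)"]) auto
    then obtain k where "fm_val M (DistF s t) = atm k" using atm by (metis imageE)
    then show ?case using DistF by (intro exI[of _ "AtomA k"]) simp
  next
    case (PredF p ts)
    have "fm_val M (PredF p ts) \<in> At"
      unfolding At_def using PredF by (intro UnI2 image_eqI[of _ _ "(p, ts)"]) auto
    then obtain k where "fm_val M (PredF p ts) = atm k" using atm by (metis imageE)
    then show ?case using PredF by (intro exI[of _ "AtomA k"]) simp
  next
    case (ConnF u \<phi>s)
    let ?n = "length \<phi>s"
    have u: "is_connective ?n u" using ConnF.prems by simp
    obtain m tab \<delta> where \<delta>: "0 < \<delta>" "\<And>x y. \<lbrakk>\<forall>i<?n. x i \<in> {0..1} \<and> \<bar>x i - y i\<bar> \<le> \<delta>\<rbrakk> \<Longrightarrow>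
      \<bar>u (restrict x {..<?n}) - step_val m tab (map y [0..<?n])\<bar> \<le> e"
      using connective_step_approx[OF u ConnF.prems(2)] by blast
    have "\<forall>\<phi>\<in>set \<phi>s. \<exists>a. \<forall>v. range v \<subseteq> X \<longrightarrow> \<bar>fm_val M \<phi> v - approx_val X atm a v\<bar> \<le> \<delta>"
      using ConnF.IH[OF _ _ \<delta>(1)] ConnF.prems(1) by simp
    from bchoice[OF this] obtain a where
      a: "\<And>\<phi> v. \<lbrakk>\<phi> \<in> set \<phi>s; range v \<subseteq> X\<rbrakk> \<Longrightarrow> \<bar>fm_val M \<phi> v - approx_val X atm (a \<phi>) v\<bar> \<le> \<delta>"
      by blast
    have "\<bar>fm_val M (ConnF u \<phi>s) v - approx_val X atm (StepA m tab (map a \<phi>s)) v\<bar> \<le> e"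
      if v: "range v \<subseteq> X" for v
    proof -
      have eq: "map (\<lambda>g. g v) (map (approx_val X atm) (map a \<phi>s))
          = map (\<lambda>i. approx_val X atm (a (\<phi>s ! i)) v) [0..<?n]"
        by (rule nth_equalityI) auto
      show ?thesis
        unfolding fm_val.simps approx_val.simps eq
      proof (rule \<delta>(2), intro allI impI)
        fix i assume i: "i < ?n"
        then have "is_fm L (\<phi>s ! i)" using ConnF.prems by auto
        from fm_val_range[OF this v] a[OF nth_mem[OF i] v] i
        show "map (\<lambda>\<phi>. fm_val M \<phi> v) \<phi>s ! i \<in> {0..1} \<and>
            \<bar>map (\<lambda>\<phi>. fm_val M \<phi> v) \<phi>s ! i - approx_val X atm (a (\<phi>s ! i)) v\<bar> \<le> \<delta>"
          by simp
      qed
    qed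
    then show ?case by blast
  next
    case (SupF x \<phi>)
    have fm: "is_fm L \<phi>" using SupF.prems by simp
    obtain a where a: "\<And>v. range v \<subseteq> X \<Longrightarrow> \<bar>fm_val M \<phi> v - approx_val X atm a v\<bar> \<le> e"
      using SupF.IH[OF fm SupF.prems(2)] by blast
    have "\<bar>fm_val M (SupF x \<phi>) v - approx_val X atm (SupA x a) v\<bar> \<le> e" if v: "range v \<subseteq> X" for v
      unfolding fm_val.simps approx_val.simps
    proof (rule SUP_diff_le[OF X_ne fm_val_bounds(1)[OF fm v]], rule a)
      show "range (v(x := c)) \<subseteq> X" if "c \<in> X" for c using v that by auto
    qed
    then show ?case by blast
  next
    case (InfF x \<phi>)
    have fm: "is_fm L \<phi>" using InfF.prems by simp
    obtain a where a: "\<And>v. range v \<subseteq> X \<Longrightarrow> \<bar>fm_val M \<phi> v - approx_val X atm a v\<bar> \<le> e"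
      using InfF.IH[OF fm InfF.prems(2)] by blast
    have "\<bar>fm_val M (InfF x \<phi>) v - approx_val X atm (InfA x a) v\<bar> \<le> e" if v: "range v \<subseteq> X" for v
      unfolding fm_val.simps approx_val.simps
    proof (rule INF_diff_le[OF X_ne fm_val_bounds(2)[OF fm v]], rule a)
      show "range (v(x := c)) \<subseteq> X" if "c \<in> X" for c using v that by auto
    qed
    then show ?case by blast
  qed
  have "countable (range (approx_val X atm))" by simp
  with main show ?thesis by (intro exI[of _ "range (approx_val X atm)"]) blast
qed

section \<open>Reduction of infima to suprema\<close>

definition neg_fm :: "('f, 'p) fm \<Rightarrow> ('f, 'p) fm" where
  "neg_fm \<phi> = ConnF (\<lambda>x. 1 - x 0) [\<phi>]"

lemma neg_fm_simps [simp]: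
  "is_fm L (neg_fm \<phi>) \<longleftrightarrow> is_fm L \<phi>"
  "fm_vars (neg_fm \<phi>) = fm_vars \<phi>"
  "fm_val M' (neg_fm \<phi>) v = 1 - fm_val M' \<phi> v"
proof -
  have "is_connective (Suc 0) (\<lambda>x. 1 - x 0)"
    unfolding is_connective_def continuous_map_in_subtopology
  proof
    have "continuous_map (product_topology (\<lambda>_. top_of_set {0..1}) {..<Suc 0})
        (top_of_set {0..1::real}) (\<lambda>x. x 0)"
      by (rule continuous_map_product_projection) simp
    then have "continuous_map (product_topology (\<lambda>_. top_of_set {0..1}) {..<Suc 0})
        euclideanreal (\<lambda>x. x 0)"
      by (simp add: continuous_map_in_subtopology)
    then show "continuous_map (product_topology (\<lambda>_. top_of_set {0..1}) {..<Suc 0})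
        euclideanreal (\<lambda>x. 1 - x 0)"
      by (intro continuous_intros) auto
  qed (auto simp: PiE_iff)
  then show "is_fm L (neg_fm \<phi>) \<longleftrightarrow> is_fm L \<phi>"
    by (simp add: neg_fm_def)
qed (simp_all add: neg_fm_def)

text \<open>Because of this identity witnesses for suprema suffice in the theorem of Los.\<close>

lemma InfF_conv_SupF:
  assumes "is_fm L \<phi>" "range v \<subseteq> X"
  shows "fm_val M (InfF x \<phi>) v = 1 - fm_val M (SupF x (neg_fm \<phi>)) v"
proof -
  let ?f = "\<lambda>a. fm_val M \<phi> (v(x := a))"
  have "bdd_above ((\<lambda>a. - ?f a) ` X)"
  proof -
    obtain B where "\<And>a. a \<in> X \<Longrightarrow> B \<le> ?f a"
      using fm_val_bounds(2)[OF assms, of x] unfolding bdd_below_def by auto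
    then show ?thesis by (intro bdd_aboveI2[of _ _ "- B"]) simp
  qed
  moreover from this have "bdd_above ((\<lambda>a. 1 - ?f a) ` X)"
    unfolding bdd_above_def by (force intro: exI[of _ "1 + _"])
  ultimately have "- ?f a \<le> (SUP a\<in>X. - ?f a)" "1 - ?f a \<le> (SUP a\<in>X. 1 - ?f a)" if "a \<in> X" for a
    using that by (auto intro: cSUP_upper)
  note upper = this
  have "(SUP a\<in>X. 1 - ?f a) \<le> 1 + (SUP a\<in>X. - ?f a)"
    using upper(1) by (intro cSUP_least[OF X_ne]) force
  moreover have "(SUP a\<in>X. - ?f a) \<le> (SUP a\<in>X. 1 - ?f a) - 1"
    using upper(2) by (intro cSUP_least[OF X_ne]) force
  ultimately show ?thesis
    unfolding fm_val.simps neg_fm_simps INF_eq_uminus_SUP by linarith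
qed

end

section \<open>The limit model\<close>

abbreviation "vals i gs \<equiv> map (\<lambda>g. g i) gs"

text \<open>\<open>Fam_Sup\<close> provides approximate witnesses at every index and so replaces
  Skolem functions in the theorem of Los. \<open>Fam_card\<close> bounds the family by the
  continuum, which lets the model live on the reals.\<close>

locale ultra_family = structure_over L M
  for L :: "('f, 'p) language" and M :: "('f, 'p, 'a) metric_structure" +
  fixes F :: "'i filter" and Fam :: "('i \<Rightarrow> 'a) set"
  assumes F_ne: "F \<noteq> bot"
    and ultra: "eventually P F \<or> eventually (\<lambda>i. \<not> P i) F"
    and Fam_X: "g \<in> Fam \<Longrightarrow> g i \<in> X"
    and Fam_ne: "Fam \<noteq> {}"
    and Fam_fun: "\<lbrakk>f \<in> funs L; set gs \<subseteq> Fam; length gs = fun_arity L f\<rbrakk> \<Longrightarrow>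
      (\<lambda>i. fun_int M f (vals i gs)) \<in> Fam"
    and Fam_Sup: "\<lbrakk>is_fm L \<phi>; \<And>n. v n \<in> Fam; 0 < e\<rbrakk> \<Longrightarrow>
      \<exists>g\<in>Fam. \<forall>i. fm_val M (SupF x \<phi>) (\<lambda>n. v n i) - e \<le> fm_val M \<phi> ((\<lambda>n. v n i)(x := g i))"
    and Fam_card: "|Fam| \<le>o |UNIV :: nat set set|"
begin

abbreviation "ae P \<equiv> eventually P F"
abbreviation "fun_on f gs \<equiv> \<lambda>i. fun_int M f (vals i gs)"
abbreviation "pred_on p gs \<equiv> \<lambda>i. pred_int M p (vals i gs)"

section \<open>Limits along the ultrafilter and the resulting pseudometric\<close>

definition flim :: "('i \<Rightarrow> real) \<Rightarrow> real" where
  "flim h = Lim F h"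

lemma flim_eqI: "(h \<longlongrightarrow> l) F \<Longrightarrow> flim h = l"
  unfolding flim_def using F_ne by (intro tendsto_Lim) auto

lemma flim_tendsto:
  assumes "\<And>i. h i \<in> {a..b}"
  shows "(h \<longlongrightarrow> flim h) F" and "flim h \<in> {a..b}"
proof -
  have "ae (\<lambda>i. h i \<in> {a..b})"
    using assms by (intro always_eventually allI)
  from ultrafilter_tendsto_compact[OF ultra F_ne compact_Icc this]
  obtain l where "l \<in> {a..b}" "(h \<longlongrightarrow> l) F" by blast
  moreover from this have "flim h = l" by (intro flim_eqI)
  ultimately show "(h \<longlongrightarrow> flim h) F" "flim h \<in> {a..b}" by simp_all
qed

lemma lim_le: "\<lbrakk>(h \<longlongrightarrow> l) F; ae (\<lambda>i. h i \<le> e)\<rbrakk> \<Longrightarrow> l \<le> (e :: real)"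
  by (rule tendsto_upperbound[OF _ _ F_ne])

lemma lim_ge: "\<lbrakk>(h \<longlongrightarrow> l) F; ae (\<lambda>i. e \<le> h i)\<rbrakk> \<Longrightarrow> (e :: real) \<le> l"
  by (rule tendsto_lowerbound[OF _ _ F_ne])

definition fdist :: "('i \<Rightarrow> 'a) \<Rightarrow> ('i \<Rightarrow> 'a) \<Rightarrow> real" where
  "fdist g h = flim (\<lambda>i. d (g i) (h i))"

text \<open>The model consists of all functions that are limits of the family along F. Unlike the family
  itself, they form a complete space.\<close>

definition Cl :: "('i \<Rightarrow> 'a) set" where
  "Cl = {g. (\<forall>i. g i \<in> X) \<and> (\<forall>e>0. \<exists>f\<in>Fam. ae (\<lambda>i. d (f i) (g i) < e))}"

lemma Cl_X: "g \<in> Cl \<Longrightarrow> g i \<in> X"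
  by (simp add: Cl_def)

lemma Cl_approx: "\<lbrakk>g \<in> Cl; 0 < e\<rbrakk> \<Longrightarrow> \<exists>f\<in>Fam. ae (\<lambda>i. d (f i) (g i) < e)"
  by (simp add: Cl_def)

lemma Fam_Cl: "Fam \<subseteq> Cl"
proof
  fix g assume g: "g \<in> Fam"
  have "ae (\<lambda>i. d (g i) (g i) < e)" if "0 < e" for e
    using MS.mdist_zero[OF Fam_X[OF g]] that by simp
  then show "g \<in> Cl"
    unfolding Cl_def using g Fam_X by blast
qed

lemma Cl_ne: "Cl \<noteq> {}"
  using Fam_Cl Fam_ne by blast

lemma d_range: "\<lbrakk>x \<in> X; y \<in> X\<rbrakk> \<Longrightarrow> d x y \<in> {0..1}"
  using d_le_1 by simp

lemma fdist_tendsto: "\<lbrakk>g \<in> Cl; h \<in> Cl\<rbrakk> \<Longrightarrow> ((\<lambda>i. d (g i) (h i)) \<longlongrightarrow> fdist g h) F"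
  unfolding fdist_def by (rule flim_tendsto(1)[OF d_range]) (auto simp: Cl_X)

lemma fdist_range: "\<lbrakk>g \<in> Cl; h \<in> Cl\<rbrakk> \<Longrightarrow> fdist g h \<in> {0..1}"
  unfolding fdist_def by (rule flim_tendsto(2)[OF d_range]) (auto simp: Cl_X)

lemma fdist_le: "\<lbrakk>g \<in> Cl; h \<in> Cl; ae (\<lambda>i. d (g i) (h i) \<le> e)\<rbrakk> \<Longrightarrow> fdist g h \<le> e"
  by (rule lim_le[OF fdist_tendsto])

lemma fdist_ge: "\<lbrakk>g \<in> Cl; h \<in> Cl; ae (\<lambda>i. e \<le> d (g i) (h i))\<rbrakk> \<Longrightarrow> e \<le> fdist g h"
  by (rule lim_ge[OF fdist_tendsto])

lemma fdist_less: "\<lbrakk>g \<in> Cl; h \<in> Cl; fdist g h < e\<rbrakk> \<Longrightarrow> ae (\<lambda>i. d (g i) (h i) < e)"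
  by (rule order_tendstoD(2)[OF fdist_tendsto])

lemma fdist_self: "g \<in> Cl \<Longrightarrow> fdist g g = 0"
  unfolding fdist_def by (rule flim_eqI) (simp add: Cl_X)

lemma fdist_sym: "fdist g h = fdist h g"
  unfolding fdist_def by (simp add: MS.commute)

lemma fdist_triangle:
  assumes "g \<in> Cl" "h \<in> Cl" "k \<in> Cl"
  shows "fdist g k \<le> fdist g h + fdist h k"
proof -
  have "((\<lambda>i. d (g i) (h i) + d (h i) (k i) - d (g i) (k i)) \<longlongrightarrow>
      fdist g h + fdist h k - fdist g k) F"
    using assms by (intro tendsto_intros fdist_tendsto)
  then have "0 \<le> fdist g h + fdist h k - fdist g k"
  proof (rule lim_ge, intro always_eventually allI)
    fix i show "0 \<le> d (g i) (h i) + d (h i) (k i) - d (g i) (k i)"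
      using MS.triangle[of "g i" "h i" "k i"] assms Cl_X by simp
  qed
  then show ?thesis by simp
qed

lemma fdist_zero_trans: "\<lbrakk>g \<in> Cl; h \<in> Cl; k \<in> Cl; fdist g h = 0\<rbrakk> \<Longrightarrow> fdist g k = fdist h k"
  using fdist_triangle[of g h k] fdist_triangle[of h g k] fdist_sym[of g h] by simp

text \<open>Up to distance zero a function in \<open>Cl\<close> is determined by a sequence in the
  family that approximates it. Members of the family are coded by sets of natural numbers, a
  sequence of such sets becomes one set by pairing, and sets of natural numbers inject into the
  reals.\<close>

lemma enc_exists:
  "\<exists>c :: ('i \<Rightarrow> 'a) \<Rightarrow> real. \<forall>g\<in>Cl. \<forall>h\<in>Cl. c g = c h \<longleftrightarrow> fdist g h = 0"
proof -
  obtain j :: "('i \<Rightarrow> 'a) \<Rightarrow> nat set" where j: "inj_on j Fam"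
    using Fam_card card_of_ordLeq[of Fam "UNIV :: nat set set"] by auto
  obtain r :: "nat set \<Rightarrow> real" where r: "inj r"
    using nat_sets_eqpoll_reals unfolding eqpoll_def bij_betw_def by blast
  have "\<forall>g\<in>Cl. \<exists>a. \<forall>n. a n \<in> Fam \<and> ae (\<lambda>i. d (a n i) (g i) < inverse (real (Suc n)))"
  proof
    fix g assume g: "g \<in> Cl"
    have "\<forall>n. \<exists>f. f \<in> Fam \<and> ae (\<lambda>i. d (f i) (g i) < inverse (real (Suc n)))"
      using Cl_approx[OF g] by (metis inverse_positive_iff_positive of_nat_0_less_iff zero_less_Suc)
    from choice[OF this] show "\<exists>a. \<forall>n. a n \<in> Fam \<and>
        ae (\<lambda>i. d (a n i) (g i) < inverse (real (Suc n)))" .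
  qed
  from bchoice[OF this] obtain a where a: "\<And>g n. g \<in> Cl \<Longrightarrow> a g n \<in> Fam"
      "\<And>g n. g \<in> Cl \<Longrightarrow> ae (\<lambda>i. d (a g n i) (g i) < inverse (real (Suc n)))"
    by blast
  define code where "code g = {prod_encode (n, m) |n m. m \<in> j (a g n)}" for g
  \<comment> \<open>Functions at distance zero may have different approximating sequences. Coding a
    representative makes the code depend on the class alone.\<close>
  define rep where "rep g = (SOME h. h \<in> Cl \<and> fdist g h = 0)" for g
  have rep: "rep g \<in> Cl \<and> fdist g (rep g) = 0" if "g \<in> Cl" for g
    unfolding rep_def by (rule someI[of _ g]) (use that fdist_self in simp)
  have code: "fdist g h = 0" if g: "g \<in> Cl" and h: "h \<in> Cl" and eq: "code g = code h" for g h
  proof -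
    have "a g n = a h n" for n
    proof -
      have "m \<in> j (a g n) \<longleftrightarrow> m \<in> j (a h n)" for m
      proof -
        have "m \<in> j (a k n) \<longleftrightarrow> prod_encode (n, m) \<in> code k" for k
          unfolding code_def by auto
        then show ?thesis using eq by simp
      qed
      then show ?thesis using inj_onD[OF j] a(1) g h by blast
    qed
    then have le: "fdist g h \<le> 2 * inverse (real (Suc n))" for n
    proof -
      have *: "fdist (a k n) k \<le> inverse (real (Suc n))" if "k \<in> Cl" for k
      proof (rule fdist_le[OF _ that])
        show "a k n \<in> Cl" using a(1)[OF that] Fam_Cl by blast
        show "ae (\<lambda>i. d (a k n i) (k i) \<le> inverse (real (Suc n)))"
          by (rule eventually_mono[OF a(2)[OF that]]) (rule less_imp_le)
      qed
      have "fdist g h \<le> fdist (a g n) g + fdist (a g n) h"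
        using fdist_triangle[of g "a g n" h] g h a(1) Fam_Cl fdist_sym by auto
      also have "\<dots> \<le> 2 * inverse (real (Suc n))"
        using *[OF g] *[OF h] \<open>\<And>n. a g n = a h n\<close> by simp
      finally show ?thesis .
    qed
    have "(\<lambda>n. 2 * inverse (real (Suc n))) \<longlonglongrightarrow> 2 * 0"
      by (intro tendsto_intros LIMSEQ_inverse_real_of_nat)
    then have "fdist g h \<le> 2 * 0"
      by (rule LIMSEQ_le_const) (use le in blast)
    with fdist_range[OF g h] show ?thesis by simp
  qed
  have "r (code (rep g)) = r (code (rep h)) \<longleftrightarrow> fdist g h = 0" if g: "g \<in> Cl" and h: "h \<in> Cl" for g h
  proof
    assume "r (code (rep g)) = r (code (rep h))"
    then have "code (rep g) = code (rep h)" using r by (simp add: inj_eq)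
    then have "fdist (rep g) (rep h) = 0" using code rep g h by blast
    then show "fdist g h = 0"
      using fdist_triangle[of g "rep g" h] fdist_triangle[of "rep g" "rep h" h] rep[OF g] rep[OF h]
        g h fdist_sym[of h "rep h"] fdist_range[OF g h] by auto
  next
    assume gh: "fdist g h = 0"
    have "(\<lambda>k. k \<in> Cl \<and> fdist g k = 0) = (\<lambda>k. k \<in> Cl \<and> fdist h k = 0)"
      using fdist_zero_trans[OF g h _ gh] by auto
    then have "rep g = rep h" unfolding rep_def by simp
    then show "r (code (rep g)) = r (code (rep h))" by simp
  qed
  then show ?thesis by (intro exI[of _ "\<lambda>g. r (code (rep g))"]) blast
qed

definition enc :: "('i \<Rightarrow> 'a) \<Rightarrow> real" where
  "enc = (SOME c. \<forall>g\<in>Cl. \<forall>h\<in>Cl. c g = c h \<longleftrightarrow> fdist g h = 0)"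

lemma enc_eq_iff: "\<lbrakk>g \<in> Cl; h \<in> Cl\<rbrakk> \<Longrightarrow> enc g = enc h \<longleftrightarrow> fdist g h = 0"
  using someI_ex[OF enc_exists] unfolding enc_def by blast

text \<open>Points outside the universe are decoded to an arbitrary member of Cl, so that the
  metric below is nonnegative and symmetric on all reals.\<close>

definition dec :: "real \<Rightarrow> 'i \<Rightarrow> 'a" where
  "dec x = (if x \<in> enc ` Cl then SOME g. g \<in> Cl \<and> enc g = x else SOME g. g \<in> Cl)"

lemma dec_Cl: "dec x \<in> Cl" and enc_dec: "x \<in> enc ` Cl \<Longrightarrow> enc (dec x) = x"
proof -
  have *: "(SOME g. g \<in> Cl \<and> enc g = x) \<in> Cl \<and> enc (SOME g. g \<in> Cl \<and> enc g = x) = x" if x: "x \<in> enc ` Cl"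
  proof -
    obtain g where "g \<in> Cl \<and> enc g = x" using x by blast
    then show ?thesis by (rule someI[of "\<lambda>g. g \<in> Cl \<and> enc g = x"])
  qed
  show "dec x \<in> Cl"
    using * some_in_eq[of Cl] Cl_ne unfolding dec_def by auto
  show "enc (dec x) = x" if "x \<in> enc ` Cl"
    using * that unfolding dec_def by auto
qed

lemma fdist_dec_enc: "g \<in> Cl \<Longrightarrow> fdist (dec (enc g)) g = 0"
  using enc_eq_iff[OF dec_Cl, of g "enc g"] enc_dec[of "enc g"] by simp

lemma dec_X: "dec x i \<in> X"
  by (rule Cl_X[OF dec_Cl])

section \<open>The limit structure on the reals\<close>

definition N :: "('f, 'p, real) metric_structure" where
  "N = \<lparr> univ = enc ` Cl,
         sdist = (\<lambda>x y. fdist (dec x) (dec y)),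
         fun_int = (\<lambda>f xs. enc (\<lambda>i. fun_int M f (map (\<lambda>x. dec x i) xs))),
         pred_int = (\<lambda>p xs. flim (\<lambda>i. pred_int M p (map (\<lambda>x. dec x i) xs))) \<rparr>"

lemma N_simps [simp]:
  "univ N = enc ` Cl"
  "sdist N x y = fdist (dec x) (dec y)"
  "fun_int N f xs = enc (\<lambda>i. fun_int M f (map (\<lambda>x. dec x i) xs))"
  "pred_int N p xs = flim (\<lambda>i. pred_int M p (map (\<lambda>x. dec x i) xs))"
  by (simp_all add: N_def)

lemma enc_in_N: "g \<in> Cl \<Longrightarrow> enc g \<in> univ N"
  by simp

lemma tuple_dist_tendsto:
  assumes "length gs = length hs" "set gs \<subseteq> Cl" "set hs \<subseteq> Cl"
  shows "((\<lambda>i. tuple_dist d (vals i gs) (vals i hs)) \<longlongrightarrow> tuple_dist fdist gs hs) F"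
  using assms
proof (induction gs hs rule: list_induct2)
  case (Cons g gs h hs)
  then show ?case by (auto intro!: tendsto_max fdist_tendsto)
qed simp

lemma tuple_dist_N:
  "length xs = length ys \<Longrightarrow> tuple_dist (sdist N) xs ys = tuple_dist fdist (map dec xs) (map dec ys)"
  by (induction xs ys rule: list_induct2) auto

lemma Cl_list_approx:
  assumes "set gs \<subseteq> Cl" "0 < e"
  shows "\<exists>fs. set fs \<subseteq> Fam \<and> length fs = length gs \<and>
    ae (\<lambda>i. tuple_dist d (vals i fs) (vals i gs) < e)"
  using assms(1)
proof (induction gs)
  case Nil
  then show ?case using assms(2) by simp
next
  case (Cons g gs)
  then obtain fs where fs: "set fs \<subseteq> Fam" "length fs = length gs"
      "ae (\<lambda>i. tuple_dist d (vals i fs) (vals i gs) < e)"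
    by auto
  obtain f where f: "f \<in> Fam" "ae (\<lambda>i. d (f i) (g i) < e)"
    using Cl_approx[of g e] Cons.prems assms(2) by auto
  have "ae (\<lambda>i. tuple_dist d (vals i (f # fs)) (vals i (g # gs)) < e)"
    using eventually_conj[OF f(2) fs(3)] by simp
  with fs f show ?case by (intro exI[of _ "f # fs"]) simp
qed

text \<open>The family is closed under f, and uniform continuity carries this to its limits:
  arguments from the family within the modulus give a value near the desired one.\<close>

lemma fun_Cl:
  assumes f: "f \<in> funs L" and gs: "set gs \<subseteq> Cl" "length gs = fun_arity L f"
  shows "(fun_on f gs) \<in> Cl"
  unfolding Cl_def
proof (intro CollectI conjI allI impI)
  have val: "set (vals i gs) \<subseteq> X" for i
    using gs Cl_X by auto
  then show "fun_int M f (vals i gs) \<in> X" for i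
    using f gs by (intro fun_closed) auto
  fix e :: real assume "0 < e"
  define e' where "e' = min 1 (e / 2)"
  have e': "0 < e'" "e' \<le> 1" "e' < e" using \<open>0 < e\<close> by (auto simp: e'_def)
  obtain fs where fs: "set fs \<subseteq> Fam" "length fs = length gs"
      "ae (\<lambda>i. tuple_dist d (vals i fs) (vals i gs) < fun_modulus L f e')"
    using Cl_list_approx[OF gs(1) fun_uniform(1)[OF f e'(1,2)]] by blast
  have "(fun_on f fs) \<in> Fam"
    using fs gs f by (intro Fam_fun) auto
  moreover have "ae (\<lambda>i. d (fun_int M f (vals i fs)) (fun_int M f (vals i gs)) < e)"
    using fs(3)
  proof eventually_elim
    case (elim i)
    have "set (vals i fs) \<subseteq> X" using fs(1) Fam_X by auto
    with fun_uniform(2)[OF f e'(1,2) _ _ _ val elim] fs(2) gs(2)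
    have "d (fun_int M f (vals i fs)) (fun_int M f (vals i gs)) \<le> e'" by simp
    with e'(3) show ?case by simp
  qed
  ultimately show "\<exists>k\<in>Fam. ae (\<lambda>i. d (k i) (fun_int M f (vals i gs)) < e)"
    by (intro bexI[of _ "\<lambda>i. fun_int M f (vals i fs)"])
qed

lemma fun_fdist_le:
  assumes f: "f \<in> funs L" and gs: "set gs \<subseteq> Cl" "length gs = fun_arity L f"
    and hs: "set hs \<subseteq> Cl" "length hs = fun_arity L f"
    and e: "0 < e" "e \<le> 1" and less: "tuple_dist fdist gs hs < fun_modulus L f e"
  shows "fdist (fun_on f gs) (fun_on f hs) \<le> e"
proof (rule fdist_le[OF fun_Cl[OF f gs] fun_Cl[OF f hs]])
  have "ae (\<lambda>i. tuple_dist d (vals i gs) (vals i hs) < fun_modulus L f e)"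
    using gs hs less by (intro order_tendstoD(2)[OF tuple_dist_tendsto]) auto
  then show "ae (\<lambda>i. d (fun_int M f (vals i gs)) (fun_int M f (vals i hs)) \<le> e)"
  proof eventually_elim
    case (elim i)
    show ?case
      by (rule fun_uniform(2)[OF f e _ _ _ _ elim]) (use gs hs Cl_X in auto)
  qed
qed

lemma pred_flim_tendsto:
  assumes p: "p \<in> preds L" and gs: "set gs \<subseteq> Cl" "length gs = pred_arity L p"
  shows "((pred_on p gs) \<longlongrightarrow> flim (pred_on p gs)) F"
    and "flim (pred_on p gs) \<in> {0..1}"
proof -
  have "pred_int M p (vals i gs) \<in> {0..1}" for i
    using gs Cl_X p by (intro pred_range) auto
  note * = flim_tendsto[of "\<lambda>i. pred_int M p (vals i gs)" 0 1, OF this]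
  show "((pred_on p gs) \<longlongrightarrow> flim (pred_on p gs)) F"
    "flim (pred_on p gs) \<in> {0..1}"
    using * by auto
qed

lemma pred_flim_le:
  assumes p: "p \<in> preds L" and gs: "set gs \<subseteq> Cl" "length gs = pred_arity L p"
    and hs: "set hs \<subseteq> Cl" "length hs = pred_arity L p"
    and e: "0 < e" "e \<le> 1" and less: "tuple_dist fdist gs hs < pred_modulus L p e"
  shows "\<bar>flim (pred_on p gs) - flim (pred_on p hs)\<bar> \<le> e"
proof (rule lim_le)
  show "((\<lambda>i. \<bar>pred_int M p (vals i gs) - pred_int M p (vals i hs)\<bar>) \<longlongrightarrow>
      \<bar>flim (pred_on p gs) - flim (pred_on p hs)\<bar>) F"
    by (intro tendsto_rabs tendsto_diff pred_flim_tendsto p gs hs)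
  have "ae (\<lambda>i. tuple_dist d (vals i gs) (vals i hs) < pred_modulus L p e)"
    using gs hs less by (intro order_tendstoD(2)[OF tuple_dist_tendsto]) auto
  then show "ae (\<lambda>i. \<bar>pred_int M p (vals i gs) - pred_int M p (vals i hs)\<bar> \<le> e)"
  proof eventually_elim
    case (elim i)
    show ?case
      by (rule pred_uniform(2)[OF p e _ _ _ _ elim]) (use gs hs Cl_X in auto)
  qed
qed

lemma Metric_space_N: "Metric_space (univ N) (sdist N)"
proof
  show "0 \<le> sdist N x y" for x y
    using fdist_range[OF dec_Cl dec_Cl, of x y] by simp
  show "sdist N x y = sdist N y x" for x y
    by (simp add: fdist_sym)
  show "sdist N x y = 0 \<longleftrightarrow> x = y" if "x \<in> univ N" "y \<in> univ N" for x y
    using enc_eq_iff[OF dec_Cl dec_Cl, of x y] enc_dec[of x] enc_dec[of y] that by auto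
  show "sdist N x z \<le> sdist N x y + sdist N y z" for x y z
    using fdist_triangle[OF dec_Cl dec_Cl dec_Cl, of x z y] by simp
qed

text \<open>At each index the limit function follows the sequence as long as consecutive terms are close,
  and stops at the first gap; the indices with a late first gap belong to F.\<close>

lemma Cl_limit:
  assumes g: "\<And>n. g n \<in> Cl" and fast: "\<And>n. fdist (g n) (g (Suc n)) < (1/2) ^ n"
  shows "\<exists>h\<in>Cl. \<forall>n. fdist (g n) h \<le> 2 * (1/2) ^ n"
proof -
  define close where "close i n \<longleftrightarrow> (\<forall>k<n. d (g k i) (g (Suc k) i) < (1/2) ^ k)" for i n
  have ev_close: "ae (\<lambda>i. close i n)" for n
    unfolding close_def
  proof (induction n)
    case (Suc n)
    from eventually_conj[OF Suc fdist_less[OF g g fast[of n]]]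
    show ?case by eventually_elim (auto simp: less_Suc_eq)
  qed simp
  have gX: "g n i \<in> X" for n i using g Cl_X by blast
  \<comment> \<open>The bound is the geometric sum of \<open>(1/2) ^ k\<close> over n \<le> k < m,
    which telescopes in the induction.\<close>
  have partial: "d (g n i) (g m i) \<le> 2 * (1/2) ^ n - 2 * (1/2) ^ m" if "close i m" "n \<le> m" for i n m
    using that(2,1)
  proof (induction m rule: dec_induct)
    case base
    then show ?case using gX by simp
  next
    case (step m)
    have "d (g n i) (g m i) \<le> 2 * (1/2) ^ n - 2 * (1/2) ^ m"
      using step unfolding close_def by auto
    moreover have "d (g m i) (g (Suc m) i) < (1/2) ^ m"
      using step unfolding close_def by auto
    moreover have "d (g n i) (g (Suc m) i) \<le> d (g n i) (g m i) + d (g m i) (g (Suc m) i)"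
      using MS.triangle gX by blast
    moreover have "2 * (1/2 :: real) ^ Suc m = (1/2) ^ m" by simp
    ultimately show ?case by linarith
  qed
  have "\<exists>y. y \<in> X \<and> (\<forall>n. close i n \<longrightarrow> d (g n i) y \<le> 2 * (1/2) ^ n)" for i
  proof (cases "\<forall>n. close i n")
    case True
    have small: "d (g n i) (g m i) \<le> 2 * (1/2) ^ n" if "n \<le> m" for n m
    proof -
      have "0 \<le> (1/2 :: real) ^ m" by simp
      moreover have "d (g n i) (g m i) \<le> 2 * (1/2) ^ n - 2 * (1/2) ^ m"
        by (rule partial) (use True that in auto)
      ultimately show ?thesis by linarith
    qed
    have "MS.MCauchy (\<lambda>n. g n i)"
      unfolding MS.MCauchy_def
    proof (intro conjI allI impI)
      show "range (\<lambda>n. g n i) \<subseteq> X" using gX by auto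
      fix e :: real assume "0 < e"
      obtain k where k: "(1/2 :: real) ^ k < e / 4"
        using real_arch_pow_inv[of "e / 4" "1/2"] \<open>0 < e\<close> by auto
      have "d (g n i) (g n' i) < e" if "k \<le> n" "k \<le> n'" for n n'
        using small[OF that(1)] small[OF that(2)] MS.triangle[of "g n i" "g k i" "g n' i"] gX k
          MS.commute[of "g n i" "g k i"] by auto
      then show "\<exists>N. \<forall>n n'. N \<le> n \<longrightarrow> N \<le> n' \<longrightarrow> d (g n i) (g n' i) < e" by blast
    qed
    then obtain y where y: "limitin MS.mtopology (\<lambda>n. g n i) y sequentially"
      using complete unfolding MS.mcomplete_def by blast
    then have yX: "y \<in> X" by (simp add: MS.limit_metric_sequentially)
    have "d (g n i) y \<le> 2 * (1/2) ^ n" for n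
    proof (rule field_le_epsilon)
      fix e :: real assume "0 < e"
      then obtain K where K: "\<And>m. K \<le> m \<Longrightarrow> d (g m i) y < e"
        using y unfolding MS.limit_metric_sequentially by blast
      have "d (g n i) y \<le> d (g n i) (g (max K n) i) + d (g (max K n) i) y"
        using MS.triangle gX yX by blast
      with small[of n "max K n"] K[of "max K n"] show "d (g n i) y \<le> 2 * (1/2) ^ n + e" by simp
    qed
    with yX show ?thesis by blast
  next
    case False
    \<comment> \<open>This b is the largest number with \<open>close i b\<close>, that is, the place
      of the first gap. The value \<open>g b i\<close> is then near \<open>g n i\<close> for all n
      \<le> b.\<close>
    define b where "b = (LEAST n. \<not> close i (Suc n))"
    have mono: "close i n" if "close i m" "n \<le> m" for n m
      using that unfolding close_def by auto
    from False obtain n where "\<not> close i n" by blast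
    then have "\<not> close i (Suc n)" using mono[of "Suc n" n] by auto
    then have "\<exists>n. \<not> close i (Suc n)" ..
    then have "\<not> close i (Suc b)" unfolding b_def by (rule LeastI_ex)
    then have le_b: "n \<le> b" if "close i n" for n
      using mono[OF that, of "Suc b"] by (cases "n \<le> b") auto
    have "close i b"
    proof (cases b)
      case (Suc c)
      then have "c < (LEAST n. \<not> close i (Suc n))" unfolding b_def by simp
      from not_less_Least[OF this] show ?thesis using Suc by simp
    qed (simp add: close_def)
    have "d (g n i) (g b i) \<le> 2 * (1/2) ^ n" if "close i n" for n
    proof -
      have "0 \<le> (1/2 :: real) ^ b" by simp
      with partial[OF \<open>close i b\<close> le_b[OF that]] show ?thesis by linarith
    qed
    then show ?thesis using gX by blast
  qed
  then obtain h where h: "\<And>i. h i \<in> X" "\<And>i n. close i n \<Longrightarrow> d (g n i) (h i) \<le> 2 * (1/2) ^ n"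
    by metis
  have near: "ae (\<lambda>i. d (g n i) (h i) \<le> 2 * (1/2) ^ n)" for n
    using ev_close[of n] by eventually_elim (rule h(2))
  have hCl: "h \<in> Cl"
    unfolding Cl_def
  proof (intro CollectI conjI allI impI h)
    fix e :: real assume "0 < e"
    obtain n where n: "(1/2 :: real) ^ n < e / 4"
      using real_arch_pow_inv[of "e / 4" "1/2"] \<open>0 < e\<close> by auto
    obtain f where f: "f \<in> Fam" "ae (\<lambda>i. d (f i) (g n i) < e / 2)"
      using Cl_approx[OF g, of "e / 2" n] \<open>0 < e\<close> by auto
    from f(2) near[of n] have "ae (\<lambda>i. d (f i) (h i) < e)"
    proof eventually_elim
      case (elim i)
      have "d (f i) (h i) \<le> d (f i) (g n i) + d (g n i) (h i)"
        using MS.triangle Fam_X[OF f(1)] gX h(1) by blast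
      with elim n show ?case by linarith
    qed
    with f(1) show "\<exists>f\<in>Fam. ae (\<lambda>i. d (f i) (h i) < e)" by blast
  qed
  have "fdist (g n) h \<le> 2 * (1/2) ^ n" for n
    by (rule fdist_le[OF g hCl near])
  with hCl show ?thesis by blast
qed

end

text \<open>The bound e \<le> 1 is imposed because moduli are controlled only there.\<close>

lemma nonpos_if_le_small:
  fixes a :: real
  assumes "\<And>e. \<lbrakk>0 < e; e \<le> 1\<rbrakk> \<Longrightarrow> a \<le> e"
  shows "a \<le> 0"
proof (rule ccontr)
  assume "\<not> a \<le> 0"
  then have "0 < min 1 (a / 2)" "min 1 (a / 2) \<le> 1" "min 1 (a / 2) < a" by auto
  then show False using assms[of "min 1 (a / 2)"] by linarith
qed

context ultra_family
begin

section \<open>Completeness of the limit structure\<close>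

lemma sdist_enc:
  assumes "g \<in> Cl" "h \<in> Cl"
  shows "sdist N (enc g) (enc h) = fdist g h"
  using fdist_zero_trans[OF dec_Cl assms(1) dec_Cl fdist_dec_enc[OF assms(1)], of "enc h"]
    fdist_zero_trans[OF dec_Cl assms(2) assms(1) fdist_dec_enc[OF assms(2)]]
  by (simp add: fdist_sym[of g])

lemma mcomplete_N: "Metric_space.mcomplete (univ N) (sdist N)"
proof -
  interpret N: Metric_space "univ N" "sdist N" by (rule Metric_space_N)
  show ?thesis
    unfolding N.mcomplete_def
  proof (intro allI impI)
    fix \<sigma> assume \<sigma>: "N.MCauchy \<sigma>"
    have \<sigma>N: "\<sigma> n \<in> univ N" for n using \<sigma> unfolding N.MCauchy_def by blast
    have "\<forall>n. \<exists>k. \<forall>a b. k \<le> a \<longrightarrow> k \<le> b \<longrightarrow> sdist N (\<sigma> a) (\<sigma> b) < (1/2) ^ n"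
    proof
      fix n
      have "(0::real) < (1/2) ^ n" by simp
      with \<sigma> show "\<exists>k. \<forall>a b. k \<le> a \<longrightarrow> k \<le> b \<longrightarrow> sdist N (\<sigma> a) (\<sigma> b) < (1/2) ^ n"
        unfolding N.MCauchy_def by blast
    qed
    from choice[OF this] obtain k where
      k: "\<And>n a b. \<lbrakk>k n \<le> a; k n \<le> b\<rbrakk> \<Longrightarrow> sdist N (\<sigma> a) (\<sigma> b) < (1/2) ^ n"
      by blast
    \<comment> \<open>Both \<open>K n\<close> and \<open>K (Suc n)\<close> have to be at least
      \<open>k n\<close>; partial sums achieve this without assuming k monotone.\<close>
    define K where "K n = (\<Sum>j\<le>n. k j)" for n
    have kK: "k n \<le> K n" for n
      unfolding K_def by (rule member_le_sum) auto
    have "k n \<le> K (Suc n)" for n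
      using kK[of n] unfolding K_def by simp
    then have "fdist (dec (\<sigma> (K n))) (dec (\<sigma> (K (Suc n)))) < (1/2) ^ n" for n
      using k[OF kK, of n "K (Suc n)"] by simp
    from Cl_limit[of "\<lambda>n. dec (\<sigma> (K n))", OF dec_Cl this]
    obtain h where h: "h \<in> Cl" "\<And>n. fdist (dec (\<sigma> (K n))) h \<le> 2 * (1/2) ^ n" by blast
    have "limitin N.mtopology \<sigma> (enc h) sequentially"
      unfolding N.limit_metric_sequentially
    proof (intro conjI allI impI)
      show "enc h \<in> univ N" using h(1) by simp
      fix e :: real assume "0 < e"
      obtain n where n: "(1/2 :: real) ^ n < e / 4"
        using real_arch_pow_inv[of "e / 4" "1/2"] \<open>0 < e\<close> by auto
      have "sdist N (\<sigma> m) (enc h) < e" if "K n \<le> m" for m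
      proof -
        have "k n \<le> m" using kK[of n] that by simp
        then have "fdist (dec (\<sigma> m)) (dec (\<sigma> (K n))) < (1/2) ^ n"
          using k[OF _ kK, of n m] by simp
        moreover have "fdist (dec (\<sigma> m)) h \<le> fdist (dec (\<sigma> m)) (dec (\<sigma> (K n))) + fdist (dec (\<sigma> (K n))) h"
          using h(1) by (intro fdist_triangle dec_Cl)
        moreover have "sdist N (\<sigma> m) (enc h) = fdist (dec (\<sigma> m)) h"
          using sdist_enc[OF dec_Cl h(1), of "\<sigma> m"] enc_dec[of "\<sigma> m"] \<sigma>N[of m] by simp
        ultimately show ?thesis using h(2)[of n] n \<open>0 < e\<close> by linarith
      qed
      then show "\<exists>Na. \<forall>m\<ge>Na. \<sigma> m \<in> univ N \<and> sdist N (\<sigma> m) (enc h) < e"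
        using \<sigma>N by blast
    qed
    then show "\<exists>x. limitin N.mtopology \<sigma> x sequentially" ..
  qed
qed

lemma map_dec: "map (\<lambda>x. dec x i) xs = vals i (map dec xs)"
  by simp

lemma set_map_dec: "set (map dec xs) \<subseteq> Cl"
  using dec_Cl by auto

lemma structure_N: "is_structure L N"
  unfolding is_structure_def
proof (intro conjI ballI impI)
  show "univ N \<noteq> {}" using Cl_ne by simp
  show "Metric_space (univ N) (sdist N)" by (rule Metric_space_N)
  show "Metric_space.mcomplete (univ N) (sdist N)" by (rule mcomplete_N)
  show "sdist N x y \<le> 1" for x y using fdist_range[OF dec_Cl dec_Cl, of x y] by simp
next
  fix f xs assume f: "f \<in> funs L" and xs: "xs \<in> tuples (fun_arity L f) (univ N)"
  show "fun_int N f xs \<in> univ N"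
    unfolding N_simps(3) map_dec using f xs
    by (intro enc_in_N fun_Cl set_map_dec) (auto simp: tuples_def)
next
  fix f e xs ys assume f: "f \<in> funs L" and e: "e \<in> {0<..1 :: real}"
    and xs: "xs \<in> tuples (fun_arity L f) (univ N)" and ys: "ys \<in> tuples (fun_arity L f) (univ N)"
    and less: "tuple_dist (sdist N) xs ys < fun_modulus L f e"
  have len: "length (map dec xs) = fun_arity L f" "length (map dec ys) = fun_arity L f"
    using xs ys by (auto simp: tuples_def)
  have "tuple_dist fdist (map dec xs) (map dec ys) < fun_modulus L f e"
    using less tuple_dist_N[of xs ys] len by simp
  then show "sdist N (fun_int N f xs) (fun_int N f ys) \<le> e"
    unfolding N_simps(3) map_dec
    using e by (subst sdist_enc[OF fun_Cl[OF f set_map_dec len(1)] fun_Cl[OF f set_map_dec len(2)]])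
      (intro fun_fdist_le[OF f set_map_dec len(1) set_map_dec len(2)], auto)
next
  fix p xs assume p: "p \<in> preds L" and xs: "xs \<in> tuples (pred_arity L p) (univ N)"
  show "pred_int N p xs \<in> {0..1}"
    unfolding N_simps(4) map_dec using p xs
    by (intro pred_flim_tendsto set_map_dec) (auto simp: tuples_def)
next
  fix p e xs ys assume p: "p \<in> preds L" and e: "e \<in> {0<..1 :: real}"
    and xs: "xs \<in> tuples (pred_arity L p) (univ N)" and ys: "ys \<in> tuples (pred_arity L p) (univ N)"
    and less: "tuple_dist (sdist N) xs ys < pred_modulus L p e"
  have len: "length (map dec xs) = pred_arity L p" "length (map dec ys) = pred_arity L p"
    using xs ys by (auto simp: tuples_def)
  have "tuple_dist fdist (map dec xs) (map dec ys) < pred_modulus L p e"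
    using less tuple_dist_N[of xs ys] len by simp
  then show "\<bar>pred_int N p xs - pred_int N p ys\<bar> \<le> e"
    unfolding N_simps(4) map_dec
    using e by (intro pred_flim_le[OF p set_map_dec len(1) set_map_dec len(2)]) auto
qed

sublocale N: structure_over L N
  by unfold_locales (rule language, rule structure_N)

section \<open>The theorem of Los\<close>

lemma list_fdist_zero:
  assumes "\<And>t. t \<in> set ts \<Longrightarrow> fdist (g t) (h t) = 0"
  shows "tuple_dist fdist (map g ts) (map h ts) = 0"
  using assms by (induction ts) auto

text \<open>Values in \<open>N\<close> pass through codes, and decoding a code returns a function
  only up to distance zero. Hence distance zero in place of equality.\<close>

lemma tm_val_N:
  assumes v: "range v \<subseteq> univ N"
  shows "is_tm L t \<Longrightarrow> (\<lambda>i. tm_val M t (\<lambda>n. dec (v n) i)) \<in> Cl \<and>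
    fdist (dec (tm_val N t v)) (\<lambda>i. tm_val M t (\<lambda>n. dec (v n) i)) = 0"
proof (induction t)
  case (Var n)
  have "(\<lambda>i. dec (v n) i) = dec (v n)" by simp
  then show ?case using fdist_self[OF dec_Cl] dec_Cl by simp
next
  case (Fn f ts)
  define h where "h t = (\<lambda>i. tm_val M t (\<lambda>n. dec (v n) i))" for t
  define k where "k = map (\<lambda>t. dec (tm_val N t v)) ts"
  have f: "f \<in> funs L" and len: "length ts = fun_arity L f" using Fn.prems by auto
  have IH: "h t \<in> Cl" "fdist (dec (tm_val N t v)) (h t) = 0" if "t \<in> set ts" for t
    using Fn.IH[OF that] Fn.prems that by (auto simp: h_def)
  have hs: "set (map h ts) \<subseteq> Cl" "length (map h ts) = fun_arity L f" using IH len by auto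
  have ks: "set k \<subseteq> Cl" "length k = fun_arity L f" using dec_Cl len by (auto simp: k_def)
  have eq1: "(\<lambda>i. tm_val M (Fn f ts) (\<lambda>n. dec (v n) i)) = (fun_on f (map h ts))"
    by (simp add: h_def comp_def)
  have eq2: "tm_val N (Fn f ts) v = enc (fun_on f k)"
    by (simp add: k_def comp_def)
  have td: "tuple_dist fdist k (map h ts) = 0"
    unfolding k_def using IH by (intro list_fdist_zero)
  have "fdist (fun_on f k) (fun_on f (map h ts)) \<le> 0"
  proof (rule nonpos_if_le_small)
    fix e :: real assume e: "0 < e" "e \<le> 1"
    show "fdist (fun_on f k) (fun_on f (map h ts)) \<le> e"
      by (rule fun_fdist_le[OF f ks hs e]) (simp only: td fun_uniform(1)[OF f e])
  qed
  moreover have "0 \<le> fdist (fun_on f k) (fun_on f (map h ts))"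
    using fdist_range[OF fun_Cl[OF f ks] fun_Cl[OF f hs]] by simp
  ultimately have "fdist (fun_on f k) (fun_on f (map h ts)) = 0"
    by simp
  then show ?case
    unfolding eq1 eq2
    using fun_Cl[OF f hs] fdist_zero_trans[OF dec_Cl fun_Cl[OF f ks] fun_Cl[OF f hs] fdist_dec_enc[OF fun_Cl[OF f ks]]]
    by simp
qed

definition los :: "('f, 'p) fm \<Rightarrow> bool" where
  "los \<phi> \<longleftrightarrow> (\<forall>v. range v \<subseteq> univ N \<longrightarrow>
    ((\<lambda>i. fm_val M \<phi> (\<lambda>n. dec (v n) i)) \<longlongrightarrow> fm_val N \<phi> v) F)"

lemma range_dec: "range (\<lambda>n. dec (v n) i) \<subseteq> X"
  using dec_X by auto

text \<open>\<open>Fam_Sup\<close> applies to assignments in the family, while decoded points are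
  only limits of such. They are replaced by nearby members w. The three parts of e pay for the
  change in the supremum, the choice of the witness and the change in \<phi>.\<close>

lemma skolem_N:
  assumes fm: "is_fm L \<phi>" and v: "range v \<subseteq> univ N" and "0 < e"
  shows "\<exists>b\<in>univ N. ae (\<lambda>i. fm_val M (SupF x \<phi>) (\<lambda>n. dec (v n) i) - e \<le>
    fm_val M \<phi> (\<lambda>n. dec ((v(x := b)) n) i))"
proof -
  have e3: "0 < e / 3" using \<open>0 < e\<close> by simp
  obtain \<delta>1 where \<delta>1: "\<delta>1 > 0" "\<And>v w. close (fm_vars \<phi>) \<delta>1 v w \<Longrightarrow> \<bar>fm_val M \<phi> v - fm_val M \<phi> w\<bar> \<le> e / 3"
    using fm_uniform[OF fm e3] by blast
  have fmS: "is_fm L (SupF x \<phi>)" using fm by simp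
  obtain \<delta>2 where \<delta>2: "\<delta>2 > 0" "\<And>v w. close (fm_vars (SupF x \<phi>)) \<delta>2 v w \<Longrightarrow>
      \<bar>fm_val M (SupF x \<phi>) v - fm_val M (SupF x \<phi>) w\<bar> \<le> e / 3"
    using fm_uniform[OF fmS e3] by blast
  define \<delta> where "\<delta> = min \<delta>1 \<delta>2"
  have \<delta>: "0 < \<delta>" "\<delta> \<le> \<delta>1" "\<delta> \<le> \<delta>2" using \<delta>1 \<delta>2 by (auto simp: \<delta>_def)
  have "\<forall>n. \<exists>f. f \<in> Fam \<and> ae (\<lambda>i. d (f i) (dec (v n) i) < \<delta>)"
    using Cl_approx[OF dec_Cl \<delta>(1)] by blast
  from choice[OF this] obtain w where w: "\<And>n. w n \<in> Fam"
      "\<And>n. ae (\<lambda>i. d (w n i) (dec (v n) i) < \<delta>)"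
    by blast
  obtain g where g: "g \<in> Fam"
      "\<And>i. fm_val M (SupF x \<phi>) (\<lambda>n. w n i) - e / 3 \<le> fm_val M \<phi> ((\<lambda>n. w n i)(x := g i))"
    using Fam_Sup[of \<phi> w, OF fm w(1) e3] by blast
  have gCl: "g \<in> Cl" using g(1) Fam_Cl by blast
  define b where "b = enc g"
  have "fdist g (dec b) < \<delta>"
    using fdist_dec_enc[OF gCl] \<delta>(1) by (simp add: b_def fdist_sym)
  from fdist_less[OF gCl dec_Cl this] have ev1: "ae (\<lambda>i. d (g i) (dec b i) < \<delta>)" .
  \<comment> \<open>Almost everywhere only finitely many approximations can be required at once; the
    free variables of \<phi> are enough.\<close>
  have ev2: "ae (\<lambda>i. \<forall>n\<in>fm_vars \<phi>. d (w n i) (dec (v n) i) < \<delta>)"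
    using w(2) by (intro eventually_ball_finite) auto
  have "ae (\<lambda>i. fm_val M (SupF x \<phi>) (\<lambda>n. dec (v n) i) - e \<le>
      fm_val M \<phi> (\<lambda>n. dec ((v(x := b)) n) i))"
    using ev1 ev2
  proof eventually_elim
    case (elim i)
    have rw: "range (\<lambda>n. w n i) \<subseteq> X" using w(1) Fam_X by auto
    have gX: "g i \<in> X" using g(1) Fam_X by blast
    have "\<bar>fm_val M (SupF x \<phi>) (\<lambda>n. w n i) - fm_val M (SupF x \<phi>) (\<lambda>n. dec (v n) i)\<bar> \<le> e / 3"
      by (rule \<delta>2(2)) (use elim(2) \<delta>(3) rw range_dec[of v i] in \<open>auto simp: close_def\<close>)
    moreover have "\<bar>fm_val M \<phi> ((\<lambda>n. w n i)(x := g i)) - fm_val M \<phi> (\<lambda>n. dec ((v(x := b)) n) i)\<bar> \<le> e / 3"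
      by (rule \<delta>1(2)) (use elim \<delta>(2) rw gX range_dec[of "v(x := b)" i] in \<open>auto simp: close_def\<close>)
    ultimately show ?case using g(2)[of i] by linarith
  qed
  moreover have "b \<in> univ N" using gCl by (simp add: b_def)
  ultimately show ?thesis by blast
qed

text \<open>The limit l of the suprema bounds all values in \<open>N\<close>, as it does so index by
  index. Conversely \<open>skolem_N\<close> gives one point that nearly attains the suprema at
  almost all indices.\<close>

lemma los_SupF:
  assumes fm: "is_fm L \<phi>" and IH: "los \<phi>"
  shows "los (SupF x \<phi>)"
  unfolding los_def
proof (intro allI impI)
  fix v :: "nat \<Rightarrow> real" assume v: "range v \<subseteq> univ N"
  let ?f = "\<lambda>b i. fm_val M \<phi> (\<lambda>n. dec ((v(x := b)) n) i)"
  let ?s = "\<lambda>i. fm_val M (SupF x \<phi>) (\<lambda>n. dec (v n) i)"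
  have fmS: "is_fm L (SupF x \<phi>)" using fm by simp
  define l where "l = flim ?s"
  have l: "(?s \<longlongrightarrow> l) F"
    unfolding l_def by (rule flim_tendsto(1)[OF fm_val_range[OF fmS range_dec]])
  have lim: "(?f b \<longlongrightarrow> fm_val N \<phi> (v(x := b))) F"
    if "b \<in> univ N" for b
  proof -
    have "range (v(x := b)) \<subseteq> univ N" using v that by auto
    then show ?thesis using IH unfolding los_def by blast
  qed
  have upd: "(\<lambda>n. dec ((v(x := b)) n) i) = (\<lambda>n. dec (v n) i)(x := dec b i)" for b i
    by auto
  have "fm_val N \<phi> (v(x := b)) \<le> l" if b: "b \<in> univ N" for b
  proof -
    have "((\<lambda>i. ?s i - ?f b i) \<longlongrightarrow> l - fm_val N \<phi> (v(x := b))) F"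
      by (intro tendsto_diff l lim b)
    then have "0 \<le> l - fm_val N \<phi> (v(x := b))"
    proof (rule lim_ge, intro always_eventually allI)
      fix i
      show "0 \<le> ?s i - ?f b i"
        using cSUP_upper[OF dec_X[of b i] fm_val_bounds(1)[OF fm range_dec[of v i], of x]]
        unfolding upd by simp
    qed
    then show ?thesis by simp
  qed
  then have "fm_val N (SupF x \<phi>) v \<le> l"
    unfolding fm_val.simps by (intro cSUP_least N.X_ne)
  moreover have "l \<le> fm_val N (SupF x \<phi>) v"
  proof (rule field_le_epsilon)
    fix e :: real assume "0 < e"
    obtain b where b: "b \<in> univ N" "ae (\<lambda>i. ?s i - e \<le> ?f b i)"
      using skolem_N[OF fm v \<open>0 < e\<close>] by blast
    have "((\<lambda>i. ?s i - ?f b i) \<longlongrightarrow> l - fm_val N \<phi> (v(x := b))) F"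
      by (intro tendsto_diff l lim b)
    then have "l - fm_val N \<phi> (v(x := b)) \<le> e"
      by (rule lim_le) (rule eventually_mono[OF b(2)], simp)
    moreover have "fm_val N \<phi> (v(x := b)) \<le> fm_val N (SupF x \<phi>) v"
      unfolding fm_val.simps by (rule cSUP_upper[OF b(1) N.fm_val_bounds(1)[OF fm v]])
    ultimately show "l \<le> fm_val N (SupF x \<phi>) v + e" by simp
  qed
  ultimately have "fm_val N (SupF x \<phi>) v = l" by (rule antisym)
  then show "(?s \<longlongrightarrow> fm_val N (SupF x \<phi>) v) F"
    using l by (simp only:)
qed

lemma los: "is_fm L \<phi> \<Longrightarrow> los \<phi>"
proof (induction \<phi>)
  case (DistF s t)
  show ?case
    unfolding los_def fm_val.simps
  proof (intro allI impI)
    fix v :: "nat \<Rightarrow> real" assume v: "range v \<subseteq> univ N"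
    let ?s = "\<lambda>i. tm_val M s (\<lambda>n. dec (v n) i)" and ?t = "\<lambda>i. tm_val M t (\<lambda>n. dec (v n) i)"
    have s: "?s \<in> Cl" "fdist (dec (tm_val N s v)) ?s = 0" and t: "?t \<in> Cl" "fdist (dec (tm_val N t v)) ?t = 0"
      using tm_val_N[OF v, of s] tm_val_N[OF v, of t] DistF by auto
    have "sdist N (tm_val N s v) (tm_val N t v) = fdist ?s (dec (tm_val N t v))"
      unfolding N_simps by (rule fdist_zero_trans[OF dec_Cl s(1) dec_Cl s(2)])
    also have "\<dots> = fdist (dec (tm_val N t v)) ?s" by (rule fdist_sym)
    also have "\<dots> = fdist ?t ?s" by (rule fdist_zero_trans[OF dec_Cl t(1) s(1) t(2)])
    also have "\<dots> = fdist ?s ?t" by (rule fdist_sym)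
    finally show "((\<lambda>i. d (?s i) (?t i)) \<longlongrightarrow> sdist N (tm_val N s v) (tm_val N t v)) F"
      using fdist_tendsto[OF s(1) t(1)] by (simp only:)
  qed
next
  case (PredF p ts)
  show ?case
    unfolding los_def
  proof (intro allI impI)
    fix v :: "nat \<Rightarrow> real" assume v: "range v \<subseteq> univ N"
    have p: "p \<in> preds L" and len: "length ts = pred_arity L p" using PredF by auto
    define h where "h t = (\<lambda>i. tm_val M t (\<lambda>n. dec (v n) i))" for t
    define k where "k = map (\<lambda>t. dec (tm_val N t v)) ts"
    have h: "h t \<in> Cl" "fdist (dec (tm_val N t v)) (h t) = 0" if "t \<in> set ts" for t
      using tm_val_N[OF v, of t] PredF that by (auto simp: h_def)
    have hs: "set (map h ts) \<subseteq> Cl" "length (map h ts) = pred_arity L p" using h len by auto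
    have ks: "set k \<subseteq> Cl" "length k = pred_arity L p" using dec_Cl len by (auto simp: k_def)
    have eq1: "(\<lambda>i. fm_val M (PredF p ts) (\<lambda>n. dec (v n) i)) = (pred_on p (map h ts))"
      by (simp add: h_def comp_def)
    have eq2: "fm_val N (PredF p ts) v = flim (pred_on p k)"
      by (simp add: k_def comp_def)
    have td: "tuple_dist fdist k (map h ts) = 0"
      unfolding k_def using h by (intro list_fdist_zero)
    let ?a = "flim (pred_on p k)" and ?b = "flim (pred_on p (map h ts))"
    have "\<bar>?a - ?b\<bar> \<le> 0"
    proof (rule nonpos_if_le_small)
      fix e :: real assume e: "0 < e" "e \<le> 1"
      show "\<bar>?a - ?b\<bar> \<le> e"
        by (rule pred_flim_le[OF p ks hs e]) (simp only: td pred_uniform(1)[OF p e])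
    qed
    then have "?a = ?b" by simp
    then show "((\<lambda>i. fm_val M (PredF p ts) (\<lambda>n. dec (v n) i)) \<longlongrightarrow> fm_val N (PredF p ts) v) F"
      unfolding eq1 eq2 using pred_flim_tendsto(1)[OF p hs] by simp
  qed
next
  case (ConnF u \<phi>s)
  show ?case
    unfolding los_def fm_val.simps
  proof (intro allI impI, rule connective_tendsto)
    fix v :: "nat \<Rightarrow> real" assume v: "range v \<subseteq> univ N"
    show "is_connective (length \<phi>s) u" using ConnF.prems by simp
    fix k assume k: "k < length \<phi>s"
    then have fm: "is_fm L (\<phi>s ! k)" using ConnF.prems by auto
    show "map (\<lambda>\<phi>. fm_val M \<phi> (\<lambda>n. dec (v n) i)) \<phi>s ! k \<in> {0..1}" for i
      using fm_val_range[OF fm range_dec] k by simp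
    show "map (\<lambda>\<phi>. fm_val N \<phi> v) \<phi>s ! k \<in> {0..1}"
      using N.fm_val_range[OF fm v] k by simp
    have "los (\<phi>s ! k)" using ConnF.IH fm k by simp
    then show "((\<lambda>i. map (\<lambda>\<phi>. fm_val M \<phi> (\<lambda>n. dec (v n) i)) \<phi>s ! k) \<longlongrightarrow>
        map (\<lambda>\<phi>. fm_val N \<phi> v) \<phi>s ! k) F"
      using v k unfolding los_def by simp
  qed
next
  case (SupF x \<phi>)
  then show ?case by (intro los_SupF) auto
next
  case (InfF x \<phi>)
  have fm: "is_fm L \<phi>" and "los \<phi>" using InfF by auto
  then have "los (neg_fm \<phi>)"
    unfolding los_def neg_fm_simps by (intro allI impI tendsto_diff tendsto_const) blast
  moreover have "is_fm L (neg_fm \<phi>)" using fm by simp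
  ultimately have "los (SupF x (neg_fm \<phi>))" by (intro los_SupF)
  then show ?case
    unfolding los_def
  proof (intro allI impI)
    fix v :: "nat \<Rightarrow> real" assume v: "range v \<subseteq> univ N"
      and "\<forall>v. range v \<subseteq> univ N \<longrightarrow> ((\<lambda>i. fm_val M (SupF x (neg_fm \<phi>)) (\<lambda>n. dec (v n) i)) \<longlongrightarrow>
        fm_val N (SupF x (neg_fm \<phi>)) v) F"
    then have "((\<lambda>i. 1 - fm_val M (SupF x (neg_fm \<phi>)) (\<lambda>n. dec (v n) i)) \<longlongrightarrow>
        1 - fm_val N (SupF x (neg_fm \<phi>)) v) F"
      by (intro tendsto_diff tendsto_const) blast
    then show "((\<lambda>i. fm_val M (InfF x \<phi>) (\<lambda>n. dec (v n) i)) \<longlongrightarrow> fm_val N (InfF x \<phi>) v) F"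
      using InfF_conv_SupF[OF fm range_dec] N.InfF_conv_SupF[OF fm v] by simp
  qed
qed

lemma fm_val_N_tendsto:
  "\<lbrakk>is_fm L \<phi>; range v \<subseteq> univ N\<rbrakk> \<Longrightarrow> ((\<lambda>i. fm_val M \<phi> (\<lambda>n. dec (v n) i)) \<longlongrightarrow> fm_val N \<phi> v) F"
  using los unfolding los_def by blast

lemma Fam_dense:
  assumes "x \<in> univ N" "0 < e"
  shows "\<exists>g\<in>Fam. sdist N x (enc g) < e"
proof -
  obtain g where g: "g \<in> Fam" "ae (\<lambda>i. d (g i) (dec x i) < e / 2)"
    using Cl_approx[OF dec_Cl, of "e / 2"] assms(2) by auto
  have gCl: "g \<in> Cl" using g(1) Fam_Cl by blast
  have "fdist g (dec x) \<le> e / 2"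
    by (rule fdist_le[OF gCl dec_Cl]) (rule eventually_mono[OF g(2)], simp)
  moreover have "sdist N x (enc g) = fdist (dec x) g"
    using sdist_enc[OF dec_Cl gCl, of x] enc_dec[of x] assms(1) by simp
  ultimately show ?thesis using g(1) assms(2) by (intro bexI[of _ g]) (auto simp: fdist_sym)
qed

end

section \<open>Families of size \<open>\<aleph>\<^sub>1\<close>\<close>

lemma uncountable_iff_cardSuc_ordLeq: "uncountable A \<longleftrightarrow> cardSuc natLeq \<le>o |A|"
proof -
  have "uncountable A \<longleftrightarrow> natLeq <o |A|"
    unfolding countable_card_le_natLeq
    using not_ordLeq_iff_ordLess[OF natLeq_Well_order card_of_Well_order, of A] by blast
  also have "\<dots> \<longleftrightarrow> cardSuc natLeq \<le>o |A|"
    by (rule cardSuc_ordLess_ordLeq[OF natLeq_Card_order card_of_Card_order])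
  finally show ?thesis .
qed

lemma uncountable_nat_sets: "uncountable (UNIV :: nat set set)"
  by (metis countable_def Cantors_theorem inj_on_def inj_imp_surj_inv surj_def UNIV_I Pow_UNIV)

lemma subset_of_card_cardSuc:
  assumes "uncountable J"
  obtains W where "W \<subseteq> J" "|W| =o cardSuc natLeq"
proof -
  have "|Field (cardSuc natLeq)| \<le>o |J|"
    using assms card_of_Field_ordIso[OF cardSuc_Card_order[OF natLeq_Card_order]]
      ordIso_ordLeq_trans unfolding uncountable_iff_cardSuc_ordLeq by blast
  then obtain f where f: "inj_on f (Field (cardSuc natLeq))" "f ` Field (cardSuc natLeq) \<subseteq> J"
    unfolding card_of_ordLeq[symmetric] by blast
  have "|f ` Field (cardSuc natLeq)| =o |Field (cardSuc natLeq)|"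
    using card_of_ordIsoI[OF inj_on_imp_bij_betw[OF f(1)]] ordIso_symmetric by blast
  also have "|Field (cardSuc natLeq)| =o cardSuc natLeq"
    by (rule card_of_Field_ordIso[OF cardSuc_Card_order[OF natLeq_Card_order]])
  finally show thesis using that f(2) by blast
qed

text \<open>Every finite subset of the first uncountable cardinal lies in one of its countable initial
  segments, so the terms form a union of \<open>\<aleph>\<^sub>1\<close> countable sets.\<close>

lemma card_of_terms:
  fixes W :: "'o set"
  assumes W: "|W| =o cardSuc natLeq"
  shows "|{t. set_sk t \<subseteq> W}| \<le>o cardSuc natLeq"
proof -
  let ?r = "cardSuc natLeq"
  have r: "Card_order ?r" by (rule cardSuc_Card_order[OF natLeq_Card_order])
  then have wo: "Well_order ?r" by (simp add: card_order_on_def)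
  then have wor: "wo_rel ?r" by (simp add: wo_rel_def)
  have "|Field ?r| =o |W|"
    using card_of_Field_ordIso[OF r] W ordIso_symmetric ordIso_transitive by blast
  then obtain f where f: "bij_betw f (Field ?r) W"
    unfolding card_of_ordIso[symmetric] by blast
  have cnt: "countable (under ?r b)" if "b \<in> Field ?r" for b
  proof -
    have "|underS ?r b| <o ?r" by (rule card_of_underS[OF r that])
    then have "|underS ?r b| \<le>o natLeq"
      using cardSuc_ordLeq_ordLess[OF natLeq_Card_order card_of_Card_order] by blast
    then have "countable (insert b (underS ?r b))"
      by (simp add: countable_card_le_natLeq[symmetric])
    moreover have "under ?r b \<subseteq> insert b (underS ?r b)"
      by (auto simp: under_def underS_def)
    ultimately show ?thesis by (rule countable_subset[rotated])
  qed
  have inf: "infinite (Field ?r)"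
    using natLeq_Card_order cardSuc_finite[OF natLeq_Card_order] Field_natLeq by auto
  then have ne: "Field ?r \<noteq> {}" by auto
  have bound: "\<exists>b\<in>Field ?r. A \<subseteq> under ?r b" if "finite A" "A \<subseteq> Field ?r" for A
    using that
  proof (induction A rule: finite_induct)
    case empty
    then show ?case using ne by blast
  next
    case (insert a A)
    then obtain b where b: "b \<in> Field ?r" "A \<subseteq> under ?r b" by auto
    have a: "a \<in> Field ?r" using insert by simp
    have "(a, b) \<in> ?r \<or> (b, a) \<in> ?r"
      using wo_rel.TOTALS[OF wor] a b(1) by simp
    then show ?case
    proof
      assume "(a, b) \<in> ?r"
      then show ?thesis using b by (auto simp: under_def)
    next
      assume ba: "(b, a) \<in> ?r"
      have "A \<subseteq> under ?r a"
        using b(2) transD[OF wo_rel.TRANS[OF wor] _ ba] unfolding under_def by blast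
      then show ?thesis using a Refl_under_in[OF wo_rel.REFL[OF wor] a] by auto
    qed
  qed
  have "{t. set_sk t \<subseteq> W} \<subseteq> (\<Union>b\<in>Field ?r. {t. set_sk t \<subseteq> f ` under ?r b})"
  proof
    fix t assume "t \<in> {t. set_sk t \<subseteq> W}"
    then have "set_sk t \<subseteq> f ` Field ?r" using f by (simp add: bij_betw_def)
    then obtain A where A: "A \<subseteq> Field ?r" "finite A" "set_sk t = f ` A"
      using finite_subset_image[OF finite_set_sk] by metis
    obtain b where b: "b \<in> Field ?r" "A \<subseteq> under ?r b" using bound[OF A(2,1)] by blast
    then have "set_sk t \<subseteq> f ` under ?r b" unfolding A(3) by (intro image_mono)
    with b(1) show "t \<in> (\<Union>b\<in>Field ?r. {t. set_sk t \<subseteq> f ` under ?r b})" by blast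
  qed
  then have "|{t. set_sk t \<subseteq> W}| \<le>o |\<Union>b\<in>Field ?r. {t. set_sk t \<subseteq> f ` under ?r b}|"
    by (rule card_of_mono1)
  also have "|\<Union>b\<in>Field ?r. {t. set_sk t \<subseteq> f ` under ?r b}| \<le>o ?r"
  proof (rule card_of_UNION_ordLeq_infinite_Field)
    show "infinite (Field ?r)" by (rule inf)
    show "Card_order ?r" by (rule r)
    show "|Field ?r| \<le>o ?r"
      using card_of_Field_ordIso[OF r] ordIso_imp_ordLeq by blast
    show "\<forall>b\<in>Field ?r. |{t. set_sk t \<subseteq> f ` under ?r b}| \<le>o ?r"
    proof
      fix b assume "b \<in> Field ?r"
      then have "countable {t. set_sk t \<subseteq> f ` under ?r b}"
        using cnt by (intro countable_set_sk) auto
      then have "|{t. set_sk t \<subseteq> f ` under ?r b}| \<le>o natLeq"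
        by (simp add: countable_card_le_natLeq)
      also have "natLeq \<le>o ?r"
        using cardSuc_greater[OF natLeq_Card_order] ordLess_imp_ordLeq by blast
      finally show "|{t. set_sk t \<subseteq> f ` under ?r b}| \<le>o ?r" .
    qed
  qed
  finally show ?thesis .
qed

context greedy
begin

section \<open>The ultrafilter of a good type and its family of functions\<close>

lemma sat_mono: "\<lbrakk>sat q' K' i; q \<subseteq> q'; K \<subseteq> K'\<rbrakk> \<Longrightarrow> sat q K i"
  using inj_on_subset[of i K' K] by (auto simp: sat_def)

lemma countable_closed_vals: "countable (closed_vals TYPE('o))"
  using countable_set_sk[of "{} :: 'o set"] unfolding closed_vals_def by simp

text \<open>F contains the solution sets of the finite parts of a good type, together with the
  finite injectivity conditions. So every function named by a term has its prescribed trace almost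
  everywhere, and its value in U, if any, is that of a closed term.\<close>

lemma family_exists:
  assumes Y: "S \<subseteq> Y" "U \<subseteq> Y" "z \<in> Y" "\<And>k xs. G k xs \<in> Y"
  obtains F :: "(nat set \<Rightarrow> 'a) filter" and Fam C E where
    "F \<noteq> bot" "\<And>P. eventually P F \<or> eventually (\<lambda>i. \<not> P i) F"
    "\<And>g i. g \<in> Fam \<Longrightarrow> g i \<in> Y"
    "\<And>k gs. set gs \<subseteq> Fam \<Longrightarrow> (\<lambda>i. G k (vals i gs)) \<in> Fam"
    "|Fam| \<le>o cardSuc natLeq"
    "C \<subseteq> Fam" "|C| =o cardSuc natLeq" "\<And>g i. g \<in> C \<Longrightarrow> g i \<in> S"
    "\<And>g h. \<lbrakk>g \<in> C; h \<in> C; g \<noteq> h\<rbrakk> \<Longrightarrow> eventually (\<lambda>i. g i \<noteq> h i) F"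
    "countable E"
    "\<And>g. g \<in> Fam \<Longrightarrow> eventually (\<lambda>i. g i \<notin> U) F \<or> (\<exists>u\<in>E. eventually (\<lambda>i. g i = u) F)"
proof -
  obtain J :: "nat set set" and p where p: "good J p" and J: "uncountable J"
    using good_exists[OF uncountable_nat_sets] by blast
  \<comment> \<open>J may have more than \<open>\<aleph>\<^sub>1\<close> elements. Restricting the
    terms to W gives the right number of functions, while F is built from the whole type.\<close>
  obtain W where W: "W \<subseteq> J" "|W| =o cardSuc natLeq"
    using subset_of_card_cardSuc[OF J] by blast
  define \<B> where "\<B> = (\<lambda>(q, K). Collect (sat q K)) ` ({q. finite q \<and> q \<subseteq> p} \<times> {K. finite K \<and> K \<subseteq> J})"
  have fip: "\<Inter> A \<noteq> {}" if A: "finite A" "A \<subseteq> \<B>" for A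
  proof -
    have "\<exists>Z\<subseteq>{q. finite q \<and> q \<subseteq> p} \<times> {K. finite K \<and> K \<subseteq> J}. finite Z \<and>
        A = (\<lambda>(q, K). Collect (sat q K)) ` Z"
      using A(2) unfolding \<B>_def by (rule finite_subset_image[OF A(1)])
    then obtain Z where Z: "finite Z" "Z \<subseteq> {q. finite q \<and> q \<subseteq> p} \<times> {K. finite K \<and> K \<subseteq> J}"
        "A = (\<lambda>(q, K). Collect (sat q K)) ` Z"
      by (elim exE conjE) (rule that)
    have "finite (\<Union> (fst ` Z))" "\<Union> (fst ` Z) \<subseteq> p" "finite (\<Union> (snd ` Z))" "\<Union> (snd ` Z) \<subseteq> J"
      using Z(1) subsetD[OF Z(2)] by (fastforce+)
    then obtain i where i: "sat (\<Union> (fst ` Z)) (\<Union> (snd ` Z)) i"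
      using good_satD[OF p, of "\<Union> (fst ` Z)" "\<Union> (snd ` Z)"] by auto
    have "sat q K i" if "(q, K) \<in> Z" for q K
      by (rule sat_mono[OF i]) (use that in force)+
    then have "i \<in> \<Inter> A" unfolding Z(3) by auto
    then show ?thesis by blast
  qed
  obtain F :: "(nat set \<Rightarrow> 'a) filter" where F: "F \<noteq> bot"
    "\<And>P. eventually P F \<or> eventually (\<lambda>i. \<not> P i) F"
    "\<And>A. A \<in> \<B> \<Longrightarrow> eventually (\<lambda>i. i \<in> A) F"
    using ultrafilter_exists[of \<B>, OF fip] by metis
  have ev_sat: "eventually (sat q K) F" if "finite q" "q \<subseteq> p" "finite K" "K \<subseteq> J" for q K
  proof -
    have "Collect (sat q K) \<in> \<B>" unfolding \<B>_def using that by auto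
    from F(3)[OF this] show ?thesis by simp
  qed
  define Fam where "Fam = ev ` {t. set_sk t \<subseteq> W}"
  define C where "C = (\<lambda>j. ev (Coord j)) ` W"
  have ev_Coord: "ev (Coord j) i = guard (i j)" for i :: "nat set \<Rightarrow> 'a" and j by (simp add: ev_def)
  have guard_S: "guard x \<in> S" for x using s0 by (simp add: guard_def)
  have distinct: "eventually (\<lambda>i. ev (Coord j) i \<noteq> ev (Coord k) i) F" if "j \<in> W" "k \<in> W" "j \<noteq> k" for j k
  proof -
    have "eventually (sat {} {j, k}) F" using that W by (intro ev_sat) auto
    then show ?thesis
    proof eventually_elim
      case (elim i)
      then have "i j \<in> S" "i k \<in> S" "i j \<noteq> i k" using that(3) unfolding sat_def by auto
      then show ?case by (simp add: ev_Coord guard_def)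
    qed
  qed
  have "inj_on (\<lambda>j. ev (Coord j)) W"
  proof (rule inj_onI, rule ccontr)
    fix j k assume jk: "j \<in> W" "k \<in> W" "ev (Coord j) = ev (Coord k)" "j \<noteq> k"
    from distinct[OF jk(1,2,4)] have "eventually (\<lambda>_. False) F" unfolding jk(3) by simp
    with F(1) show False by (simp add: trivial_limit_def)
  qed
  then have "|C| =o |W|"
    using card_of_ordIsoI[OF inj_on_imp_bij_betw] ordIso_symmetric unfolding C_def by blast
  show thesis
  proof (rule that)
    show "F \<noteq> bot" "\<And>P. eventually P F \<or> eventually (\<lambda>i. \<not> P i) F" by (rule F)+
    show "g i \<in> Y" if g: "g \<in> Fam" for g i
    proof -
      obtain t where t: "g = ev t" using g unfolding Fam_def by blast
      have "untr (greedy_last fs) \<in> Y" for fs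
        using untr_greedy_last[of fs] Y(2,3) by auto
      then show ?thesis
        unfolding t ev_def using guard_S Y by (cases t) auto
    qed
    show "(\<lambda>i. G k (vals i gs)) \<in> Fam" if gs: "set gs \<subseteq> Fam" for k gs
    proof -
      have "gs \<in> lists (ev ` {t. set_sk t \<subseteq> W})"
        using gs unfolding Fam_def by auto
      then obtain ts where ts: "gs = map ev ts" "set ts \<subseteq> {t. set_sk t \<subseteq> W}"
        unfolding lists_image by auto
      have "(\<lambda>i. G k (vals i gs)) = ev (Op k ts)"
        unfolding ts by (auto simp: ev_def comp_def)
      moreover have "set_sk (Op k ts) \<subseteq> W" using ts(2) by auto
      ultimately show ?thesis unfolding Fam_def by blast
    qed
    have "|Fam| \<le>o |{t. set_sk t \<subseteq> W}|" unfolding Fam_def by (rule card_of_image)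
    also have "|{t. set_sk t \<subseteq> W}| \<le>o cardSuc natLeq" by (rule card_of_terms[OF W(2)])
    finally show "|Fam| \<le>o cardSuc natLeq" .
    show "C \<subseteq> Fam" unfolding C_def Fam_def by auto
    show "|C| =o cardSuc natLeq" using \<open>|C| =o |W|\<close> W(2) by (rule ordIso_transitive)
    show "g i \<in> S" if "g \<in> C" for g i using that guard_S unfolding C_def by (auto simp: ev_Coord)
    show "eventually (\<lambda>i. g i \<noteq> h i) F" if "g \<in> C" "h \<in> C" "g \<noteq> h" for g h
      using that distinct unfolding C_def by auto
    show "countable (closed_vals TYPE(nat set))" by (rule countable_closed_vals)
    show "eventually (\<lambda>i. g i \<notin> U) F \<or> (\<exists>u\<in>closed_vals TYPE(nat set). eventually (\<lambda>i. g i = u) F)"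
      if g: "g \<in> Fam" for g
    proof -
      obtain t where t: "g = ev t" "set_sk t \<subseteq> W" using g unfolding Fam_def by blast
      then have "t \<in> fst ` p" using good_fst[OF p] W(1) by auto
      then obtain v where v: "(t, v) \<in> p" by auto
      have "eventually (sat {(t, v)} {}) F" using v by (intro ev_sat) auto
      then have ev: "eventually (\<lambda>i. tr (g i) = v) F"
        by eventually_elim (simp add: sat_def t(1))
      show ?thesis
      proof (cases v)
        case None
        from ev have "eventually (\<lambda>i. g i \<notin> U) F"
          by eventually_elim (simp add: None tr_def split: if_splits)
        then show ?thesis ..
      next
        case (Some u)
        have "v \<in> snd ` p" using v by force
        then have "u \<in> closed_vals TYPE(nat set)" using good_snd[OF p] Some by auto
        moreover from ev have "eventually (\<lambda>i. g i = u) F"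
          by eventually_elim (simp add: Some tr_def split: if_splits)
        ultimately show ?thesis by blast
      qed
    qed
  qed
qed

end

section \<open>The zero set in the limit model\<close>

lemma infinite_natLeq_ordLeq: "infinite A \<Longrightarrow> natLeq \<le>o |A|"
  using infinite_iff_natLeq_ordLeq by blast

text \<open>Each point of A has a point of D within e/2, and two points of A cannot share one, as
  they are at least e apart.\<close>

lemma (in Metric_space) card_of_separated_le_dense:
  assumes "0 < e" and A: "A \<subseteq> M" "\<And>x y. \<lbrakk>x \<in> A; y \<in> A; x \<noteq> y\<rbrakk> \<Longrightarrow> e \<le> d x y"
    and D: "D \<subseteq> M" "mtopology closure_of D = M"
  shows "|A| \<le>o |D|"
proof -
  have "\<forall>x\<in>A. \<exists>y. y \<in> D \<and> d x y < e / 2"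
  proof
    fix x assume "x \<in> A"
    then have "x \<in> mtopology closure_of D" using A(1) D(2) by auto
    then obtain y where "y \<in> D" "y \<in> mball x (e / 2)"
      unfolding metric_closure_of using \<open>0 < e\<close> by (auto dest!: spec[of _ "e / 2"])
    then show "\<exists>y. y \<in> D \<and> d x y < e / 2" by auto
  qed
  from bchoice[OF this] obtain f where f: "\<And>x. x \<in> A \<Longrightarrow> f x \<in> D" "\<And>x. x \<in> A \<Longrightarrow> d x (f x) < e / 2"
    by blast
  have "inj_on f A"
  proof (rule inj_onI, rule ccontr)
    fix x y assume xy: "x \<in> A" "y \<in> A" "f x = f y" "x \<noteq> y"
    have mem: "x \<in> M" "y \<in> M" "f x \<in> M" using A(1) D(1) f(1) xy by blast+
    have "d x y \<le> d x (f x) + d (f x) y" by (rule triangle[OF mem(1,3,2)])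
    moreover have "d (f x) y < e / 2" using f(2)[OF xy(2)] xy(3) commute[of y "f x"] by simp
    ultimately show False using f(2)[OF xy(1)] A(2)[OF xy(1,2,4)] by linarith
  qed
  with f(1) show ?thesis unfolding card_of_ordLeq[symmetric] by blast
qed

context structure_over
begin

section \<open>The distance to a set of tuples\<close>

lemma Metric_space_tuples_X: "Metric_space (tuples n X) (tuple_dist d)"
  by (rule Metric_space_tuples[OF MS.Metric_space_axioms])

lemma tuple_dist_le_1:
  assumes "xs \<in> tuples n X" "ys \<in> tuples n X"
  shows "tuple_dist d xs ys \<le> 1"
proof -
  have "length xs = n" "length ys = n" using assms by (auto simp: tuples_def)
  moreover have "d (xs ! i) (ys ! i) \<le> 1" if "i < n" for i
    using assms that by (intro d_le_1) (auto simp: tuples_def)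
  ultimately show ?thesis
    using tuple_dist_le_iff[where d = d, OF MS.nonneg] by auto
qed

lemma tuple_dist_nonneg: "0 \<le> tuple_dist d' xs ys"
  unfolding tuple_dist_def by simp

lemma bdd_below_dist_to: "bdd_below (insert 1 ((\<lambda>ys. tuple_dist (sdist M) xs ys) ` Z))"
  using tuple_dist_nonneg by (intro bdd_belowI[of _ 0]) auto

lemma dist_to_le: "ys \<in> Z \<Longrightarrow> dist_to M Z xs \<le> tuple_dist d xs ys"
  unfolding dist_to_def by (rule cInf_lower[OF _ bdd_below_dist_to]) simp

lemma dist_to_range: "dist_to M Z xs \<in> {0..1}"
proof -
  have "dist_to M Z xs \<le> 1"
    unfolding dist_to_def by (rule cInf_lower[OF _ bdd_below_dist_to]) simp
  moreover have "0 \<le> dist_to M Z xs"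
    unfolding dist_to_def using tuple_dist_nonneg by (intro cInf_greatest) auto
  ultimately show ?thesis by simp
qed

lemma dist_to_eqI:
  assumes "\<And>ys. ys \<in> Z \<Longrightarrow> a \<le> tuple_dist d xs ys" "a \<le> 1"
    and "\<And>e. 0 < e \<Longrightarrow> \<exists>ys\<in>Z. tuple_dist d xs ys \<le> a + e"
  shows "dist_to M Z xs = a"
proof (rule antisym)
  show "a \<le> dist_to M Z xs"
    unfolding dist_to_def using assms(1,2) by (intro cInf_greatest) auto
  show "dist_to M Z xs \<le> a"
    by (rule field_le_epsilon) (use assms(3) dist_to_le order_trans in blast)
qed

lemma dist_to_approx:
  assumes Z: "Z \<noteq> {}" "Z \<subseteq> tuples n X" and xs: "xs \<in> tuples n X" and "0 < e"
  shows "\<exists>ys\<in>Z. tuple_dist d xs ys < dist_to M Z xs + e"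
proof -
  obtain ys0 where ys0: "ys0 \<in> Z" using Z(1) by blast
  have "\<exists>a\<in>insert 1 ((\<lambda>ys. tuple_dist d xs ys) ` Z). a < dist_to M Z xs + e"
    unfolding dist_to_def by (rule cInf_lessD) (use assms(4) in auto)
  then consider "1 < dist_to M Z xs + e" | ys where "ys \<in> Z" "tuple_dist d xs ys < dist_to M Z xs + e"
    by auto
  then show ?thesis
  proof cases
    \<comment> \<open>Here the infimum may come from the inserted 1. Then any point of Z will do,
      because distances are at most 1.\<close>
    case 1
    then show ?thesis using ys0 tuple_dist_le_1[OF xs, of ys0] Z(2) by (intro bexI[of _ ys0]) auto
  qed blast
qed

lemma dist_to_Lipschitz:
  assumes Z: "Z \<noteq> {}" "Z \<subseteq> tuples n X" and xs: "xs \<in> tuples n X" "xs' \<in> tuples n X"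
  shows "dist_to M Z xs \<le> tuple_dist d xs xs' + dist_to M Z xs'"
proof (rule field_le_epsilon)
  fix e :: real assume "0 < e"
  obtain ys where ys: "ys \<in> Z" "tuple_dist d xs' ys < dist_to M Z xs' + e"
    using dist_to_approx[OF Z xs(2) \<open>0 < e\<close>] by blast
  have "tuple_dist d xs ys \<le> tuple_dist d xs xs' + tuple_dist d xs' ys"
    using Metric_space.triangle[OF Metric_space_tuples_X xs(1,2)] ys(1) Z(2) by blast
  with ys dist_to_le[OF ys(1), of xs]
  show "dist_to M Z xs \<le> tuple_dist d xs xs' + dist_to M Z xs' + e" by linarith
qed

lemma dist_to_self: "\<lbrakk>ys \<in> Z; ys \<in> tuples n X\<rbrakk> \<Longrightarrow> dist_to M Z ys = 0"
  using dist_to_le[of ys Z ys] dist_to_range[of Z ys]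
    Metric_space.mdist_zero[OF Metric_space_tuples_X, of ys n] by simp

end

text \<open>\<open>Fam_near\<close> asks for near points in D rather than in Z, so that their
  coordinates lie in U and \<open>Fam_U\<close> makes them constant almost everywhere. The constant
  functions in \<open>infinite_D\<close> keep the new zero set infinite.\<close>

locale definable_family = ultra_family L M F Fam
  for L :: "('f, 'p) language" and M :: "('f, 'p, 'a) metric_structure"
    and F :: "'i filter" and Fam :: "('i \<Rightarrow> 'a) set" +
  fixes n :: nat and Z D :: "'a list set" and U E :: "'a set"
  assumes Z_sub: "Z \<subseteq> tuples n X" and Z_ne: "Z \<noteq> {}" and D_Z: "D \<subseteq> Z"
    and D_U: "ys \<in> D \<Longrightarrow> set ys \<subseteq> U"
    and Fam_near: "\<lbrakk>set fs \<subseteq> Fam; length fs = n; 0 < r\<rbrakk> \<Longrightarrow>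
      \<exists>hs. set hs \<subseteq> Fam \<and> length hs = n \<and> (\<forall>i. vals i hs \<in> D \<and>
        tuple_dist d (vals i fs) (vals i hs) \<le> dist_to M Z (vals i fs) + r)"
    and countable_E: "countable E"
    and Fam_U: "g \<in> Fam \<Longrightarrow> ae (\<lambda>i. g i \<notin> U) \<or> (\<exists>u\<in>E. ae (\<lambda>i. g i = u))"
    and infinite_D: "\<exists>ds :: nat \<Rightarrow> 'a list. inj ds \<and> range ds \<subseteq> D \<and> (\<forall>m. \<forall>j<n. (\<lambda>_. ds m ! j) \<in> Fam)"
begin

section \<open>The limit of the distance predicate\<close>

definition fdist_to :: "('i \<Rightarrow> 'a) list \<Rightarrow> real" where
  "fdist_to gs = flim (\<lambda>i. dist_to M Z (vals i gs))"

lemma fdist_to_tendsto: "((\<lambda>i. dist_to M Z (vals i gs)) \<longlongrightarrow> fdist_to gs) F"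
  unfolding fdist_to_def by (rule flim_tendsto(1)[OF dist_to_range])

lemma fdist_to_range: "fdist_to gs \<in> {0..1}"
  unfolding fdist_to_def by (rule flim_tendsto(2)[OF dist_to_range])

lemma tuple_X: "\<lbrakk>set gs \<subseteq> Cl; length gs = n\<rbrakk> \<Longrightarrow> vals i gs \<in> tuples n X"
  using Cl_X by (auto simp: tuples_def)

lemma fdist_to_Lipschitz:
  assumes gs: "set gs \<subseteq> Cl" "length gs = n" and hs: "set hs \<subseteq> Cl" "length hs = n"
  shows "fdist_to gs \<le> tuple_dist fdist gs hs + fdist_to hs"
proof -
  have "((\<lambda>i. tuple_dist d (vals i gs) (vals i hs) + dist_to M Z (vals i hs)
      - dist_to M Z (vals i gs)) \<longlongrightarrow> tuple_dist fdist gs hs + fdist_to hs - fdist_to gs) F"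
    using gs hs by (intro tendsto_diff tendsto_add fdist_to_tendsto tuple_dist_tendsto) auto
  then have "0 \<le> tuple_dist fdist gs hs + fdist_to hs - fdist_to gs"
  proof (rule lim_ge, intro always_eventually allI)
    fix i
    show "0 \<le> tuple_dist d (vals i gs) (vals i hs) + dist_to M Z (vals i hs)
      - dist_to M Z (vals i gs)"
      using dist_to_Lipschitz[OF Z_ne Z_sub tuple_X[OF gs] tuple_X[OF hs], of i i] by simp
  qed
  then show ?thesis by simp
qed

text \<open>This is the limit of the distance to Z and not of the predicate that defines Z. It turns
  out to be the distance to its own zero set.\<close>

definition PN :: "real list \<Rightarrow> real" where
  "PN xs = fdist_to (map dec xs)"

definition ZN :: "real list set" where
  "ZN = zero_set N n PN"

lemma ZN_iff: "xs \<in> ZN \<longleftrightarrow> xs \<in> tuples n (univ N) \<and> fdist_to (map dec xs) = 0"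
  by (auto simp: ZN_def zero_set_def PN_def)

lemma dec_enc_list:
  assumes "set hs \<subseteq> Cl"
  shows "tuple_dist fdist (map dec (map enc hs)) hs = 0" "tuple_dist fdist hs (map dec (map enc hs)) = 0"
proof -
  show "tuple_dist fdist (map dec (map enc hs)) hs = 0"
    using assms by (induction hs) (auto simp: fdist_dec_enc)
  show "tuple_dist fdist hs (map dec (map enc hs)) = 0"
    using assms by (induction hs) (auto simp: fdist_dec_enc fdist_sym[of _ "dec _"])
qed

lemma fdist_to_dec_enc:
  assumes hs: "set hs \<subseteq> Cl" "length hs = n"
  shows "fdist_to (map dec (map enc hs)) = fdist_to hs"
proof -
  have "set (map dec (map enc hs)) \<subseteq> Cl" "length (map dec (map enc hs)) = n"
    using hs dec_Cl by auto
  from fdist_to_Lipschitz[OF this hs] fdist_to_Lipschitz[OF hs this] dec_enc_list[OF hs(1)]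
  show ?thesis by simp
qed

lemma enc_in_ZN:
  assumes hs: "set hs \<subseteq> Cl" "length hs = n" and "\<And>i. vals i hs \<in> Z"
  shows "map enc hs \<in> ZN"
proof -
  have "dist_to M Z (vals i hs) = 0" for i
    using assms(3) Z_sub by (intro dist_to_self) auto
  then have "fdist_to hs = 0"
    unfolding fdist_to_def by (intro flim_eqI) simp
  then show ?thesis
    unfolding ZN_iff fdist_to_dec_enc[OF hs] using hs by (auto simp: tuples_def)
qed

text \<open>The points of the zero set with coordinates in \<open>EN\<close> come from members of the family with
  values in D, which are almost everywhere constant.\<close>

definition EN :: "real set" where
  "EN = {enc g |g. g \<in> Fam \<and> (\<exists>u\<in>E. ae (\<lambda>i. g i = u))}"

lemma countable_EN: "countable EN"
proof -
  \<comment> \<open>Functions that agree with u almost everywhere are at distance zero, so one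
    choice for each u in E yields all codes.\<close>
  define pick where "pick u = (SOME g. g \<in> Fam \<and> ae (\<lambda>i. g i = u))" for u
  have "EN \<subseteq> (\<lambda>u. enc (pick u)) ` E"
  proof
    fix x assume "x \<in> EN"
    then obtain g u where g: "x = enc g" "g \<in> Fam" "u \<in> E" "ae (\<lambda>i. g i = u)"
      unfolding EN_def by blast
    have p: "pick u \<in> Fam \<and> ae (\<lambda>i. pick u i = u)"
      unfolding pick_def by (rule someI[of _ g]) (use g in simp)
    have "ae (\<lambda>i. d (g i) (pick u i) \<le> 0)"
      using g(4) p[THEN conjunct2]
    proof eventually_elim
      case (elim i)
      have "g i \<in> X" using Fam_X[OF g(2)] .
      then show ?case using elim by simp
    qed
    then have "fdist g (pick u) \<le> 0"
      using g(2) p Fam_Cl by (intro fdist_le) auto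
    then have "fdist g (pick u) = 0"
      using fdist_range[of g "pick u"] g(2) p Fam_Cl by auto
    then have "x = enc (pick u)"
      using g p Fam_Cl enc_eq_iff[of g "pick u"] by auto
    with g(3) show "x \<in> (\<lambda>u. enc (pick u)) ` E" by blast
  qed
  then show ?thesis
    using countable_E by (meson countable_image countable_subset)
qed

text \<open>After moving xs into the family, near points in D are taken index by index. Their
  coordinates are in U at every index, so the first alternative of \<open>Fam_U\<close> is
  impossible and the codes lie in \<open>EN\<close>. The lemma yields both the distance formula and
  the separability of \<open>ZN\<close>.\<close>

lemma near_point:
  assumes xs: "xs \<in> tuples n (univ N)" and "0 < e"
  shows "\<exists>ys\<in>ZN. set ys \<subseteq> EN \<and> tuple_dist (sdist N) xs ys \<le> PN xs + e"
proof -
  define gs where "gs = map dec xs"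
  have gs: "set gs \<subseteq> Cl" "length gs = n" using xs dec_Cl by (auto simp: gs_def tuples_def)
  \<comment> \<open>The distance from xs to fs is counted twice, in the triangle inequality and in
    comparing the distances to Z. The other two quarters are for the choice of hs and for decoding
    its codes.\<close>
  have e4: "0 < e / 4" using assms(2) by simp
  obtain fs where fs: "set fs \<subseteq> Fam" "length fs = length gs"
      "ae (\<lambda>i. tuple_dist d (vals i fs) (vals i gs) < e / 4)"
    using Cl_list_approx[OF gs(1) e4] by blast
  have fs': "set fs \<subseteq> Cl" "length fs = n" using fs gs Fam_Cl by auto
  obtain hs where hs: "set hs \<subseteq> Fam" "length hs = n" "\<And>i. vals i hs \<in> D"
      "\<And>i. tuple_dist d (vals i fs) (vals i hs) \<le> dist_to M Z (vals i fs) + e / 4"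
    using Fam_near[OF fs(1) fs'(2) e4] by blast
  have hs': "set hs \<subseteq> Cl" using hs Fam_Cl by auto
  define ks where "ks = map dec (map enc hs)"
  have ks: "set ks \<subseteq> Cl" "length ks = n" using hs dec_Cl by (auto simp: ks_def)
  have "tuple_dist fdist hs ks < e / 4"
    using dec_enc_list(2)[OF hs'] e4 by (simp add: ks_def)
  then have ev: "ae (\<lambda>i. tuple_dist d (vals i hs) (vals i ks) < e / 4)"
    using hs hs' ks by (intro order_tendstoD(2)[OF tuple_dist_tendsto]) auto
  have lim: "((\<lambda>i. tuple_dist d (vals i gs) (vals i ks) - dist_to M Z (vals i gs)) \<longlongrightarrow>
      tuple_dist fdist gs ks - fdist_to gs) F"
    using gs ks by (intro tendsto_diff tuple_dist_tendsto fdist_to_tendsto) auto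
  have "tuple_dist fdist gs ks - fdist_to gs \<le> e"
  proof (rule lim_le[OF lim])
    show "ae (\<lambda>i. tuple_dist d (vals i gs) (vals i ks) - dist_to M Z (vals i gs) \<le> e)"
      using fs(3) ev
    proof eventually_elim
      case (elim i)
      let ?g = "vals i gs" and ?f = "vals i fs" and ?h = "vals i hs" and ?k = "vals i ks"
      note t = tuple_X[OF gs, of i] tuple_X[OF fs', of i] tuple_X[OF hs' hs(2), of i] tuple_X[OF ks, of i]
      have "tuple_dist d ?g ?k \<le> tuple_dist d ?g ?f + tuple_dist d ?f ?k"
        by (rule Metric_space.triangle[OF Metric_space_tuples_X t(1,2,4)])
      moreover have "tuple_dist d ?f ?k \<le> tuple_dist d ?f ?h + tuple_dist d ?h ?k"
        by (rule Metric_space.triangle[OF Metric_space_tuples_X t(2,3,4)])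
      moreover have "tuple_dist d ?g ?f = tuple_dist d ?f ?g"
        by (rule Metric_space.commute[OF Metric_space_tuples_X[of n]])
      moreover have "dist_to M Z ?f \<le> tuple_dist d ?f ?g + dist_to M Z ?g"
        by (rule dist_to_Lipschitz[OF Z_ne Z_sub t(2,1)])
      ultimately show ?case using elim hs(4)[of i] by linarith
    qed
  qed
  moreover have "tuple_dist (sdist N) xs (map enc hs) = tuple_dist fdist gs ks"
    using xs hs by (subst tuple_dist_N) (auto simp: gs_def ks_def tuples_def)
  ultimately have "tuple_dist (sdist N) xs (map enc hs) \<le> PN xs + e"
    by (simp add: PN_def gs_def)
  moreover have "map enc hs \<in> ZN"
    using hs D_Z by (intro enc_in_ZN hs') auto
  moreover have "set (map enc hs) \<subseteq> EN"
  proof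
    fix x assume "x \<in> set (map enc hs)"
    then obtain h where h: "h \<in> set hs" "x = enc h" by auto
    have U: "h i \<in> U" for i using D_U[OF hs(3)[of i]] h(1) by auto
    have "\<not> ae (\<lambda>i. h i \<notin> U)"
      using F_ne U by (simp add: trivial_limit_def)
    then show "x \<in> EN"
      using Fam_U[of h] h hs(1) unfolding EN_def by blast
  qed
  ultimately show ?thesis by blast
qed

text \<open>The lower bound is the Lipschitz property of \<open>fdist_to\<close>, which vanishes on
  \<open>ZN\<close>; the upper bound is \<open>near_point\<close>.\<close>

lemma dist_to_ZN:
  assumes xs: "xs \<in> tuples n (univ N)"
  shows "dist_to N ZN xs = PN xs"
proof (rule N.dist_to_eqI)
  show "PN xs \<le> 1" using fdist_to_range[of "map dec xs"] by (simp add: PN_def)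
  show "\<exists>ys\<in>ZN. tuple_dist (sdist N) xs ys \<le> PN xs + e" if "0 < e" for e
    using near_point[OF xs that] by blast
  fix ys assume ys: "ys \<in> ZN"
  have len: "length xs = n" "length ys = n" using xs ys by (auto simp: ZN_iff tuples_def)
  have "fdist_to (map dec xs) \<le> tuple_dist fdist (map dec xs) (map dec ys) + fdist_to (map dec ys)"
    using len by (intro fdist_to_Lipschitz set_map_dec) auto
  then show "PN xs \<le> tuple_dist (sdist N) xs ys"
    using ys len by (simp add: PN_def ZN_iff tuple_dist_N)
qed

lemma ZN_sub: "ZN \<subseteq> tuples n (univ N)"
  by (auto simp: ZN_iff)

text \<open>Constant functions with values in D give points of \<open>ZN\<close>, and distinct
  constants stay distinct because their limit distance is the distance in M.\<close>

lemma infinite_ZN: "infinite ZN"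
proof -
  obtain ds :: "nat \<Rightarrow> 'a list" where ds: "inj ds" "range ds \<subseteq> D" "\<And>m j. j < n \<Longrightarrow> (\<lambda>_. ds m ! j) \<in> Fam"
    using infinite_D by blast
  have len: "length (ds m) = n" for m
    using ds(2) D_Z Z_sub by (force simp: tuples_def)
  define c where "c m = map enc (map (\<lambda>j _. ds m ! j) [0..<n])" for m
  have "inj c"
  proof (rule injI)
    fix l m assume eq: "c l = c m"
    have "ds l ! j = ds m ! j" if j: "j < n" for j
    proof -
      have "enc (\<lambda>_. ds l ! j) = enc (\<lambda>_. ds m ! j)"
        using arg_cong[OF eq, of "\<lambda>xs. xs ! j"] j by (simp add: c_def)
      moreover have "(\<lambda>_. ds l ! j) \<in> Cl" "(\<lambda>_. ds m ! j) \<in> Cl"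
        using ds(3)[OF j] Fam_Cl by auto
      ultimately have "fdist (\<lambda>_. ds l ! j) (\<lambda>_. ds m ! j) = 0"
        using enc_eq_iff by blast
      moreover have "fdist (\<lambda>_. ds l ! j) (\<lambda>_. ds m ! j) = d (ds l ! j) (ds m ! j)"
        unfolding fdist_def by (rule flim_eqI) simp
      ultimately show ?thesis
        using Fam_X[OF ds(3)[OF j]] by (metis MS.zero)
    qed
    then have "ds l = ds m" by (intro nth_equalityI) (auto simp: len)
    with ds(1) show "l = m" by (simp add: inj_eq)
  qed
  moreover have "range c \<subseteq> ZN"
  proof
    fix x assume "x \<in> range c"
    then obtain m where m: "x = c m" by blast
    have eq: "vals i (map (\<lambda>j _. ds m ! j) [0..<n]) = ds m" for i :: 'i
      by (intro nth_equalityI) (auto simp: len)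
    show "x \<in> ZN"
      unfolding m c_def
    proof (rule enc_in_ZN)
      show "vals i (map (\<lambda>j _. ds m ! j) [0..<n]) \<in> Z" for i :: 'i
        unfolding eq using ds(2) D_Z by blast
      show "set (map (\<lambda>j (_ :: 'i). ds m ! j) [0..<n]) \<subseteq> Cl"
        using ds(3) Fam_Cl by auto
    qed simp
  qed
  ultimately show ?thesis
    using finite_subset range_inj_infinite by blast
qed

lemma density_ZN:
  "density_character_is (Metric_space.mtopology ZN (tuple_dist (sdist N))) natLeq"
proof -
  interpret T: Metric_space "tuples n (univ N)" "tuple_dist (sdist N)"
    by (rule N.Metric_space_tuples_X)
  interpret ZM: Metric_space ZN "tuple_dist (sdist N)"
    by (rule T.subspace[OF ZN_sub])
  define Q where "Q = {ys \<in> ZN. set ys \<subseteq> EN}"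
  have "Q \<subseteq> lists EN" by (auto simp: Q_def)
  then have "countable Q"
    using countable_EN by (meson countable_lists countable_subset)
  \<comment> \<open>Finite sets are closed, so a finite dense set would be all of
    \<open>ZN\<close>.\<close>
  have dense_inf: "infinite D'" if D': "D' \<subseteq> ZN" "ZM.mtopology closure_of D' = ZN" for D'
  proof
    assume "finite D'"
    then have "closedin ZM.mtopology D'"
      using D'(1) closedin_Hausdorff_finite[OF ZM.Hausdorff_space_mtopology] by simp
    then have "D' = ZN" using D'(2) by (simp add: closure_of_closedin)
    with \<open>finite D'\<close> infinite_ZN show False by simp
  qed
  have dense: "ZM.mtopology closure_of Q = ZN"
    unfolding ZM.metric_closure_of
  proof (intro equalityI subsetI CollectI conjI allI impI)
    fix xs and r :: real assume xs: "xs \<in> ZN" and "0 < r"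
    have "0 < r / 2" using \<open>0 < r\<close> by simp
    obtain ys where ys: "ys \<in> ZN" "set ys \<subseteq> EN" "tuple_dist (sdist N) xs ys \<le> PN xs + r / 2"
      using near_point[OF _ \<open>0 < r / 2\<close>, of xs] xs ZN_sub by blast
    have "PN xs = 0" using xs by (simp add: ZN_iff PN_def)
    with ys \<open>0 < r\<close> xs show "\<exists>y\<in>Q. y \<in> ZM.mball xs r"
      by (intro bexI[of _ ys]) (auto simp: Q_def)
  qed auto
  have "Q \<subseteq> ZN" by (auto simp: Q_def)
  have "|Q| =o natLeq"
    using \<open>countable Q\<close> dense_inf[OF \<open>Q \<subseteq> ZN\<close> dense]
    unfolding countable_card_le_natLeq ordIso_iff_ordLeq
    using infinite_natLeq_ordLeq by blast
  then show ?thesis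
    unfolding density_character_is_def
    unfolding ZM.topspace_mtopology
    using \<open>Q \<subseteq> ZN\<close> dense dense_inf infinite_natLeq_ordLeq by blast
qed

text \<open>The estimate in M holds for all tuples at once, hence at every index, and the theorem of
  Los carries it over. In the limit a strict bound becomes \<le>, so e is halved.\<close>

lemma definable_limit:
  assumes \<phi>: "\<And>k. is_fm L (\<phi> k)" "\<And>k. fm_vars (\<phi> k) \<subseteq> {..<n}"
    and lim: "uniform_limit (tuples n X) (\<lambda>k xs. fm_val M (\<phi> k) (nth xs)) (dist_to M Z) sequentially"
  shows "uniform_limit (tuples n (univ N)) (\<lambda>k xs. fm_val N (\<phi> k) (nth xs)) PN sequentially"
  unfolding uniform_limit_iff
proof (intro allI impI)
  fix e :: real assume "0 < e"
  then have "0 < e / 2" by simp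
  with lim have "eventually (\<lambda>k. \<forall>xs\<in>tuples n X. dist (fm_val M (\<phi> k) (nth xs)) (dist_to M Z xs) < e / 2) sequentially"
    unfolding uniform_limit_iff by blast
  then show "eventually (\<lambda>k. \<forall>xs\<in>tuples n (univ N). dist (fm_val N (\<phi> k) (nth xs)) (PN xs) < e) sequentially"
  proof eventually_elim
    case (elim k)
    show ?case
    proof
      fix xs assume xs: "xs \<in> tuples n (univ N)"
      obtain b where b: "b \<in> univ N" using N.X_ne by blast
      \<comment> \<open>The theorem of Los needs all values of the assignment in the universe, which
        \<open>nth xs\<close> does not guarantee from n onwards. The formulas do not read those
        variables.\<close>
      define v where "v j = (if j < n then xs ! j else b)" for j
      have v: "range v \<subseteq> univ N" using xs b by (auto simp: v_def tuples_def)
      have eq: "fm_val N (\<phi> k) v = fm_val N (\<phi> k) (nth xs)"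
        using \<phi>(2)[of k] by (intro fm_val_cong) (auto simp: v_def)
      have gs: "set (map dec xs) \<subseteq> Cl" "length (map dec xs) = n"
        using xs dec_Cl by (auto simp: tuples_def)
      have eqM: "fm_val M (\<phi> k) (\<lambda>j. dec (v j) i) = fm_val M (\<phi> k) (nth (vals i (map dec xs)))" for i
        using \<phi>(2)[of k] gs(2) by (intro fm_val_cong) (auto simp: v_def)
      have "((\<lambda>i. fm_val M (\<phi> k) (\<lambda>j. dec (v j) i)) \<longlongrightarrow> fm_val N (\<phi> k) v) F"
        by (rule fm_val_N_tendsto[OF \<phi>(1) v])
      then have "((\<lambda>i. dist (fm_val M (\<phi> k) (nth (vals i (map dec xs))))
          (dist_to M Z (vals i (map dec xs)))) \<longlongrightarrow> dist (fm_val N (\<phi> k) (nth xs)) (PN xs)) F"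
        unfolding eq eqM PN_def by (intro tendsto_dist fdist_to_tendsto)
      then have "dist (fm_val N (\<phi> k) (nth xs)) (PN xs) \<le> e / 2"
      proof (rule lim_le, intro always_eventually allI)
        fix i
        show "dist (fm_val M (\<phi> k) (nth (vals i (map dec xs))))
          (dist_to M Z (vals i (map dec xs))) \<le> e / 2"
          using elim tuple_X[OF gs, of i] less_imp_le by blast
      qed
      then show "dist (fm_val N (\<phi> k) (nth xs)) (PN xs) < e" using \<open>0 < e\<close> by simp
    qed
  qed
qed

text \<open>The codes of the family are dense, and those of C remain e apart, so no dense set can be
  smaller.\<close>

lemma density_N:
  assumes "|Fam| \<le>o cardSuc natLeq" "C \<subseteq> Fam" "|C| =o cardSuc natLeq" "0 < e"
    and sep: "\<And>g h. \<lbrakk>g \<in> C; h \<in> C; g \<noteq> h\<rbrakk> \<Longrightarrow> ae (\<lambda>i. e \<le> d (g i) (h i))"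
  shows "density_character_is (Metric_space.mtopology (univ N) (sdist N)) (cardSuc natLeq)"
proof -
  have C: "C \<subseteq> Cl" using assms(2) Fam_Cl by auto
  have ge: "e \<le> sdist N (enc g) (enc h)" if "g \<in> C" "h \<in> C" "g \<noteq> h" for g h
    using sep[OF that] that C by (subst sdist_enc) (auto intro: fdist_ge)
  have "inj_on enc C"
  proof (rule inj_onI, rule ccontr)
    fix g h assume gh: "g \<in> C" "h \<in> C" "enc g = enc h" "g \<noteq> h"
    have "sdist N (enc g) (enc h) = 0"
      unfolding gh(3) using N.MS.mdist_zero[OF enc_in_N] C gh(2) by blast
    with ge[OF gh(1,2,4)] \<open>0 < e\<close> show False by simp
  qed
  then have "|enc ` C| =o |C|"
    using card_of_ordIsoI[OF inj_on_imp_bij_betw] ordIso_symmetric by blast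
  then have encC: "|enc ` C| =o cardSuc natLeq"
    using assms(3) ordIso_transitive by blast
  have lower: "cardSuc natLeq \<le>o |D'|" if D': "D' \<subseteq> univ N" "N.MS.mtopology closure_of D' = univ N" for D'
  proof -
    have "|enc ` C| \<le>o |D'|"
    proof (rule N.MS.card_of_separated_le_dense[OF \<open>0 < e\<close> _ _ D'])
      show "enc ` C \<subseteq> univ N" using C by auto
      show "e \<le> sdist N x y" if "x \<in> enc ` C" "y \<in> enc ` C" "x \<noteq> y" for x y
        using that ge by blast
    qed
    then show ?thesis using encC ordIso_ordLeq_trans ordIso_symmetric by blast
  qed
  have sub: "enc ` Fam \<subseteq> univ N" using Fam_Cl by auto
  have dense: "N.MS.mtopology closure_of (enc ` Fam) = univ N"
    unfolding N.MS.metric_closure_of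
  proof (intro equalityI subsetI CollectI conjI allI impI)
    fix x and r :: real assume x: "x \<in> univ N" "0 < r"
    obtain g where g: "g \<in> Fam" "sdist N x (enc g) < r" using Fam_dense[OF x] by blast
    show "\<exists>y\<in>enc ` Fam. y \<in> N.MS.mball x r"
      using g x(1) sub by (intro bexI[of _ "enc g"]) (auto simp: N.MS.in_mball simp del: N_simps)
  qed auto
  have "|enc ` Fam| \<le>o cardSuc natLeq"
    using card_of_image assms(1) ordLeq_transitive by blast
  then have "|enc ` Fam| =o cardSuc natLeq"
    using lower[OF sub dense] by (simp add: ordIso_iff_ordLeq)
  then show ?thesis
    unfolding density_character_is_def N.MS.topspace_mtopology
    using sub dense lower by blast
qed

end

section \<open>Existence of families\<close>

lemma countable_imp_ordLeq: "natLeq \<le>o \<mu> \<Longrightarrow> countable B \<Longrightarrow> |B| \<le>o \<mu>"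
  unfolding countable_card_le_natLeq by (rule ordLeq_transitive)

lemma infinite_Field_if_natLeq_ordLeq:
  assumes "Card_order \<mu>" "natLeq \<le>o \<mu>"
  shows "infinite (Field \<mu>)"
proof
  assume "finite (Field \<mu>)"
  moreover have "natLeq \<le>o |Field \<mu>|"
    using assms(2) card_of_Field_ordIso[OF assms(1)] ordLeq_ordIso_trans ordIso_symmetric by blast
  ultimately show False using infinite_iff_natLeq_ordLeq by blast
qed

text \<open>The union over k of maximal sets with separation 1/(k+1) is dense. If each of them had
  at most \<mu> points, so would the union, against the density character \<kappa>.\<close>

lemma (in Metric_space) large_separated_set:
  assumes density: "\<And>D. \<lbrakk>D \<subseteq> M; mtopology closure_of D = M\<rbrakk> \<Longrightarrow> \<kappa> \<le>o |D|"
    and \<mu>: "Card_order \<mu>" "natLeq \<le>o \<mu>" "\<mu> <o \<kappa>"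
  obtains S e where "S \<subseteq> M" "0 < e" "\<And>x y. \<lbrakk>x \<in> S; y \<in> S; x \<noteq> y\<rbrakk> \<Longrightarrow> e \<le> d x y" "\<not> |S| \<le>o \<mu>"
proof -
  have fin: "infinite (Field \<mu>)" by (rule infinite_Field_if_natLeq_ordLeq[OF \<mu>(1,2)])
  define \<A> where "\<A> r = {S. S \<subseteq> M \<and> (\<forall>x\<in>S. \<forall>y\<in>S. x \<noteq> y \<longrightarrow> r \<le> d x y)}" for r
  have "\<exists>S\<in>\<A> r. \<forall>S'\<in>\<A> r. S \<subseteq> S' \<longrightarrow> S' = S" for r
  proof (rule subset_Zorn_nonempty)
    have "{} \<in> \<A> r" by (simp add: \<A>_def)
    then show "\<A> r \<noteq> {}" by blast
    fix C assume C: "C \<noteq> {}" "subset.chain (\<A> r) C"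
    have mem: "Y \<in> \<A> r" if "Y \<in> C" for Y using C(2) that unfolding subset_chain_def by blast
    have chain: "Y \<subseteq> Y' \<or> Y' \<subseteq> Y" if "Y \<in> C" "Y' \<in> C" for Y Y'
      using C(2) that unfolding subset_chain_def by blast
    have "r \<le> d x y" if xy: "x \<in> \<Union> C" "y \<in> \<Union> C" "x \<noteq> y" for x y
    proof -
      obtain Y Y' where Y: "Y \<in> C" "x \<in> Y" "Y' \<in> C" "y \<in> Y'" using xy by blast
      then obtain Y'' where "Y'' \<in> C" "x \<in> Y''" "y \<in> Y''" using chain[OF Y(1,3)] by blast
      then show ?thesis using mem[of Y''] xy(3) unfolding \<A>_def by blast
    qed
    moreover have "\<Union> C \<subseteq> M" using mem unfolding \<A>_def by blast
    ultimately show "\<Union> C \<in> \<A> r" unfolding \<A>_def by blast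
  qed
  then have "\<forall>r. \<exists>S. S \<in> \<A> r \<and> (\<forall>S'\<in>\<A> r. S \<subseteq> S' \<longrightarrow> S' = S)" by blast
  from choice[OF this] obtain S where
    "\<forall>r. S r \<in> \<A> r \<and> (\<forall>S'\<in>\<A> r. S r \<subseteq> S' \<longrightarrow> S' = S r)" ..
  then have S: "\<And>r. S r \<in> \<A> r" "\<And>r S'. \<lbrakk>S' \<in> \<A> r; S r \<subseteq> S'\<rbrakk> \<Longrightarrow> S' = S r"
    by simp_all
  define T where "T k = S (inverse (real (Suc k)))" for k
  have T_mem: "T k \<in> \<A> (inverse (real (Suc k)))" for k unfolding T_def by (rule S(1))
  have T_M: "T k \<subseteq> M" for k using T_mem[of k] unfolding \<A>_def by blast
  have T_sep: "inverse (real (Suc k)) \<le> d x y" if "x \<in> T k" "y \<in> T k" "x \<noteq> y" for x y k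
    using T_mem[of k] that unfolding \<A>_def by blast
  have T_max: "\<exists>y\<in>T k. d x y < inverse (real (Suc k))" if x: "x \<in> M" for x k
  proof (rule ccontr)
    assume "\<not> ?thesis"
    then have far: "inverse (real (Suc k)) \<le> d x y" if "y \<in> T k" for y using that by force
    have far': "inverse (real (Suc k)) \<le> d y x" if "y \<in> T k" for y
      using far[OF that] commute[of x y] by simp
    have "insert x (T k) \<in> \<A> (inverse (real (Suc k)))"
      unfolding \<A>_def
    proof (intro CollectI conjI ballI impI)
      show "insert x (T k) \<subseteq> M" using x T_M by blast
      fix y y' assume y: "y \<in> insert x (T k)" "y' \<in> insert x (T k)" "y \<noteq> y'"
      then consider "y = x" "y' \<in> T k" | "y' = x" "y \<in> T k" | "y \<in> T k" "y' \<in> T k" by blast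
      then show "inverse (real (Suc k)) \<le> d y y'"
        by cases (use far far' T_sep y(3) in blast)+
    qed
    then have "insert x (T k) = T k" unfolding T_def by (intro S(2)) auto
    then have "x \<in> T k" by blast
    from far[OF this] mdist_zero[OF x] show False by simp
  qed
  have "\<exists>k. \<not> |T k| \<le>o \<mu>"
  proof (rule ccontr)
    assume "\<not> ?thesis"
    then have le: "\<forall>k\<in>UNIV. |T k| \<le>o \<mu>" by blast
    have "|UNIV :: nat set| \<le>o \<mu>"
      using card_of_nat \<mu>(2) ordIso_ordLeq_trans by blast
    from card_of_UNION_ordLeq_infinite_Field[OF fin \<mu>(1) this le]
    have "|\<Union>k\<in>UNIV. T k| \<le>o \<mu>" .
    moreover have "\<kappa> \<le>o |\<Union>k\<in>UNIV. T k|"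
    proof (rule density)
      show "(\<Union>k\<in>UNIV. T k) \<subseteq> M" using T_M by blast
      show "mtopology closure_of (\<Union>k\<in>UNIV. T k) = M"
        unfolding metric_closure_of
      proof (intro equalityI subsetI CollectI conjI allI impI)
        fix x and r :: real assume x: "x \<in> M" "0 < r"
        obtain k where "inverse (real (Suc k)) < r" using reals_Archimedean[OF x(2)] by blast
        moreover obtain y where "y \<in> T k" "d x y < inverse (real (Suc k))" using T_max[OF x(1)] by blast
        ultimately show "\<exists>y\<in>\<Union>k\<in>UNIV. T k. y \<in> mball x r"
          using x(1) T_M by (intro bexI[of _ y]) (auto simp: in_mball)
      qed auto
    qed
    ultimately have "\<kappa> \<le>o \<mu>" using ordLeq_transitive by blast
    with \<mu>(3) show False using not_ordLess_ordLeq by blast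
  qed
  then obtain k where "\<not> |T k| \<le>o \<mu>" ..
  then show thesis
    using that[of "T k" "inverse (real (Suc k))"] T_M T_sep by simp
qed

context structure_over
begin

text \<open>A nearly optimal point for an approximant \<psi> is nearly optimal for \<phi>. The
  factor 3 counts the change of the supremum, the choice of a and the change of the value at
  a.\<close>

lemma approx_Sup_witness:
  assumes fm: "is_fm L \<phi>" and \<psi>: "\<And>v. range v \<subseteq> X \<Longrightarrow> \<bar>fm_val M \<phi> v - \<psi> v\<bar> \<le> e"
    and "0 < e" and w: "range w \<subseteq> X"
  shows "\<exists>a. a \<in> X \<and> (SUP c\<in>X. \<psi> (w(x := c))) - e \<le> \<psi> (w(x := a))"
    and "\<lbrakk>a \<in> X; (SUP c\<in>X. \<psi> (w(x := c))) - e \<le> \<psi> (w(x := a))\<rbrakk> \<Longrightarrow>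
      fm_val M (SupF x \<phi>) w - 3 * e \<le> fm_val M \<phi> (w(x := a))"
proof -
  have upd: "range (w(x := c)) \<subseteq> X" if "c \<in> X" for c using w that by auto
  have "\<exists>y\<in>(\<lambda>c. \<psi> (w(x := c))) ` X. (SUP c\<in>X. \<psi> (w(x := c))) - e < y"
    by (rule less_cSupD) (use X_ne \<open>0 < e\<close> in auto)
  then show "\<exists>a. a \<in> X \<and> (SUP c\<in>X. \<psi> (w(x := c))) - e \<le> \<psi> (w(x := a))"
    using less_imp_le by blast
  assume a: "a \<in> X" "(SUP c\<in>X. \<psi> (w(x := c))) - e \<le> \<psi> (w(x := a))"
  have "\<bar>fm_val M (SupF x \<phi>) w - (SUP c\<in>X. \<psi> (w(x := c)))\<bar> \<le> e"
    unfolding fm_val.simps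
    by (rule SUP_diff_le[OF X_ne fm_val_bounds(1)[OF fm w]]) (rule \<psi>[OF upd])
  with a \<psi>[OF upd[OF a(1)]] show "fm_val M (SupF x \<phi>) w - 3 * e \<le> fm_val M \<phi> (w(x := a))"
    by linarith
qed

text \<open>The closure properties required of the family are all instances of closure under
  countably many operations on lists, which is what the greedy construction provides.\<close>

lemma definable_family_exists:
  assumes L: "countable_language L" and Z: "Z \<subseteq> tuples n X"
    and density_X: "density_character_is MS.mtopology \<kappa>"
    and density_Z: "density_character_is (Metric_space.mtopology Z (tuple_dist d)) \<mu>"
    and \<mu>: "Card_order \<mu>" "natLeq \<le>o \<mu>" "\<mu> <o \<kappa>"
  obtains F :: "(nat set \<Rightarrow> 'a) filter" and Fam C E D U e where
    "definable_family L M F Fam n Z D U E"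
    "|Fam| \<le>o cardSuc natLeq" "C \<subseteq> Fam" "|C| =o cardSuc natLeq" "0 < e"
    "\<And>g h. \<lbrakk>g \<in> C; h \<in> C; g \<noteq> h\<rbrakk> \<Longrightarrow> eventually (\<lambda>i. e \<le> d (g i) (h i)) F"
proof -
  have inf: "infinite (Field \<mu>)" by (rule infinite_Field_if_natLeq_ordLeq[OF \<mu>(1,2)])
  note small_countable = countable_imp_ordLeq[OF \<mu>(2)]
  interpret T: Metric_space "tuples n X" "tuple_dist d" by (rule Metric_space_tuples_X)
  interpret ZM: Metric_space Z "tuple_dist d" by (rule T.subspace[OF Z])
  obtain D where D: "D \<subseteq> Z" "ZM.mtopology closure_of D = Z" "|D| =o \<mu>"
    using density_Z unfolding density_character_is_def ZM.topspace_mtopology by blast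
  have "natLeq \<le>o |D|" using \<mu>(2) D(3) ordLeq_ordIso_trans ordIso_symmetric by blast
  then have "infinite D" using infinite_iff_natLeq_ordLeq by blast
  then obtain ds :: "nat \<Rightarrow> 'a list" where ds: "inj ds" "range ds \<subseteq> D"
    using infinite_countable_subset by blast
  have Z_ne: "Z \<noteq> {}" using \<open>infinite D\<close> D(1) by auto
  define U where "U = (\<Union>ys\<in>D. set ys)"
  have U_X: "U \<subseteq> X" using D(1) Z by (auto simp: U_def tuples_def)
  have U_small: "|U| \<le>o \<mu>"
    unfolding U_def
  proof (rule card_of_UNION_ordLeq_infinite_Field[OF inf \<mu>(1)])
    show "|D| \<le>o \<mu>" using D(3) ordIso_imp_ordLeq by blast
    show "\<forall>ys\<in>D. |set ys| \<le>o \<mu>" by (intro ballI small_countable countable_finite finite_set)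
  qed
  have dense_X: "\<kappa> \<le>o |B|" if "B \<subseteq> X" "MS.mtopology closure_of B = X" for B
    using density_X that unfolding density_character_is_def MS.topspace_mtopology by blast
  obtain S e where S: "S \<subseteq> X" "0 < e" "\<And>x y. \<lbrakk>x \<in> S; y \<in> S; x \<noteq> y\<rbrakk> \<Longrightarrow> e \<le> d x y" "\<not> |S| \<le>o \<mu>"
    by (rule MS.large_separated_set[OF dense_X \<mu>]) (assumption+, rule that, assumption+)
  obtain s0 where s0: "s0 \<in> S" using S(4) small_countable[of S] by fastforce
  have "\<not> S \<subseteq> U" using S(4) U_small card_of_mono1 ordLeq_transitive by blast
  then obtain z where z: "z \<in> X" "z \<notin> U" using S(1) by blast
  obtain a0 where a0: "a0 \<in> X" using X_ne by blast
  obtain \<Psi> where \<Psi>: "countable \<Psi>" "\<And>\<phi> r. \<lbrakk>is_fm L \<phi>; 0 < r\<rbrakk> \<Longrightarrow>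
      \<exists>\<psi>\<in>\<Psi>. \<forall>v. range v \<subseteq> X \<longrightarrow> \<bar>fm_val M \<phi> v - \<psi> v\<bar> \<le> r"
    using formulas_separable[OF L] by blast
  define asg where "asg xs m = (if m < length xs then xs ! m else a0)" for xs :: "'a list" and m
  define skop where "skop \<psi> x k xs = (SOME a. a \<in> X \<and>
      (SUP c\<in>X. \<psi> ((asg xs)(x := c))) - inverse (real (Suc k)) \<le> \<psi> ((asg xs)(x := a)))"
    for \<psi> :: "(nat \<Rightarrow> 'a) \<Rightarrow> real" and x k xs
  define near where "near k xs = (SOME ys. ys \<in> D \<and>
      tuple_dist d xs ys \<le> dist_to M Z xs + inverse (real (Suc k)))" for k xs
  \<comment> \<open>The near point map is split into its coordinates, since operations return single
    elements. The constants come from an infinite sequence in D.\<close>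
  define Ops where "Ops = fun_int M ` funs L \<union> (\<lambda>(\<psi>, x, k). skop \<psi> x k) ` (\<Psi> \<times> UNIV \<times> UNIV) \<union>
    range (\<lambda>(j, k) xs. near k xs ! j) \<union> range (\<lambda>(m, j) _. ds m ! j)"
  have "countable Ops"
    unfolding Ops_def using L \<Psi>(1) by (auto simp: countable_language_def)
  have "Ops \<noteq> {}" unfolding Ops_def by auto
  \<comment> \<open>Operations meet lists of every length, also where their results are unspecified,
    so results outside M are replaced by a0. By \<open>op\<close> below, this changes nothing where
    an operation stays in M.\<close>
  define G where "G k xs = (if from_nat_into Ops k xs \<in> X then from_nat_into Ops k xs else a0)" for k xs
  have G_X: "G k xs \<in> X" for k xs using a0 by (simp add: G_def)
  interpret gr: greedy S U "\<lambda>B. |B| \<le>o \<mu>" G z s0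
  proof
    show "|B| \<le>o \<mu>" if "B \<subseteq> B'" "|B'| \<le>o \<mu>" for B B' :: "'a set"
      using that card_of_mono1 ordLeq_transitive by blast
    show "|B \<union> B'| \<le>o \<mu>" if "|B| \<le>o \<mu>" "|B'| \<le>o \<mu>" for B B' :: "'a set"
      by (rule card_of_Un_ordLeq_infinite_Field[OF inf that \<mu>(1)])
    show "|\<Union>u\<in>U. H u| \<le>o \<mu>" if "\<And>u. u \<in> U \<Longrightarrow> |H u| \<le>o \<mu>" for H :: "'a \<Rightarrow> 'a set"
      using that by (intro card_of_UNION_ordLeq_infinite_Field[OF inf \<mu>(1) U_small]) blast
    show "|B| \<le>o \<mu>" if "finite B" for B :: "'a set"
      using that by (intro small_countable countable_finite)
  qed (use S z s0 in auto)
  obtain F :: "(nat set \<Rightarrow> 'a) filter" and Fam C E where fam: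
    "F \<noteq> bot" "\<And>P. eventually P F \<or> eventually (\<lambda>i. \<not> P i) F"
    "\<And>g i. g \<in> Fam \<Longrightarrow> g i \<in> X"
    "\<And>k gs. set gs \<subseteq> Fam \<Longrightarrow> (\<lambda>i. G k (vals i gs)) \<in> Fam"
    "|Fam| \<le>o cardSuc natLeq"
    "C \<subseteq> Fam" "|C| =o cardSuc natLeq" "\<And>g i. g \<in> C \<Longrightarrow> g i \<in> S"
    "\<And>g h. \<lbrakk>g \<in> C; h \<in> C; g \<noteq> h\<rbrakk> \<Longrightarrow> eventually (\<lambda>i. g i \<noteq> h i) F"
    "countable E"
    "\<And>g. g \<in> Fam \<Longrightarrow> eventually (\<lambda>i. g i \<notin> U) F \<or> (\<exists>u\<in>E. eventually (\<lambda>i. g i = u) F)"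
    by (rule gr.family_exists[OF S(1) U_X z(1) G_X]) (rule that, assumption+)
  have op: "(\<lambda>i. g (vals i gs)) \<in> Fam"
    if g: "g \<in> Ops" and gs: "set gs \<subseteq> Fam" and X: "\<And>i. g (vals i gs) \<in> X" for g gs
  proof -
    obtain k where k: "from_nat_into Ops k = g"
      using from_nat_into_surj[OF \<open>countable Ops\<close> g] by blast
    have "(\<lambda>i. G k (vals i gs)) = (\<lambda>i. g (vals i gs))"
      using X by (simp add: G_def k)
    with fam(4)[OF gs, of k] show ?thesis by simp
  qed
  have near: "near k xs \<in> D \<and> tuple_dist d xs (near k xs) \<le> dist_to M Z xs + inverse (real (Suc k))"
    if xs: "xs \<in> tuples n X" for k xs
  proof -
    \<comment> \<open>One half of the error replaces the infimum by a point of Z, the other replaces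
      that point by one of D.\<close>
    let ?r = "inverse (real (Suc k)) / 2"
    have r: "0 < ?r" by simp
    obtain ys where ys: "ys \<in> Z" "tuple_dist d xs ys < dist_to M Z xs + ?r"
      using dist_to_approx[OF Z_ne Z xs r] by blast
    have "ys \<in> ZM.mtopology closure_of D" using ys(1) D(2) by simp
    then obtain ys' where ys': "ys' \<in> D" "ys' \<in> ZM.mball ys ?r"
      unfolding ZM.metric_closure_of using r by blast
    have mem: "ys \<in> tuples n X" "ys' \<in> tuples n X" using ys(1) ys'(1) D(1) Z by blast+
    have "tuple_dist d xs ys' \<le> tuple_dist d xs ys + tuple_dist d ys ys'"
      by (rule T.triangle[OF xs mem])
    moreover have "tuple_dist d ys ys' < ?r" using ys'(2) by simp
    ultimately have "ys' \<in> D \<and> tuple_dist d xs ys' \<le> dist_to M Z xs + inverse (real (Suc k))"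
      using ys(2) ys'(1) by linarith
    then show ?thesis unfolding near_def by (rule someI)
  qed
  have "definable_family L M F Fam n Z D U E"
  proof unfold_locales
    show "F \<noteq> bot" "\<And>P. eventually P F \<or> eventually (\<lambda>i. \<not> P i) F" by (rule fam)+
    show "g i \<in> X" if "g \<in> Fam" for g i by (rule fam(3)[OF that])
    show "Fam \<noteq> {}" using fam(4)[of "[]"] by auto
    show "(\<lambda>i. fun_int M f (vals i gs)) \<in> Fam"
      if "f \<in> funs L" "set gs \<subseteq> Fam" "length gs = fun_arity L f" for f gs
    proof (rule op[OF _ that(2)])
      show "fun_int M f \<in> Ops" using that(1) unfolding Ops_def by blast
      show "fun_int M f (vals i gs) \<in> X" for i
        using that fam(3) by (intro fun_closed) auto
    qed
    show "\<exists>g\<in>Fam. \<forall>i. fm_val M (SupF x \<phi>) (\<lambda>n. v n i) - r \<le> fm_val M \<phi> ((\<lambda>n. v n i)(x := g i))"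
      if fm: "is_fm L \<phi>" and v: "\<And>n. v n \<in> Fam" and r: "0 < r" for \<phi> x r and v :: "nat \<Rightarrow> _"
    proof -
      obtain k where k: "inverse (real (Suc k)) < r / 3" using reals_Archimedean[of "r / 3"] r by auto
      have k0: "0 < inverse (real (Suc k))" by simp
      obtain \<psi> where \<psi>: "\<psi> \<in> \<Psi>" "\<And>v. range v \<subseteq> X \<Longrightarrow> \<bar>fm_val M \<phi> v - \<psi> v\<bar> \<le> inverse (real (Suc k))"
        using \<Psi>(2)[OF fm k0] by blast
      \<comment> \<open>Skolem operations take finite lists, so the assignment is cut off beyond the
        free variables of \<phi>.\<close>
      obtain N0 where N0: "fm_vars \<phi> \<subseteq> {..<N0}"
        using finite_nat_set_iff_bounded[of "fm_vars \<phi>"] by auto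
      define gs where "gs = map v [0..<N0]"
      have gs: "set gs \<subseteq> Fam" using v by (auto simp: gs_def)
      define w where "w i = asg (vals i gs)" for i
      have w_X: "range (w i) \<subseteq> X" for i
        using v fam(3) a0 by (auto simp: w_def asg_def gs_def)
      have w_eq: "w i m = v m i" if "m < N0" for i m
        using that by (simp add: w_def asg_def gs_def)
      define g where "g = (\<lambda>i. skop \<psi> x k (vals i gs))"
      have g: "g i \<in> X \<and> (SUP c\<in>X. \<psi> ((w i)(x := c))) - inverse (real (Suc k)) \<le> \<psi> ((w i)(x := g i))" for i
        unfolding g_def skop_def w_def[symmetric]
        by (rule someI_ex, rule approx_Sup_witness(1)[OF fm \<psi>(2) k0 w_X])
      have "g \<in> Fam"
        unfolding g_def
      proof (rule op[OF _ gs])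
        show "skop \<psi> x k \<in> Ops"
          unfolding Ops_def using \<psi>(1) by (intro UnI1 UnI2 image_eqI[of _ _ "(\<psi>, x, k)"]) auto
        show "skop \<psi> x k (vals i gs) \<in> X" for i using g unfolding g_def by blast
      qed
      moreover have "fm_val M (SupF x \<phi>) (\<lambda>n. v n i) - r \<le> fm_val M \<phi> ((\<lambda>n. v n i)(x := g i))" for i
      proof -
        have "fm_val M (SupF x \<phi>) (w i) - 3 * inverse (real (Suc k)) \<le> fm_val M \<phi> ((w i)(x := g i))"
          using approx_Sup_witness(2)[OF fm \<psi>(2) k0 w_X] g by blast
        moreover have "fm_val M (SupF x \<phi>) (w i) = fm_val M (SupF x \<phi>) (\<lambda>n. v n i)"
          using N0 w_eq by (intro fm_val_cong) auto
        moreover have "fm_val M \<phi> ((w i)(x := g i)) = fm_val M \<phi> ((\<lambda>n. v n i)(x := g i))"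
          using N0 w_eq by (intro fm_val_cong) auto
        ultimately show ?thesis using k by linarith
      qed
      ultimately show ?thesis by blast
    qed
    have "cardSuc natLeq \<le>o |UNIV :: nat set set|"
      using uncountable_nat_sets unfolding uncountable_iff_cardSuc_ordLeq .
    then show "|Fam| \<le>o |UNIV :: nat set set|" using fam(5) ordLeq_transitive by blast
    show "Z \<subseteq> tuples n X" "Z \<noteq> {}" "D \<subseteq> Z" by (rule Z Z_ne D)+
    show "set ys \<subseteq> U" if "ys \<in> D" for ys using that unfolding U_def by blast
    show "\<exists>hs. set hs \<subseteq> Fam \<and> length hs = n \<and> (\<forall>i. vals i hs \<in> D \<and>
        tuple_dist d (vals i fs) (vals i hs) \<le> dist_to M Z (vals i fs) + r)"
      if fs: "set fs \<subseteq> Fam" "length fs = n" and r: "0 < r" for fs r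
    proof -
      obtain k where k: "inverse (real (Suc k)) < r" using reals_Archimedean[OF r] by blast
      have fs_X: "vals i fs \<in> tuples n X" for i using fs fam(3) by (auto simp: tuples_def)
      define hs where "hs = map (\<lambda>j i. near k (vals i fs) ! j) [0..<n]"
      have len: "length (near k (vals i fs)) = n" "set (near k (vals i fs)) \<subseteq> X" for i
        using near[OF fs_X, of k i] D(1) Z by (auto simp: tuples_def)
      have hs: "vals i hs = near k (vals i fs)" for i
        by (rule nth_equalityI) (auto simp: hs_def len)
      have "(\<lambda>i. near k (vals i fs) ! j) \<in> Fam" if j: "j < n" for j
      proof (rule op[OF _ fs(1)])
        show "(\<lambda>xs. near k xs ! j) \<in> Ops"
          unfolding Ops_def by (intro UnI1 UnI2 range_eqI[of _ _ "(j, k)"]) auto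
        show "near k (vals i fs) ! j \<in> X" for i
          using len[of i] j nth_mem[of j "near k (vals i fs)"] by auto
      qed
      then have "set hs \<subseteq> Fam" by (auto simp: hs_def)
      moreover have "length hs = n" by (simp add: hs_def)
      moreover have "vals i hs \<in> D \<and>
        tuple_dist d (vals i fs) (vals i hs) \<le> dist_to M Z (vals i fs) + r" for i
        unfolding hs using near[OF fs_X, of k i] k by linarith
      ultimately show ?thesis by blast
    qed
    show "countable E" by (rule fam)
    show "eventually (\<lambda>i. g i \<notin> U) F \<or> (\<exists>u\<in>E. eventually (\<lambda>i. g i = u) F)" if "g \<in> Fam" for g
      by (rule fam(11)[OF that])
    have "(\<lambda>_. ds m ! j) \<in> Fam" if j: "j < n" for m j
    proof -
      have "ds m \<in> tuples n X" using ds(2) D(1) Z by blast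
      then have "ds m ! j \<in> X" using j by (auto simp: tuples_def)
      moreover have "(\<lambda>_. ds m ! j) \<in> Ops"
        unfolding Ops_def by (intro UnI2 range_eqI[of _ _ "(m, j)"]) auto
      ultimately show ?thesis using op[of "\<lambda>_. ds m ! j" "[]"] by simp
    qed
    with ds show "\<exists>ds :: nat \<Rightarrow> 'a list. inj ds \<and> range ds \<subseteq> D \<and> (\<forall>m. \<forall>j<n. (\<lambda>_. ds m ! j) \<in> Fam)"
      by blast
  qed
  moreover have "eventually (\<lambda>i. e \<le> d (g i) (h i)) F" if gh: "g \<in> C" "h \<in> C" "g \<noteq> h" for g h
    using fam(9)[OF gh] by eventually_elim (intro S(3) fam(8) gh)
  ultimately show thesis using that fam(5,6,7) S(2) by blast
qed

end

section \<open>Change of language\<close>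

lemma set1_fm_subset_funs: "is_fm L \<phi> \<Longrightarrow> set1_fm \<phi> \<subseteq> funs L"
proof (induction \<phi>)
  case (DistF s t)
  then show ?case using set_tm_subset_funs[of L s] set_tm_subset_funs[of L t] by auto
next
  case (PredF p ts)
  then show ?case using set_tm_subset_funs[of L] by fastforce
qed auto

lemma finite_set_tm [simp]: "finite (set_tm t)"
  by (induction t) auto

lemma finite_set1_fm [simp]: "finite (set1_fm \<phi>)"
  by (induction \<phi>) auto

lemma is_tm_map:
  assumes "is_tm L t" "\<And>f. \<lbrakk>f \<in> funs L; f \<in> set_tm t\<rbrakk> \<Longrightarrow> h f \<in> funs L' \<and> fun_arity L' (h f) = fun_arity L f"
  shows "is_tm L' (map_tm h t)"
  using assms
proof (induction t)
  case (Fn f ts)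
  have "is_tm L' (map_tm h t)" if "t \<in> set ts" for t
    by (rule Fn.IH[OF that]) (use Fn.prems that in auto)
  then show ?case using Fn.prems(1) Fn.prems(2)[of f] by auto
qed simp

text \<open>Since h is constrained only at symbols that occur in \<phi>, taking the identity for h
  also moves a formula into a smaller language.\<close>

lemma is_fm_map:
  assumes "is_fm L \<phi>" "\<And>f. \<lbrakk>f \<in> funs L; f \<in> set1_fm \<phi>\<rbrakk> \<Longrightarrow> h f \<in> funs L' \<and> fun_arity L' (h f) = fun_arity L f"
    and preds: "preds L' = preds L" "pred_arity L' = pred_arity L"
  shows "is_fm L' (map_fm h id \<phi>)"
  using assms(1,2)
proof (induction \<phi>)
  case (DistF s t)
  have "is_tm L' (map_tm h s)" "is_tm L' (map_tm h t)"
    by (rule is_tm_map[of L]; use DistF in simp)+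
  then show ?case by simp
next
  case (PredF p ts)
  have "is_tm L' (map_tm h t)" if "t \<in> set ts" for t
    by (rule is_tm_map[of L]) (use PredF that in auto)
  then show ?case using PredF preds by auto
next
  case (ConnF u \<phi>s)
  have "is_fm L' (map_fm h id \<phi>)" if "\<phi> \<in> set \<phi>s" for \<phi>
    by (rule ConnF.IH[OF that]) (use ConnF.prems that in auto)
  then show ?case using ConnF.prems(1) by (auto simp: id_def)
qed simp_all

lemma tm_vars_map [simp]: "tm_vars (map_tm h t) = tm_vars t"
  by (induction t) auto

lemma fm_vars_map [simp]: "fm_vars (map_fm h k \<phi>) = fm_vars \<phi>"
  by (induction \<phi>) auto

lemma tm_val_map:
  assumes "\<And>f xs. f \<in> set_tm t \<Longrightarrow> fun_int M' (h f) xs = fun_int M f xs"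
  shows "tm_val M' (map_tm h t) v = tm_val M t v"
  using assms
proof (induction t)
  case (Fn f ts)
  have "map (\<lambda>t. tm_val M' (map_tm h t) v) ts = map (\<lambda>t. tm_val M t v) ts"
    by (intro map_cong refl Fn.IH) (use Fn.prems in auto)
  moreover have "fun_int M' (h f) xs = fun_int M f xs" for xs
    using Fn.prems by simp
  ultimately show ?case by (simp only: tm.map tm_val.simps map_map comp_def)
qed simp

lemma fm_val_map:
  assumes "univ M' = univ M" "sdist M' = sdist M" "pred_int M' = pred_int M"
    and "\<And>f xs. f \<in> set1_fm \<phi> \<Longrightarrow> fun_int M' (h f) xs = fun_int M f xs"
  shows "fm_val M' (map_fm h id \<phi>) v = fm_val M \<phi> v"
  using assms(4)
proof (induction \<phi> arbitrary: v)
  case (DistF s t)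
  have "tm_val M' (map_tm h s) v = tm_val M s v" "tm_val M' (map_tm h t) v = tm_val M t v"
    by (rule tm_val_map; use DistF in simp)+
  then show ?case using assms(2) by simp
next
  case (PredF p ts)
  have "map (\<lambda>t. tm_val M' (map_tm h t) v) ts = map (\<lambda>t. tm_val M t v) ts"
    by (intro map_cong refl tm_val_map) (use PredF in auto)
  then show ?case by (simp only: fm.map fm_val.simps map_map comp_def assms(3) id_apply)
next
  case (ConnF u \<phi>s)
  have "map (\<lambda>\<phi>. fm_val M' (map_fm h id \<phi>) v) \<phi>s = map (\<lambda>\<phi>. fm_val M \<phi> v) \<phi>s"
    by (intro map_cong refl ConnF.IH) (use ConnF.prems in auto)
  then show ?case by (simp only: fm.map fm_val.simps length_map map_map comp_def)
next
  case (SupF x \<phi>)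
  have "fm_val M' (map_fm h id \<phi>) (v(x := a)) = fm_val M \<phi> (v(x := a))" for a
    by (rule SupF.IH) (use SupF.prems in simp)
  then show ?case using assms(1) by (simp add: id_def)
next
  case (InfF x \<phi>)
  have "fm_val M' (map_fm h id \<phi>) (v(x := a)) = fm_val M \<phi> (v(x := a))" for a
    by (rule InfF.IH) (use InfF.prems in simp)
  then show ?case using assms(1) by (simp add: id_def)
qed

section \<open>Naming parameters and forgetting the names\<close>

lemma struct_params_simps [simp]:
  "univ (struct_params M) = univ M" "sdist (struct_params M) = sdist M"
  "pred_int (struct_params M) = pred_int M"
  "fun_int (struct_params M) (Inl f) = fun_int M f" "fun_int (struct_params M) (Inr a) xs = a"
  by (simp_all add: struct_params_def)

lemma lang_params_simps [simp]:
  "funs (lang_params L A) = Inl ` funs L \<union> Inr ` A"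
  "fun_arity (lang_params L A) (Inl f) = fun_arity L f" "fun_arity (lang_params L A) (Inr a) = 0"
  "fun_modulus (lang_params L A) (Inl f) = fun_modulus L f" "fun_modulus (lang_params L A) (Inr a) r = 1"
  "preds (lang_params L A) = preds L" "pred_arity (lang_params L A) = pred_arity L"
  "pred_modulus (lang_params L A) = pred_modulus L"
  by (simp_all add: lang_params_def)

lemma is_language_lang_params: "is_language L \<Longrightarrow> is_language (lang_params L A)"
  by (auto simp: is_language_def is_modulus_def)

lemma countable_lang_params: "\<lbrakk>countable_language L; countable A\<rbrakk> \<Longrightarrow> countable_language (lang_params L A)"
  by (simp add: countable_language_def)

lemma is_structure_struct_params:
  assumes M: "is_structure L M" and A: "A \<subseteq> univ M"
  shows "is_structure (lang_params L A) (struct_params M)"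
proof -
  interpret Metric_space "univ M" "sdist M" using M by (simp add: is_structure_def)
  have "sdist M a a = 0" if "a \<in> A" for a using A that by auto
  with M A show ?thesis
    unfolding is_structure_def by (auto simp: tuples_def)
qed

definition reduct :: "('f + 'c, 'p, 'a) metric_structure \<Rightarrow> ('f, 'p, 'a) metric_structure" where
  "reduct M = \<lparr> univ = univ M, sdist = sdist M, fun_int = (\<lambda>f. fun_int M (Inl f)), pred_int = pred_int M \<rparr>"

lemma reduct_simps [simp]:
  "univ (reduct M) = univ M" "sdist (reduct M) = sdist M"
  "pred_int (reduct M) = pred_int M" "fun_int (reduct M) f = fun_int M (Inl f)"
  by (simp_all add: reduct_def)

lemma is_structure_reduct:
  assumes M: "is_structure (lang_params L A) M"
  shows "is_structure L (reduct M)"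
  using M unfolding is_structure_def by (auto simp: ball_Un)

lemma definable_predicate_cong:
  assumes "\<And>xs. xs \<in> tuples n (univ M) \<Longrightarrow> P xs = Q xs"
  shows "definable_predicate L M A n P \<longleftrightarrow> definable_predicate L M A n Q"
proof -
  have "uniform_limit (tuples n (univ M)) \<phi> P sequentially \<longleftrightarrow>
      uniform_limit (tuples n (univ M)) \<phi> Q sequentially" for \<phi>
    using assms by (intro uniform_limit_cong') auto
  moreover have "(\<forall>xs\<in>tuples n (univ M). P xs \<in> {0..1}) \<longleftrightarrow> (\<forall>xs\<in>tuples n (univ M). Q xs \<in> {0..1})"
    using assms by simp
  ultimately show ?thesis unfolding definable_predicate_def by (simp only:)
qed

theorem theorem10:
  fixes L :: "('f, 'p) language"
    and T :: "('f, 'p) fm set"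
    and \<kappa> :: "'k rel"
    and \<mu> :: "'l rel"
  assumes "is_language L"
    and "countable_language L"
    and "is_theory L T"
    and "Card_order \<kappa>"
    and "Card_order \<mu>"
    and "natLeq \<le>o \<mu>"
    and "\<mu> <o \<kappa>"
    and "\<exists>M :: ('f, 'p, 'a) metric_structure. two_cardinal_model L T \<kappa> \<mu> M"
  shows "\<exists>N :: ('f, 'p, real) metric_structure.
           two_cardinal_model L T (cardSuc natLeq) natLeq N"
proof -
  obtain M :: "('f, 'p, 'a) metric_structure" and n P where
    model: "is_model L T M" and
    dens: "density_character_is (Metric_space.mtopology (univ M) (sdist M)) \<kappa>" and
    P: "definable_distance_predicate L M (univ M) n P" and
    densP: "density_character_is (Metric_space.mtopology (zero_set M n P) (tuple_dist (sdist M))) \<mu>"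
    using assms(8) unfolding two_cardinal_model_def by blast
  define Z where "Z = zero_set M n P"
  have struct: "is_structure L M" using model by (simp add: is_model_def)
  have Z: "Z \<subseteq> tuples n (univ M)" and "definable_predicate L M (univ M) n (dist_to M Z)"
    using P unfolding definable_distance_predicate_def definable_set_def Z_def by blast+
  then obtain \<phi> where \<phi>: "\<And>k. is_fm (lang_params L (univ M)) (\<phi> k)" "\<And>k. fm_vars (\<phi> k) \<subseteq> {..<n}"
      "uniform_limit (tuples n (univ M)) (\<lambda>k xs. fm_val (struct_params M) (\<phi> k) (nth xs)) (dist_to M Z) sequentially"
    unfolding definable_predicate_def by blast
  \<comment> \<open>Countably many formulas mention countably many parameters. Naming just these
    keeps the language countable, as naming all of M need not.\<close>
  define A where "A = (\<Union>k. Inr -` set1_fm (\<phi> k))"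
  have A: "A \<subseteq> univ M"
    using set1_fm_subset_funs[OF \<phi>(1)] unfolding A_def by fastforce
  have "countable A"
    unfolding A_def by (intro countable_UN) (auto intro!: countable_finite finite_vimageI)
  let ?L = "lang_params L A" and ?M = "struct_params M"
  have L': "is_language ?L" "countable_language ?L"
    using assms(1,2) \<open>countable A\<close> by (auto intro: is_language_lang_params countable_lang_params)
  have \<phi>A: "is_fm ?L (\<phi> k)" for k
  proof -
    have "is_fm ?L (map_fm id id (\<phi> k))"
      by (rule is_fm_map[OF \<phi>(1)]) (auto simp: A_def)
    then show ?thesis by (simp add: fm.map_id)
  qed
  interpret st: structure_over ?L ?M
    by unfold_locales (rule L' is_structure_struct_params[OF struct A])+
  have dist_to: "dist_to ?M Z = dist_to M Z" by (simp add: dist_to_def fun_eq_iff)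
  have Z': "Z \<subseteq> tuples n (univ ?M)" using Z by simp
  have dens': "density_character_is st.MS.mtopology \<kappa>" using dens by simp
  have densZ': "density_character_is (Metric_space.mtopology Z (tuple_dist (sdist ?M))) \<mu>"
    using densP by (simp add: Z_def)
  obtain F :: "(nat set \<Rightarrow> 'a) filter" and Fam C E D U e where fam:
    "definable_family ?L ?M F Fam n Z D U E"
    "|Fam| \<le>o cardSuc natLeq" "C \<subseteq> Fam" "|C| =o cardSuc natLeq" "0 < e"
    "\<And>g h. \<lbrakk>g \<in> C; h \<in> C; g \<noteq> h\<rbrakk> \<Longrightarrow> eventually (\<lambda>i. e \<le> sdist ?M (g i) (h i)) F"
    by (rule st.definable_family_exists[OF L'(2) Z' dens' densZ' assms(5,6,7)]) (rule that, assumption+)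
  interpret df: definable_family ?L ?M F Fam n Z D U E by (rule fam)
  \<comment> \<open>The limit is formed in the language with names for A; the model of T is obtained
    by forgetting these names.\<close>
  define N where "N = reduct df.N"
  have N_struct: "is_structure L N"
    unfolding N_def by (rule is_structure_reduct[OF df.structure_N])
  have N_simps: "univ N = univ df.N" "sdist N = sdist df.N" "pred_int N = pred_int df.N"
      "fun_int N f = fun_int df.N (Inl f)" for f
    by (simp_all add: N_def del: df.N_simps)
  have "is_model L T N"
    unfolding is_model_def
  proof (intro conjI N_struct ballI allI impI)
    fix \<theta> and v :: "nat \<Rightarrow> real" assume \<theta>: "\<theta> \<in> T" and v: "range v \<subseteq> univ N"
    have "is_fm L \<theta>" using assms(3) \<theta> by (simp add: is_theory_def)
    then have "is_fm ?L (map_fm Inl id \<theta>)" by (rule is_fm_map) auto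
    moreover have "range v \<subseteq> univ df.N" using v by (simp only: N_simps)
    ultimately have "((\<lambda>i. fm_val ?M (map_fm Inl id \<theta>) (\<lambda>n. df.dec (v n) i)) \<longlongrightarrow>
        fm_val df.N (map_fm Inl id \<theta>) v) F"
      by (rule df.fm_val_N_tendsto)
    moreover have "fm_val ?M (map_fm Inl id \<theta>) w = fm_val M \<theta> w" for w
      by (rule fm_val_map) simp_all
    moreover have "fm_val M \<theta> (\<lambda>n. df.dec (v n) i) = 0" for i
      using model \<theta> df.range_dec[of v i] unfolding is_model_def by simp
    ultimately have "((\<lambda>_. 0) \<longlongrightarrow> fm_val df.N (map_fm Inl id \<theta>) v) F" by simp
    then have "fm_val df.N (map_fm Inl id \<theta>) v = 0"
      using tendsto_unique[OF df.F_ne _ tendsto_const] by blast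
    moreover have "fm_val df.N (map_fm Inl id \<theta>) v = fm_val N \<theta> v"
      by (rule fm_val_map) (simp_all add: N_def del: df.N_simps)
    ultimately show "fm_val N \<theta> v = 0" by simp
  qed
  moreover have "density_character_is (Metric_space.mtopology (univ N) (sdist N)) (cardSuc natLeq)"
    unfolding N_simps by (rule df.density_N[OF fam(2-6)])
  moreover have "definable_distance_predicate L N (univ N) n df.PN"
  proof -
    \<comment> \<open>The names for A are replaced by parameters from \<open>N\<close>, namely their
      interpretations in the limit structure.\<close>
    define h :: "'f + 'a \<Rightarrow> 'f + real" where "h = case_sum Inl (\<lambda>a. Inr (fun_int df.N (Inr a) []))"
    define \<theta> where "\<theta> k = map_fm h id (\<phi> k)" for k
    have "is_fm (lang_params L (univ N)) (\<theta> k)" for k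
      unfolding \<theta>_def
    proof (rule is_fm_map[OF \<phi>A])
      fix f assume f: "f \<in> funs ?L"
      show "h f \<in> funs (lang_params L (univ N)) \<and> fun_arity (lang_params L (univ N)) (h f) = fun_arity ?L f"
      proof (cases f)
        case (Inr a)
        then have "fun_int df.N f [] \<in> univ df.N"
          using f by (intro df.N.fun_closed) auto
        then show ?thesis using Inr unfolding N_simps(1) by (simp add: h_def del: df.N_simps)
      qed (use f in \<open>auto simp: h_def\<close>)
    qed simp_all
    moreover have "fm_vars (\<theta> k) \<subseteq> {..<n}" for k using \<phi>(2) by (simp add: \<theta>_def)
    moreover have "uniform_limit (tuples n (univ N)) (\<lambda>k xs. fm_val (struct_params N) (\<theta> k) (nth xs)) df.PN sequentially"
    proof -
      have "fm_val (struct_params N) (\<theta> k) v = fm_val df.N (\<phi> k) v" for k v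
        unfolding \<theta>_def
      proof (rule fm_val_map)
        fix f xs
        show "fun_int (struct_params N) (h f) xs = fun_int df.N f xs"
          by (cases f) (simp_all add: h_def N_def)
      qed (simp_all add: N_def del: df.N_simps)
      moreover have "uniform_limit (tuples n (univ df.N)) (\<lambda>k xs. fm_val df.N (\<phi> k) (nth xs)) df.PN sequentially"
        using \<phi>(3) by (intro df.definable_limit[OF \<phi>A \<phi>(2)]) (simp add: dist_to)
      ultimately show ?thesis by (simp only: N_simps)
    qed
    moreover have "df.PN xs \<in> {0..1}" for xs
      unfolding df.PN_def by (rule df.fdist_to_range)
    ultimately have PN: "definable_predicate L N (univ N) n df.PN"
      unfolding definable_predicate_def by blast
    have zero: "zero_set N n df.PN = df.ZN"
      unfolding df.ZN_def zero_set_def N_simps ..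
    have "dist_to N df.ZN xs = df.PN xs" if "xs \<in> tuples n (univ N)" for xs
    proof -
      have "dist_to N df.ZN = dist_to df.N df.ZN" unfolding dist_to_def N_simps ..
      then show ?thesis using df.dist_to_ZN that unfolding N_simps by simp
    qed
    then have "definable_predicate L N (univ N) n (dist_to N df.ZN)"
      using PN definable_predicate_cong by blast
    then show ?thesis
      unfolding definable_distance_predicate_def definable_set_def zero
      using PN df.ZN_sub unfolding N_simps by blast
  qed
  moreover have "density_character_is (Metric_space.mtopology (zero_set N n df.PN) (tuple_dist (sdist N))) natLeq"
  proof -
    have "zero_set N n df.PN = df.ZN"
      unfolding df.ZN_def zero_set_def N_simps ..
    then show ?thesis using df.density_ZN by (simp only: N_simps)
  qed
  ultimately show ?thesis
    unfolding two_cardinal_model_def by blast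
qed

end
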